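(* Let $n,r\in\mathbb{N}_0$ with $n\geq 2$, let $\nu>0$, let $v\in C^r([0,\infty),C^\infty(\mathbb{T}^n)^n)$ be a periodic real function with $\mathrm{div}\, v(x,t)=0$ for all $t\in[0,\infty)$, and let $u_0\in C^\infty(\mathbb{T}^n)^n$ with $\mathrm{div}\, u_0=0$. Then the initial value problem \[\partial_t u(x,t)=\nu\Delta u(x,t)+\mathbb{P}[v(x,t)\cdot\nabla u(x,t)],\qquad u(x,0)=u_0(x),\] has a unique smooth solution $u\in C^{r+1}([0,\infty),C^\infty(\mathbb{T}^n)^n)$. It fulfills \[\int_{\mathbb{T}^n}u(x,t)\,\mathrm{d}x=\int_{\mathbb{T}^n}u_0(x)\,\mathrm{d}x\] for all $t\in[0,\infty)$, and it fulfills the bounds \[\|u(\cdot,t)\|_{\mathsf{A},0}\leq\|u_0\|_{\mathsf{A},0}\cdot\exp\left(\frac{1}{4\nu}\int_0^t\|v(\cdot,s)\|_{\mathsf{A},0}^2\,\mathrm{d}s\right),\] \[\|u(\cdot,t)\|_{\mathsf{A},1}\leq\|u_0\|_{\mathsf{A},1}\cdot\exp\left(\int_0^t\|v(\cdot,s)\|_{\mathsf{A},1}\,\mathrm{d}s+\frac{1}{4\nu}\int_0^t\|v(\cdot,s)\|_{\mathsf{A},0}^2\,\mathrm{d}s\right),\] and for all integers $d\geq 2$ the bounds \[\|u(\cdot,t)\|_{\mathsf{A},d}\leq\exp\left(\frac{1}{4\nu}\int_0^t\|v(\cdot,s)\|_{\mathsf{A},0}^2\,\mathrm{d}s+d\int_0^t\|v(\cdot,s)\|_{\mathsf{A},1}\,\mathrm{d}s\right)\cdot\left(\|u_0\|_{\mathsf{A},d}+\sum_{j=2}^d\binom{d}{j}\int_0^t\|v(\cdot,s)\|_{\mathsf{A},j}\,\mathrm{d}s\cdot\sup_{s\in[0,t]}\|u(\cdot,s)\|_{\mathsf{A},d+1-j}\right)\]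 for all $t\in[0,\infty)$. If $\|v(\cdot,t)\|_{\mathsf{A},0}+\delta\leq\nu$ for all $t\in[0,\tau]$ with $\tau\geq 0$ and $\delta\geq 0$, then \[\|u(\cdot,t)\|_{\mathsf{A},0}\leq\|u_0\|_{\mathsf{A},0}\cdot e^{-\delta t}\] and \[\|u(\cdot,t)\|_{\mathsf{A},1}\leq\|u_0\|_{\mathsf{A},1}\cdot\exp\left(\int_0^t\|v(\cdot,s)\|_{\mathsf{A},1}\,\mathrm{d}s-\delta t\right)\] for all $t\in[0,\tau]$.
   Context: $\mathbb{T}:=\mathbb{R}/(2\pi\mathbb{Z})$ and $\mathbb{N}_0=\{0,1,2,\dots\}$. $C^\infty(\mathbb{T}^n)^n=C^\infty(\mathbb{T}^n,\mathbb{R}^n)$ is the space of smooth $\mathbb{R}^n$-valued functions on $\mathbb{T}^n$. For an interval $I\subseteq[0,\infty)$, $C^d(I,C^\infty(\mathbb{T}^n)^n)$ denotes the set of functions $f:\mathbb{T}^n\times I\to\mathbb{R}^n$ which are $C^d$ in $t\in I$ and $C^\infty$ in $x\in\mathbb{T}^n$. The divergence, $\nabla$ and $\Delta$ are taken in $x$, and $v\cdot\nabla u=\sum_{j=1}^n v_j\,\partial_j u$ (componentwise in $u$). $f\in C^\infty(\mathbb{T}^n)^n$ is expanded into its Fourier series $f(x)=\sum_{k\in\mathbb{Z}^n}f_k e^{ik\cdot x}$ with $f_k\in\mathbb{C}^n$. The Leray projector $\mathbb{P}$ acts by $\mathbb{P}f(x)=\sum_{k\in\mathbb{Z}^n}\mathbb{P}_kf_k\,e^{ik\cdot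 x}$, where $\mathbb{P}_0:=\mathrm{id}$ and, for $k\neq 0$, $\mathbb{P}_k$ is the orthogonal projection of $\mathbb{C}^n$ onto the orthogonal complement of $k$, i.e. $\mathbb{P}_k=\mathrm{id}-\frac{1}{|k|^2}kk^T$. For $d\in\mathbb{N}_0$ and $f\in C^\infty(\mathbb{T}^n)^n$ set $\|f\|_{\mathsf{A},d}:=\sum_{k\in\mathbb{Z}^n\setminus\{0\}}|k|^d\,|f_k|$, where $|\cdot|$ is the $l^2$-norm (Euclidean norm) on $\mathbb{C}^n\supseteq\mathbb{Z}^n$. For time-dependent functions the seminorm is taken in $x$ at fixed time. *)

theory Defs
  imports "HOL-Analysis.Analysis"
begin

text \<open>Functions on the torus \<open>(\<real>/2\<pi>\<int>)\<^sup>n\<close> are represented by functions on \<open>\<real>\<^sup>n\<close> that are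
  \<open>2\<pi>\<close>-periodic in every coordinate; \<open>n\<close> is the cardinality of the index type \<open>'n\<close>.\<close>

definition periodic_2pi :: "(real^'n \<Rightarrow> 'b) \<Rightarrow> bool" where
  "periodic_2pi f \<longleftrightarrow> (\<forall>x i. f (x + axis i (2 * pi)) = f x)"

definition torus_cell :: "(real^'n) set" where
  "torus_cell = cbox 0 (\<chi> i. 2 * pi)"

definition partial :: "'n \<Rightarrow> (real^'n \<Rightarrow> 'b::real_normed_vector) \<Rightarrow> real^'n \<Rightarrow> 'b" where
  "partial j f x = vector_derivative (\<lambda>h. f (x + h *\<^sub>R axis j 1)) (at 0)"

definition partially_differentiable :: "(real^'n \<Rightarrow> 'b::real_normed_vector) \<Rightarrow> bool" where
  "partially_differentiable f \<longleftrightarrow> (\<forall>j x. (\<lambda>h. f (x + h *\<^sub>R axis j 1)) differentiable (at 0))"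

primrec partials :: "'n list \<Rightarrow> (real^'n \<Rightarrow> 'b::real_normed_vector) \<Rightarrow> real^'n \<Rightarrow> 'b" where
  "partials [] f = f"
| "partials (j # js) f = partial j (partials js f)"

definition smooth_torus :: "(real^'n \<Rightarrow> 'b::real_normed_vector) \<Rightarrow> bool" where
  "smooth_torus f \<longleftrightarrow> periodic_2pi f \<and>
     (\<forall>js. partially_differentiable (partials js f) \<and> continuous_on UNIV (partials js f))"

text \<open>Time-dependent functions are written \<open>f t x\<close>. The time derivative is taken within the
  interval \<open>I\<close>, hence one-sided at an endpoint belonging to \<open>I\<close>.\<close>

definition time_deriv ::
  "real set \<Rightarrow> (real \<Rightarrow> real^'n \<Rightarrow> 'b::real_normed_vector) \<Rightarrow> real \<Rightarrow> real^'n \<Rightarrow> 'b" where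
  "time_deriv I f t x = vector_derivative (\<lambda>s. f s x) (at t within I)"

text \<open>The space \<open>C\<^sup>d(I, C\<^sup>\<infinity>(T\<^sup>n))\<close>: the time derivatives of order up to \<open>d\<close> exist, they are smooth
  and periodic in \<open>x\<close>, and all their spatial derivatives are jointly continuous in \<open>(t, x)\<close> on
  \<open>I \<times> \<real>\<^sup>n\<close>. On an interval this is the usual notion of a \<open>C\<^sup>d\<close> map from \<open>I\<close> to the Frechet
  space \<open>C\<^sup>\<infinity>(T\<^sup>n)\<close>. Values of \<open>f t\<close> for \<open>t\<close> outside \<open>I\<close> are irrelevant.\<close>

definition Cd_smooth ::
  "nat \<Rightarrow> real set \<Rightarrow> (real \<Rightarrow> real^'n \<Rightarrow> 'b::real_normed_vector) \<Rightarrow> bool" where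
  "Cd_smooth d I f \<longleftrightarrow>
     (\<forall>j<d. \<forall>t\<in>I. \<forall>x. (\<lambda>s. (time_deriv I ^^ j) f s x) differentiable (at t within I)) \<and>
     (\<forall>j\<le>d. \<forall>t\<in>I. smooth_torus ((time_deriv I ^^ j) f t)) \<and>
     (\<forall>j\<le>d. \<forall>js. continuous_on (I \<times> UNIV)
        (\<lambda>(t, x). partials js ((time_deriv I ^^ j) f t) x))"

definition divergence :: "(real^'n \<Rightarrow> real^'n) \<Rightarrow> real^'n \<Rightarrow> real" where
  "divergence f x = (\<Sum>j\<in>UNIV. partial j f x $ j)"

definition laplacian :: "(real^'n \<Rightarrow> real^'n) \<Rightarrow> real^'n \<Rightarrow> real^'n" where
  "laplacian f x = (\<Sum>j\<in>UNIV. partial j (partial j f) x)"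

definition advection :: "(real^'n \<Rightarrow> real^'n) \<Rightarrow> (real^'n \<Rightarrow> real^'n) \<Rightarrow> real^'n \<Rightarrow> real^'n" where
  "advection v u x = (\<Sum>j\<in>UNIV. (v x $ j) *\<^sub>R partial j u x)"

definition real_freq :: "int^'n \<Rightarrow> real^'n" where
  "real_freq k = (\<chi> i. real_of_int (k $ i))"

definition fourier_coeff :: "(real^'n \<Rightarrow> real^'n) \<Rightarrow> int^'n \<Rightarrow> complex^'n" where
  "fourier_coeff f k = (\<chi> i. of_real (1 / (2 * pi) ^ CARD('n)) *
     integral torus_cell (\<lambda>x. of_real (f x $ i) * cis (- (real_freq k \<bullet> x))))"

definition leray_symbol :: "int^'n \<Rightarrow> complex^'n \<Rightarrow> complex^'n" where
  "leray_symbol k w = (if k = 0 then w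
     else w - (of_real (1 / (norm (real_freq k))\<^sup>2) * (\<Sum>j\<in>UNIV. of_int (k $ j) * w $ j))
              *s (\<chi> i. of_int (k $ i)))"

definition leray_series :: "(real^'n \<Rightarrow> real^'n) \<Rightarrow> real^'n \<Rightarrow> complex^'n" where
  "leray_series f x =
     (\<chi> i. \<Sum>\<^sub>\<infinity>k\<in>UNIV. leray_symbol k (fourier_coeff f k) $ i * cis (real_freq k \<bullet> x))"

text \<open>The Leray projection of a real field is real, see \<open>leray_series_real\<close> below; the real part
  only changes the type.\<close>

definition leray :: "(real^'n \<Rightarrow> real^'n) \<Rightarrow> real^'n \<Rightarrow> real^'n" where
  "leray f x = (\<chi> i. Re (leray_series f x $ i))"

text \<open>The Fourier coefficients of a smooth periodic function decay rapidly, so for such functions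
  the series below converges absolutely; otherwise \<open>infsum\<close> may return the default value 0.\<close>

definition normA :: "nat \<Rightarrow> (real^'n \<Rightarrow> real^'n) \<Rightarrow> real" where
  "normA d f = (\<Sum>\<^sub>\<infinity>k\<in>UNIV - {0}. norm (real_freq k) ^ d * norm (fourier_coeff f k))"

definition ivp_solution ::
  "real \<Rightarrow> nat \<Rightarrow> (real \<Rightarrow> real^'n \<Rightarrow> real^'n) \<Rightarrow> (real^'n \<Rightarrow> real^'n) \<Rightarrow>
   (real \<Rightarrow> real^'n \<Rightarrow> real^'n) \<Rightarrow> bool" where
  "ivp_solution \<nu> r v u0 u \<longleftrightarrow>
     Cd_smooth (Suc r) {0..} u \<and>
     (\<forall>t\<ge>0. \<forall>x. ((\<lambda>s. u s x) has_vector_derivative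
        (\<nu> *\<^sub>R laplacian (u t) x + leray (advection (v t) (u t)) x)) (at t within {0..})) \<and>
     (\<forall>x. u 0 x = u0 x)"

lemma integral_cnj_eq: "integral S (\<lambda>x. cnj (g x)) = cnj (integral S g)"
proof (cases "g integrable_on S")
  case True
  then show ?thesis
    using integral_linear[OF True bounded_linear_cnj] by (simp add: o_def)
next
  case False
  have "\<not> (\<lambda>x. cnj (g x)) integrable_on S"
    using integrable_linear[OF _ bounded_linear_cnj, of "\<lambda>x. cnj (g x)" S] False
    by (auto simp: o_def)
  with False show ?thesis
    by (simp add: not_integrable_integral)
qed

lemma real_freq_uminus: "real_freq (- k) = - real_freq k"
  by (simp add: real_freq_def vec_eq_iff)

lemma fourier_coeff_uminus: "fourier_coeff f (- k) $ i = cnj (fourier_coeff f k $ i)"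
  by (simp add: fourier_coeff_def real_freq_uminus cis_cnj flip: integral_cnj_eq)

lemma leray_symbol_uminus:
  "leray_symbol (- k) (fourier_coeff f (- k)) $ i = cnj (leray_symbol k (fourier_coeff f k) $ i)"
proof (cases "k = 0")
  case True
  show ?thesis
    using fourier_coeff_uminus[of f k i] unfolding leray_symbol_def True minus_zero if_P[OF refl] .
next
  case False
  then show ?thesis
    by (simp add: leray_symbol_def real_freq_uminus fourier_coeff_uminus sum_negf)
qed

lemma leray_series_real: "leray_series f x $ i \<in> \<real>"
proof -
  let ?g = "\<lambda>k. leray_symbol k (fourier_coeff f k) $ i * cis (real_freq k \<bullet> x)"
  have "infsum ?g UNIV = infsum (?g \<circ> uminus) UNIV"
    by (subst infsum_reindex[symmetric]) (auto simp: surj_def intro: exI[of _ "- _"])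
  also have "?g \<circ> uminus = (\<lambda>k. cnj (?g k))"
    by (simp add: fun_eq_iff leray_symbol_uminus real_freq_uminus cis_cnj)
  also have "infsum (\<lambda>k. cnj (?g k)) UNIV = cnj (infsum ?g UNIV)"
    by (rule infsum_cnj)
  finally have "infsum ?g UNIV \<in> \<real>"
    unfolding Reals_cnj_iff by (rule sym)
  then show ?thesis
    by (simp only: leray_series_def vec_lambda_beta)
qed

end

theory Submission
  imports Defs
begin

text \<open>
  On the Fourier side the problem is an infinite system of ordinary differential equations. With
  \<open>a\<close> the coefficients of \<open>v\<close>, \<open>c\<close> those of \<open>u\<close> and \<open>P\<^sub>k\<close> the symbol of the Leray projection,
  it reads \<open>c\<^sub>k' = - \<nu> |k|\<^sup>2 c\<^sub>k + P\<^sub>k \<Sum>\<^sub>l i (a\<^sub>l \<bullet> k) c\<^sub>k\<^sub>-\<^sub>l\<close>; since \<open>v\<close> is divergence free,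
  \<open>a\<^sub>l \<bullet> k = a\<^sub>l \<bullet> (k - l)\<close>. All norms in the theorem are weighted sums of \<open>|c\<^sub>k|\<close>, so the whole
  argument takes place in this system, among families that decay faster than every power of
  \<open>|k|\<close>, locally uniformly in time.

  \<^bold>\<open>Translation.\<close> A smooth periodic function has rapidly decaying coefficients, because a partial
  derivative multiplies them by \<open>i k\<^sub>j\<close> (\<open>fourier_coeff_partial\<close>, \<open>Cd_rapid_fourier_coeff\<close>), and
  conversely a rapidly decaying family can be summed and differentiated term by term
  (\<open>Cd_smooth_synth\<close>). The two operations are inverse to each other by the orthogonality of the
  exponentials and by their completeness, which comes from the Stone-Weierstrass theorem
  (\<open>synth_fourier_coeff\<close>, \<open>fourier_coeff_synth\<close>). Products become convolutions
  (\<open>fourier_coeff_advection\<close>).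

  \<^bold>\<open>Bounds.\<close> In the derivative of \<open>|c\<^sub>k|\<close> the projection can be dropped, being an orthogonal
  projection, and so can the mean \<open>a\<^sub>0\<close>, which is real and only rotates the phase of \<open>c\<^sub>k\<close>
  (\<open>inner_transport_le\<close>). Hence \<open>|c\<^sub>k|' \<le> - \<nu> |k|\<^sup>2 |c\<^sub>k| + \<Sum>\<^sub>l |a\<^sub>l| |k - l| |c\<^sub>k\<^sub>-\<^sub>l|\<close>, where \<open>l \<noteq> 0\<close>.
  Multiplying by \<open>|k|\<^sup>d \<le> (|l| + |k - l|)\<^sup>d\<close> and summing over \<open>k\<close> gives terms
  \<open>binomial d j * \<parallel>a\<parallel>\<^sub>j \<parallel>c\<parallel>\<^sub>d\<^sub>+\<^sub>1\<^sub>-\<^sub>j\<close> (\<open>infsum_interaction_le\<close>). The term \<open>j = 0\<close> has one derivative too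
  many. It is absorbed by the viscosity mode by mode as soon as \<open>\<parallel>a\<parallel>\<^sub>0 x - \<nu> x\<^sup>2 \<le> \<kappa>\<close> for all
  \<open>x \<ge> 1\<close>: the choice \<open>\<kappa> = \<parallel>a\<parallel>\<^sub>0\<^sup>2 / (4 \<nu>)\<close> is always possible, and \<open>\<kappa> = - \<delta>\<close> is possible if
  \<open>\<parallel>a\<parallel>\<^sub>0 + \<delta> \<le> \<nu>\<close>. The term \<open>j = 1\<close> adds \<open>d \<parallel>a\<parallel>\<^sub>1\<close> to the growth rate and the others are source
  terms (\<open>a_priori_bound\<close>, \<open>normA_bound\<close>). All bounds of the theorem are instances.

  \<^bold>\<open>Uniqueness.\<close> The system is linear, the bound for \<open>d = 0\<close> applied to a difference of two
  solutions shows that it has no modes \<open>k \<noteq> 0\<close>, and the mode \<open>k = 0\<close>, the mean, is constant in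
  time (\<open>fourier_solution_unique\<close>, \<open>fourier_solution_zero_mode\<close>).

  \<^bold>\<open>Existence.\<close> Picard iteration for Duhamel's formula: the derivative costs a factor \<open>|k|\<close> and
  the heat kernel gains \<open>\<nu> |k|\<^sup>2 + \<rho>\<close> against functions growing like \<open>exp (\<rho> t)\<close>. The quotient is
  as small as desired for large \<open>\<rho>\<close>, so that the increments of the iteration decrease like
  \<open>2\<^sup>-\<^sup>p\<close> with every weight and on every time interval (\<open>picard_bound\<close>). The limit is smooth in
  \<open>x\<close>, its regularity in time is read off from the equation (\<open>Cd_rapid_fourier_solution\<close>), and it
  is real because the reflected conjugate family solves the same problem
  (\<open>hermitian_fourier_solution\<close>).
\<close>

section \<open>Absolutely convergent series of functions\<close>

text \<open>A summable majorant that does not depend on the point gives uniform convergence, and with it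
  the exchange of the sum with integrals and limits. Differentiation is reduced to integration by
  the fundamental theorem of calculus, which works for sums over any index set.\<close>

lemma has_sum_integral_termwise:
  fixes f :: "'i \<Rightarrow> 'a::euclidean_space \<Rightarrow> 'c::banach"
  assumes cont: "\<And>i. continuous_on (cbox a b) (f i)"
    and bound: "\<And>i x. i \<in> X \<Longrightarrow> x \<in> cbox a b \<Longrightarrow> norm (f i x) \<le> M i"
    and M: "M summable_on X"
  shows "((\<lambda>i. integral (cbox a b) (f i)) has_sum
           integral (cbox a b) (\<lambda>x. \<Sum>\<^sub>\<infinity>i\<in>X. f i x)) X"
proof -
  have u: "uniform_limit (cbox a b) (\<lambda>F x. \<Sum>i\<in>F. f i x) (\<lambda>x. \<Sum>\<^sub>\<infinity>i\<in>X. f i x)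
      (finite_subsets_at_top X)"
    using bound M by (rule Weierstrass_m_test_general)
  obtain I J where I: "\<And>F. ((\<lambda>x. \<Sum>i\<in>F. f i x) has_integral I F) (cbox a b)"
    and J: "((\<lambda>x. \<Sum>\<^sub>\<infinity>i\<in>X. f i x) has_integral J) (cbox a b)"
    and IJ: "(I \<longlongrightarrow> J) (finite_subsets_at_top X)"
    by (rule uniform_limit_integral_cbox[OF u]) (auto intro!: continuous_intros cont)
  have "I F = (\<Sum>i\<in>F. integral (cbox a b) (f i))" for F
  proof (cases "finite F")
    case True
    then show ?thesis
      using integral_unique[OF I[of F]]
      by (simp add: integral_sum integrable_continuous cont)
  next
    case False
    then show ?thesis using integral_unique[OF I[of F]] by simp
  qed
  then have "I = sum (\<lambda>i. integral (cbox a b) (f i))" by (rule ext)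
  then show ?thesis
    using IJ integral_unique[OF J] by (simp add: has_sum_def)
qed

lemma continuous_on_infsum:
  fixes f :: "'i \<Rightarrow> 'a::topological_space \<Rightarrow> 'c::banach"
  assumes cont: "\<And>i. i \<in> X \<Longrightarrow> continuous_on S (f i)"
    and bound: "\<And>i x. i \<in> X \<Longrightarrow> x \<in> S \<Longrightarrow> norm (f i x) \<le> M i"
    and M: "M summable_on X"
  shows "continuous_on S (\<lambda>x. \<Sum>\<^sub>\<infinity>i\<in>X. f i x)"
proof (rule uniform_limit_theorem)
  show "uniform_limit S (\<lambda>F x. \<Sum>i\<in>F. f i x) (\<lambda>x. \<Sum>\<^sub>\<infinity>i\<in>X. f i x) (finite_subsets_at_top X)"
    using bound M by (rule Weierstrass_m_test_general)
  show "\<forall>\<^sub>F F in finite_subsets_at_top X. continuous_on S (\<lambda>x. \<Sum>i\<in>F. f i x)"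
    by (rule eventually_finite_subsets_at_top_weakI) (auto intro!: continuous_intros cont)
qed simp

lemma summable_on_of_norm_le:
  fixes f :: "'i \<Rightarrow> 'c::banach"
  assumes "M summable_on X" "\<And>i. i \<in> X \<Longrightarrow> norm (f i) \<le> M i"
  shows "f summable_on X"
  using abs_summable_summable[OF Infinite_Sum.abs_summable_on_comparison_test'[OF assms]] by simp

lemma norm_infsum_le_infsum:
  fixes f :: "'i \<Rightarrow> 'c::banach"
  assumes M: "M summable_on X" and le: "\<And>i. i \<in> X \<Longrightarrow> norm (f i) \<le> M i"
  shows "norm (\<Sum>\<^sub>\<infinity>i\<in>X. f i) \<le> (\<Sum>\<^sub>\<infinity>i\<in>X. M i)"
  by (rule norm_infsum_le[OF has_sum_infsum[OF summable_on_of_norm_le[OF M le]]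
        has_sum_infsum[OF M] le])

lemma has_sum_sum:
  fixes f :: "'j \<Rightarrow> 'i \<Rightarrow> 'c::topological_comm_monoid_add"
  assumes "finite A" "\<And>j. j \<in> A \<Longrightarrow> (f j has_sum s j) X"
  shows "((\<lambda>i. \<Sum>j\<in>A. f j i) has_sum (\<Sum>j\<in>A. s j)) X"
  using assms by (induction A rule: finite_induct) (auto intro!: has_sum_add)

lemma infsum_linear_image:
  assumes "bounded_linear h" "f summable_on A"
  shows "(\<Sum>\<^sub>\<infinity>x\<in>A. h (f x)) = h (\<Sum>\<^sub>\<infinity>x\<in>A. f x)"
  by (rule infsumI[OF has_sum_bounded_linear[OF assms(1) has_sum_infsum[OF assms(2)]]])

lemma has_vector_derivative_infsum:
  fixes f f' :: "'i \<Rightarrow> real \<Rightarrow> 'c::banach"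
  assumes deriv: "\<And>i t. t \<in> {a..b} \<Longrightarrow> (f i has_vector_derivative f' i t) (at t within {a..b})"
    and cont: "\<And>i. continuous_on {a..b} (f' i)"
    and bound: "\<And>i t. i \<in> X \<Longrightarrow> t \<in> {a..b} \<Longrightarrow> norm (f' i t) \<le> M i"
    and M: "M summable_on X"
    and f: "\<And>t. t \<in> {a..b} \<Longrightarrow> (\<lambda>i. f i t) summable_on X"
    and t: "t \<in> {a..b}"
  shows "((\<lambda>t. \<Sum>\<^sub>\<infinity>i\<in>X. f i t) has_vector_derivative (\<Sum>\<^sub>\<infinity>i\<in>X. f' i t)) (at t within {a..b})"
proof -
  let ?G = "\<lambda>t. \<Sum>\<^sub>\<infinity>i\<in>X. f' i t"
  have G: "continuous_on {a..b} ?G"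
    by (rule continuous_on_infsum[OF cont bound M])
  have ab: "a \<in> {a..b}" using t by auto
  have eq: "(\<Sum>\<^sub>\<infinity>i\<in>X. f i s) = (\<Sum>\<^sub>\<infinity>i\<in>X. f i a) + integral {a..s} ?G" if s: "s \<in> {a..b}" for s
  proof -
    have sub: "{a..s} \<subseteq> {a..b}" using s by auto
    have "((\<lambda>i. integral (cbox a s) (f' i)) has_sum integral (cbox a s) ?G) X"
      by (rule has_sum_integral_termwise[OF _ _ M])
        (use sub bound continuous_on_subset[OF cont sub] in auto)
    moreover have "integral {a..s} (f' i) = f i s - f i a" for i
    proof (rule integral_unique, rule fundamental_theorem_of_calculus)
      show "a \<le> s" using s by simp
      show "(f i has_vector_derivative f' i x) (at x within {a..s})" if "x \<in> {a..s}" for x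
        using deriv[of x i] that sub by (meson has_vector_derivative_within_subset subsetD)
    qed
    ultimately have "((\<lambda>i. f i s - f i a) has_sum integral {a..s} ?G) X"
      by simp
    then have "((\<lambda>i. (f i s - f i a) + f i a) has_sum (integral {a..s} ?G + (\<Sum>\<^sub>\<infinity>i\<in>X. f i a))) X"
      by (intro has_sum_add has_sum_infsum f ab)
    then show ?thesis by (simp add: infsumI add.commute)
  qed
  have "((\<lambda>s. (\<Sum>\<^sub>\<infinity>i\<in>X. f i a) + integral {a..s} ?G) has_vector_derivative 0 + ?G t)
      (at t within {a..b})"
    by (intro has_vector_derivative_add integral_has_vector_derivative G t) simp
  from has_vector_derivative_transform[OF t eq this] show ?thesis by simp
qed

text \<open>Bounds are available uniformly on compact time intervals only; continuity and
  differentiability on the half line follow because they are local.\<close>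

lemma continuous_on_half_line:
  fixes f :: "real \<times> 'a::t2_space \<Rightarrow> 'b::topological_space"
  assumes "\<And>T. T > 0 \<Longrightarrow> continuous_on ({0..T} \<times> S) f"
  shows "continuous_on ({0..} \<times> S) f"
proof -
  have "continuous (at (t, x) within {0..} \<times> S) f" if tx: "t \<in> {0..}" "x \<in> S" for t x
  proof -
  have "continuous (at (t, x) within {0..t+1} \<times> S) f"
    using assms[of "t + 1"] tx by (auto simp: continuous_on_eq_continuous_within)
  moreover have "at (t, x) within {0..t+1} \<times> S = at (t, x) within {0..} \<times> S"
    by (rule at_within_nhd[of _ "{..<t+1} \<times> UNIV"]) (auto intro!: open_Times)
  ultimately show ?thesis by simp
  qed
  then show ?thesis by (auto simp: continuous_on_eq_continuous_within)
qed

lemma continuous_on_half_line_real: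
  fixes f :: "real \<Rightarrow> 'b::topological_space"
  assumes "\<And>T. T > 0 \<Longrightarrow> continuous_on {0..T} f"
  shows "continuous_on {0..} f"
  unfolding continuous_on_eq_continuous_within
proof
  fix t assume t: "t \<in> {0::real..}"
  have "continuous (at t within {0..t+1}) f"
    using assms[of "t + 1"] t by (auto simp: continuous_on_eq_continuous_within)
  moreover have "at t within {0..t+1} = at t within {0..}"
    by (rule at_within_nhd[of _ "{..<t+1}"]) auto
  ultimately show "continuous (at t within {0..}) f" by simp
qed

lemma has_vector_derivative_half_line:
  assumes "(f has_vector_derivative f') (at t within {0..T})" "t \<in> {0..<T}"
  shows "(f has_vector_derivative f') (at t within {0::real..})"
proof -
  have "at t within {0..T} = at t within {0..}"
    by (rule at_within_nhd[of _ "{..<T}"]) (use assms in auto)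
  then show ?thesis using assms by simp
qed

text \<open>The elementary differential inequality behind all a priori estimates: if
  \<open>w' \<bullet> w \<le> - \<beta> |w|\<^sup>2 + g |w|\<close> then formally \<open>|w|' \<le> - \<beta> |w| + g\<close>. The norm is
  not differentiable at zeros of \<open>w\<close>, so \<open>sqrt (|w|\<^sup>2 + \<epsilon>\<^sup>2)\<close> is used in its place.\<close>

lemma norm_le_integral_of_inner_deriv_le:
  fixes w w' :: "real \<Rightarrow> 'a::euclidean_space" and \<beta> g :: "real \<Rightarrow> real"
  assumes t: "0 \<le> t"
    and deriv: "\<And>s. s \<in> {0..t} \<Longrightarrow> (w has_vector_derivative w' s) (at s within {0..t})"
    and \<beta>: "continuous_on {0..t} \<beta>" and g: "continuous_on {0..t} g"
    and g0: "\<And>s. s \<in> {0..t} \<Longrightarrow> 0 \<le> g s"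
    and ineq: "\<And>s. s \<in> {0..t} \<Longrightarrow> w' s \<bullet> w s \<le> - \<beta> s * (norm (w s))\<^sup>2 + g s * norm (w s)"
  shows "norm (w t) \<le> norm (w 0) + integral {0..t} (\<lambda>s. g s - \<beta> s * norm (w s))"
proof -
  have wc: "continuous_on {0..t} w"
    using deriv by (rule continuous_on_vector_derivative)
  obtain B where "\<forall>s\<in>{0..t}. \<bar>\<beta> s\<bar> \<le> B"
    using compact_imp_bounded[OF compact_continuous_image[OF \<beta> compact_Icc]]
    unfolding bounded_iff by auto
  then have B: "\<bar>\<beta> s\<bar> \<le> B" if "s \<in> {0..t}" for s using that by auto
  have B0: "0 \<le> B" using B[of 0] t by auto
  let ?H = "\<lambda>s. g s - \<beta> s * norm (w s)"
  have Hc: "continuous_on {0..t} ?H" by (intro continuous_intros g \<beta> wc)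
  have main: "norm (w t) \<le> norm (w 0) + integral {0..t} ?H + \<epsilon> * (1 + B * t)" if e: "\<epsilon> > 0" for \<epsilon>
  proof -
    define \<psi> where "\<psi> s = sqrt (w s \<bullet> w s + \<epsilon>\<^sup>2)" for s
    have pos: "w s \<bullet> w s + \<epsilon>\<^sup>2 > 0" for s
      using e by (simp add: add_nonneg_pos)
    have \<psi>pos: "\<psi> s > 0" for s unfolding \<psi>_def using pos by simp
    have \<psi>ge: "norm (w s) \<le> \<psi> s" for s
      unfolding \<psi>_def norm_eq_sqrt_inner by simp
    have \<psi>le: "\<psi> s \<le> norm (w s) + \<epsilon>" for s
      unfolding \<psi>_def using e
      by (intro real_le_lsqrt) (auto simp: power2_sum power2_norm_eq_inner)
    have d\<psi>: "(\<psi> has_vector_derivative (w' s \<bullet> w s) / \<psi> s) (at s within {0..t})"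
      if s: "s \<in> {0..t}" for s
    proof -
      have "((\<lambda>s. w s \<bullet> w s) has_derivative (\<lambda>h. w s \<bullet> (h *\<^sub>R w' s) + (h *\<^sub>R w' s) \<bullet> w s)) (at s within {0..t})"
        using deriv[OF s] unfolding has_vector_derivative_def
        by (rule has_derivative_inner) (use deriv[OF s] in \<open>simp add: has_vector_derivative_def\<close>)
      then have "((\<lambda>s. w s \<bullet> w s) has_real_derivative 2 * (w' s \<bullet> w s)) (at s within {0..t})"
        unfolding has_field_derivative_def
        by (rule has_derivative_eq_rhs) (auto simp: inner_commute algebra_simps)
      then have "((\<lambda>s. w s \<bullet> w s + \<epsilon>\<^sup>2) has_real_derivative 2 * (w' s \<bullet> w s)) (at s within {0..t})"
        by (auto intro!: derivative_eq_intros)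
      then have "(\<psi> has_real_derivative (2 * (w' s \<bullet> w s)) * (inverse (sqrt (w s \<bullet> w s + \<epsilon>\<^sup>2)) / 2)) (at s within {0..t})"
        unfolding \<psi>_def
        by (rule DERIV_cong[OF DERIV_chain2[where f = sqrt and g = "\<lambda>s. w s \<bullet> w s + \<epsilon>\<^sup>2",
              OF DERIV_real_sqrt[OF pos[of s]]]]) simp
      then show ?thesis
        by (simp add: has_real_derivative_iff_has_vector_derivative \<psi>_def field_simps)
    qed
    have int: "(\<lambda>s. (w' s \<bullet> w s) / \<psi> s) integrable_on {0..t}"
      using fundamental_theorem_of_calculus[OF t d\<psi>] by auto
    have "\<psi> t - \<psi> 0 = integral {0..t} (\<lambda>s. (w' s \<bullet> w s) / \<psi> s)"
      using fundamental_theorem_of_calculus[OF t d\<psi>] by (auto simp: integral_unique)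
    also have "\<dots> \<le> integral {0..t} (\<lambda>s. ?H s + B * \<epsilon>)"
    proof (rule integral_le[OF int])
      show "(\<lambda>s. ?H s + B * \<epsilon>) integrable_on {0..t}"
        by (intro integrable_continuous_real continuous_intros Hc)
      fix s assume s: "s \<in> {0..t}"
      define n where "n = norm (w s)"
      have n: "0 \<le> n" "n \<le> \<psi> s" "\<psi> s \<le> n + \<epsilon>" using \<psi>ge \<psi>le by (auto simp: n_def)
      have 1: "g s * n / \<psi> s \<le> g s"
        using g0[OF s] n \<psi>pos[of s] by (simp add: divide_le_eq mult_left_mono)
      have q: "0 \<le> n - n\<^sup>2 / \<psi> s" "n - n\<^sup>2 / \<psi> s \<le> \<epsilon>"
      proof -
        have eq: "n - n\<^sup>2 / \<psi> s = (n / \<psi> s) * (\<psi> s - n)"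
          using \<psi>pos[of s] by (simp add: field_simps power2_eq_square)
        have f: "0 \<le> n / \<psi> s" "n / \<psi> s \<le> 1" using n \<psi>pos[of s] by auto
        show "0 \<le> n - n\<^sup>2 / \<psi> s" using f n eq by simp
        have "(n / \<psi> s) * (\<psi> s - n) \<le> \<psi> s - n"
          by (rule mult_left_le_one_le) (use f n in auto)
        then have "n - n\<^sup>2 / \<psi> s \<le> \<psi> s - n" unfolding eq .
        then show "n - n\<^sup>2 / \<psi> s \<le> \<epsilon>" using n by linarith
      qed
      have 2: "\<beta> s * (n - n\<^sup>2 / \<psi> s) \<le> B * \<epsilon>"
        using B[OF s] q B0 by (intro mult_mono) auto
      have "(w' s \<bullet> w s) / \<psi> s \<le> (- \<beta> s * n\<^sup>2 + g s * n) / \<psi> s"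
        using ineq[OF s] \<psi>pos[of s] by (intro divide_right_mono) (auto simp: n_def)
      also have "\<dots> = - \<beta> s * (n\<^sup>2 / \<psi> s) + g s * n / \<psi> s"
        by (simp add: add_divide_distrib diff_divide_distrib)
      also have "\<dots> \<le> g s - \<beta> s * n + B * \<epsilon>"
        using 1 2 by (simp add: algebra_simps)
      finally show "(w' s \<bullet> w s) / \<psi> s \<le> ?H s + B * \<epsilon>" by (simp add: n_def)
    qed
    also have "\<dots> = integral {0..t} ?H + B * \<epsilon> * t"
      using t by (subst integral_add) (auto intro!: integrable_continuous_real Hc)
    finally show ?thesis
      using \<psi>ge[of t] \<psi>le[of 0] by (simp add: algebra_simps)
  qed
  show ?thesis
  proof (rule field_le_epsilon)
    fix e :: real assume e: "e > 0"
    have p: "1 + B * t > 0" using B0 t by (simp add: add_pos_nonneg)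
    show "norm (w t) \<le> norm (w 0) + integral {0..t} ?H + e"
      using main[of "e / (1 + B * t)"] e p by simp
  qed
qed

section \<open>Rapidly decaying families on the integer lattice\<close>

definition weight :: "int^'n \<Rightarrow> real" where
  "weight k = 1 + norm (real_freq k)"

lemma weight_ge_1: "1 \<le> weight k"
  by (simp add: weight_def)

lemma weight_pos [simp]: "0 < weight k" "0 \<le> weight k"
  using weight_ge_1[of k] by linarith+

lemma real_freq_add: "real_freq (k + l) = real_freq k + real_freq l"
  and real_freq_diff: "real_freq (k - l) = real_freq k - real_freq l"
  and real_freq_0 [simp]: "real_freq 0 = 0"
  by (simp_all add: real_freq_def vec_eq_iff)

lemma real_freq_nth: "real_freq k $ i = real_of_int (k $ i)"
  by (simp add: real_freq_def)

lemma real_freq_eq_0_iff [simp]: "real_freq k = 0 \<longleftrightarrow> k = 0"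
  by (simp add: real_freq_def vec_eq_iff)

lemma norm_real_freq_ge_1: "k \<noteq> 0 \<Longrightarrow> 1 \<le> norm (real_freq k)"
proof -
  assume "k \<noteq> 0"
  then obtain i where "k $ i \<noteq> 0" by (auto simp: vec_eq_iff)
  then have "1 \<le> \<bar>real_freq k $ i\<bar>" by (simp add: real_freq_nth)
  also have "\<dots> \<le> norm (real_freq k)" by (rule component_le_norm_cart)
  finally show ?thesis .
qed

text \<open>This is why convolutions preserve rapid decay.\<close>

lemma weight_submult: "weight k \<le> weight (k - l) * weight l"
proof -
  have "norm (real_freq k) \<le> norm (real_freq (k - l)) + norm (real_freq l)"
    using norm_triangle_ineq[of "real_freq (k - l)" "real_freq l"] by (simp add: real_freq_diff)
  then have "weight k \<le> 1 + norm (real_freq (k - l)) + norm (real_freq l)"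
    by (simp add: weight_def)
  also have "\<dots> \<le> weight (k - l) * weight l"
    by (simp add: weight_def algebra_simps)
  finally show ?thesis .
qed

lemma weight_power_submult: "weight k ^ m \<le> weight (k - l) ^ m * weight l ^ m"
  by (simp add: power_mono weight_submult flip: power_mult_distrib)

lemma summable_on_inverse_square_int:
  "(\<lambda>z::int. 1 / (1 + \<bar>real_of_int z\<bar>)\<^sup>2) summable_on UNIV" (is "?g summable_on _")
proof -
  have "summable (\<lambda>n. 1 / (1 + real n)\<^sup>2)"
    using inverse_power_summable[of 2, where 'a = real]
    summable_Suc_iff[of "\<lambda>n. inverse (real n ^ 2)"]
    by (simp only: inverse_eq_divide of_nat_Suc)
  then have n: "(\<lambda>n. 1 / (1 + real n)\<^sup>2) summable_on UNIV"
    by (rule summable_nonneg_imp_summable_on) auto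
  have "?g summable_on range int"
    using n by (subst summable_on_reindex) (auto simp: o_def)
  moreover have "?g summable_on range (\<lambda>n. - int n)"
    using n by (subst summable_on_reindex) (auto simp: o_def inj_def)
  ultimately have "?g summable_on (range int \<union> range (\<lambda>n. - int n))"
    by (rule summable_on_union)
  moreover have "range int \<union> range (\<lambda>n. - int n) = UNIV"
  proof (intro set_eqI iffI UNIV_I)
    fix z :: int
    show "z \<in> range int \<union> range (\<lambda>n. - int n)" by (cases z rule: int_cases2) auto
  qed
  ultimately show ?thesis by simp
qed

text \<open>The product of the one-dimensional weights dominates a power of the Euclidean weight,
  and the sum of a product function over a lattice box is a product of one-dimensional sums.\<close>

lemma summable_on_inverse_weight:
  "(\<lambda>k::int^'n. 1 / weight k ^ (2 * CARD('n))) summable_on UNIV"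
proof -
  let ?g = "\<lambda>z::int. 1 / (1 + \<bar>real_of_int z\<bar>)\<^sup>2"
  let ?G = "\<lambda>k::int^'n. \<Prod>i\<in>UNIV. ?g (k $ i)"
  define C where "C = infsum ?g UNIV"
  have "?G summable_on UNIV"
  proof (rule nonneg_bdd_above_summable_on)
    show "0 \<le> ?G k" for k by (simp add: prod_nonneg)
    show "bdd_above (sum ?G ` {F. F \<subseteq> UNIV \<and> finite F})"
    proof (rule bdd_aboveI2)
      fix F :: "(int^'n) set" assume "F \<in> {F. F \<subseteq> UNIV \<and> finite F}"
      then have F: "finite F" by simp
      define A where "A = (\<Union>i. (\<lambda>k. k $ i) ` F)"
      have A: "finite A" using F by (auto simp: A_def)
      have inj: "inj_on vec_nth F" by (auto simp: inj_on_def vec_nth_inject)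
      have "sum ?G F = (\<Sum>f\<in>vec_nth ` F. \<Prod>i\<in>UNIV. ?g (f i))"
        by (subst sum.reindex[OF inj]) simp
      also have "\<dots> \<le> (\<Sum>f\<in>PiE UNIV (\<lambda>_::'n. A). \<Prod>i\<in>UNIV. ?g (f i))"
      proof (rule sum_mono2)
        show "finite (PiE UNIV (\<lambda>_::'n. A))" using A by (intro finite_PiE) auto
        show "vec_nth ` F \<subseteq> PiE UNIV (\<lambda>_::'n. A)" by (auto simp: A_def)
        show "0 \<le> (\<Prod>i\<in>UNIV. ?g (f i))" for f :: "'n \<Rightarrow> int" by (simp add: prod_nonneg)
      qed
      also have "\<dots> = (\<Prod>i\<in>(UNIV::'n set). \<Sum>z\<in>A. ?g z)"
        by (rule prod_sum_PiE[symmetric]) (auto simp: A)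
      also have "\<dots> \<le> (\<Prod>i\<in>(UNIV::'n set). C)"
        unfolding C_def using summable_on_inverse_square_int A
        by (intro prod_mono conjI sum_nonneg finite_sum_le_infsum) auto
      finally show "sum ?G F \<le> C ^ CARD('n)" by simp
    qed
  qed
  then show ?thesis
  proof (rule summable_on_of_norm_le)
    fix k :: "int^'n"
    have "(\<Prod>i\<in>(UNIV::'n set). (1 + \<bar>real_of_int (k $ i)\<bar>)\<^sup>2) \<le> (\<Prod>i\<in>(UNIV::'n set). (weight k)\<^sup>2)"
      using component_le_norm_cart[of "real_freq k"]
      by (intro prod_mono) (auto simp: weight_def real_freq_nth intro!: power_mono)
    then have le: "(\<Prod>i\<in>(UNIV::'n set). (1 + \<bar>real_of_int (k $ i)\<bar>)\<^sup>2) \<le> weight k ^ (2 * CARD('n))"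
      by (simp add: power_mult)
    have "1 / weight k ^ (2 * CARD('n)) \<le> 1 / (\<Prod>i\<in>(UNIV::'n set). (1 + \<bar>real_of_int (k $ i)\<bar>)\<^sup>2)"
      by (intro divide_left_mono le mult_pos_pos prod_pos) (auto intro!: zero_less_power)
    then show "norm (1 / weight k ^ (2 * CARD('n))) \<le> ?G k"
      by (simp add: prod_dividef)
  qed
qed

text \<open>The decay is uniform on compact time intervals only, which is the convergence of
  \<open>C\<^sup>\<infinity>\<close> functions that are continuous in time on a half line. A single family of
  coefficients is regarded as constant in time, so that one notion serves both purposes.\<close>

definition rapid :: "(real \<Rightarrow> int^'n \<Rightarrow> 'b::real_normed_vector) \<Rightarrow> bool" where
  "rapid c \<longleftrightarrow> (\<forall>k. continuous_on {0..} (\<lambda>t. c t k)) \<and>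
     (\<forall>m T. \<exists>C. \<forall>t\<in>{0..T}. \<forall>k. weight k ^ m * norm (c t k) \<le> C)"

text \<open>The recursion follows that of \<open>Cd_smooth\<close> in \<open>Cd_smooth_Suc_iff\<close>: an induction on the order
  passes from a family to its time derivative.\<close>

primrec Cd_rapid :: "nat \<Rightarrow> (real \<Rightarrow> int^'n \<Rightarrow> 'b::real_normed_vector) \<Rightarrow> bool" where
  "Cd_rapid 0 c \<longleftrightarrow> rapid c"
| "Cd_rapid (Suc d) c \<longleftrightarrow> rapid c \<and> (\<exists>c'. Cd_rapid d c' \<and>
     (\<forall>k. \<forall>t\<ge>0. ((\<lambda>s. c s k) has_vector_derivative c' t k) (at t within {0..})))"

lemma rapid_continuous: "rapid c \<Longrightarrow> continuous_on {0..} (\<lambda>t. c t k)"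
  by (simp add: rapid_def)

lemma rapid_continuous_on: "rapid c \<Longrightarrow> A \<subseteq> {0..} \<Longrightarrow> continuous_on A (\<lambda>t. c t k)"
  using rapid_continuous continuous_on_subset by blast

lemma rapid_bound:
  fixes c :: "real \<Rightarrow> int^'n \<Rightarrow> 'b::real_normed_vector"
  assumes "rapid c"
  obtains C where "0 \<le> C" "\<And>t k. t \<in> {0..T} \<Longrightarrow> weight k ^ m * norm (c t k) \<le> C"
proof -
  obtain C where "\<forall>t\<in>{0..T}. \<forall>k. weight k ^ m * norm (c t k) \<le> C"
    using assms unfolding rapid_def by blast
  then have "\<And>t k. t \<in> {0..T} \<Longrightarrow> weight k ^ m * norm (c t k) \<le> max 0 C"
    by (meson max.coboundedI2)
  then show ?thesis using that[of "max 0 C"] by simp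
qed

lemma rapidI:
  assumes "\<And>k. continuous_on {0..} (\<lambda>t. c t k)"
    and "\<And>m T. \<exists>C. \<forall>t\<in>{0..T}. \<forall>k. weight k ^ m * norm (c t k) \<le> C"
  shows "rapid c"
  using assms by (simp add: rapid_def)

text \<open>Spending \<open>2n\<close> powers of the weight turns a rapidly decaying family into an absolutely
  summable one, with a majorant that does not depend on time.\<close>

lemma rapid_majorant:
  fixes c :: "real \<Rightarrow> int^'n \<Rightarrow> 'b::real_normed_vector"
  assumes "rapid c"
  obtains M where "M summable_on UNIV" "\<And>k. 0 \<le> M k"
    "\<And>t k. t \<in> {0..T} \<Longrightarrow> weight k ^ m * norm (c t k) \<le> M k"
proof -
  obtain C where C: "0 \<le> C" "\<And>t k. t \<in> {0..T} \<Longrightarrow> weight k ^ (m + 2 * CARD('n)) * norm (c t k) \<le> C"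
    using rapid_bound[OF assms] by metis
  show ?thesis
  proof
    show "(\<lambda>k::int^'n. C * (1 / weight k ^ (2 * CARD('n)))) summable_on UNIV"
      by (rule summable_on_cmult_right[OF summable_on_inverse_weight])
    show "0 \<le> C * (1 / weight k ^ (2 * CARD('n)))" for k :: "int^'n" using C by simp
    show "weight k ^ m * norm (c t k) \<le> C * (1 / weight k ^ (2 * CARD('n)))" if "t \<in> {0..T}" for t k
      using C(2)[OF that, of k] by (simp add: power_add field_simps)
  qed
qed

lemma rapid_majorant0:
  fixes c :: "real \<Rightarrow> int^'n \<Rightarrow> 'b::real_normed_vector"
  assumes "rapid c"
  obtains M where "M summable_on UNIV" "\<And>k. 0 \<le> M k" "\<And>t k. t \<in> {0..T} \<Longrightarrow> norm (c t k) \<le> M k"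
  using rapid_majorant[OF assms, of T 0] by auto

lemma rapid_at: "rapid c \<Longrightarrow> t \<ge> 0 \<Longrightarrow> rapid (\<lambda>_. c t)"
  unfolding rapid_def by (auto; meson atLeastAtMost_iff order_refl)

lemma rapid_add:
  assumes "rapid a" "rapid b"
  shows "rapid (\<lambda>t k. a t k + b t k)"
proof (rule rapidI)
  show "continuous_on {0..} (\<lambda>t. a t k + b t k)" for k
    using assms by (intro continuous_intros rapid_continuous)
  fix m T
  obtain A where A: "\<And>t k. t \<in> {0..T} \<Longrightarrow> weight k ^ m * norm (a t k) \<le> A"
    using rapid_bound[OF assms(1)] by metis
  obtain B where B: "\<And>t k. t \<in> {0..T} \<Longrightarrow> weight k ^ m * norm (b t k) \<le> B"
    using rapid_bound[OF assms(2)] by metis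
  have "weight k ^ m * norm (a t k + b t k) \<le> A + B" if "t \<in> {0..T}" for t k
  proof -
    have "weight k ^ m * norm (a t k + b t k) \<le> weight k ^ m * (norm (a t k) + norm (b t k))"
      by (intro mult_left_mono norm_triangle_ineq) simp
    then show ?thesis using A[OF that, of k] B[OF that, of k] by (simp add: algebra_simps)
  qed
  then show "\<exists>C. \<forall>t\<in>{0..T}. \<forall>k. weight k ^ m * norm (a t k + b t k) \<le> C" by blast
qed

lemma rapid_multiplier:
  assumes c: "rapid c" and lin: "\<And>k. bounded_linear (A k)"
    and bound: "\<And>k w. norm (A k w) \<le> K * weight k ^ p * norm w" and K: "0 \<le> K"
  shows "rapid (\<lambda>t k. A k (c t k))"
proof (rule rapidI)
  show "continuous_on {0..} (\<lambda>t. A k (c t k))" for k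
    by (rule bounded_linear.continuous_on[OF lin rapid_continuous[OF c]])
  fix m T
  obtain C where C: "\<And>t k. t \<in> {0..T} \<Longrightarrow> weight k ^ (m + p) * norm (c t k) \<le> C"
    using rapid_bound[OF c] by metis
  have "weight k ^ m * norm (A k (c t k)) \<le> K * C" if "t \<in> {0..T}" for t k
  proof -
    have "weight k ^ m * norm (A k (c t k)) \<le> weight k ^ m * (K * weight k ^ p * norm (c t k))"
      by (intro mult_left_mono bound) simp
    also have "\<dots> = K * (weight k ^ (m + p) * norm (c t k))" by (simp add: power_add)
    also have "\<dots> \<le> K * C" by (intro mult_left_mono C that K)
    finally show ?thesis .
  qed
  then show "\<exists>C. \<forall>t\<in>{0..T}. \<forall>k. weight k ^ m * norm (A k (c t k)) \<le> C" by blast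
qed

lemma Cd_rapid_imp_rapid: "Cd_rapid d c \<Longrightarrow> rapid c"
  by (cases d) auto

lemma Cd_rapid_Suc_D: "Cd_rapid (Suc d) c \<Longrightarrow> Cd_rapid d c"
proof (induction d arbitrary: c)
  case (Suc d)
  then obtain c' where "Cd_rapid (Suc d) c'"
    "\<forall>k. \<forall>t\<ge>0. ((\<lambda>s. c s k) has_vector_derivative c' t k) (at t within {0..})"
    by auto
  with Suc show ?case by auto
qed auto

lemma Cd_rapid_mono:
  assumes "e \<le> d" "Cd_rapid d c"
  shows "Cd_rapid e c"
  using assms by (induction rule: inc_induct) (auto dest: Cd_rapid_Suc_D simp del: Cd_rapid.simps)

lemma Cd_rapid_add: "Cd_rapid d a \<Longrightarrow> Cd_rapid d b \<Longrightarrow> Cd_rapid d (\<lambda>t k. a t k + b t k)"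
proof (induction d arbitrary: a b)
  case (Suc d)
  then obtain a' b' where "Cd_rapid d a'" "Cd_rapid d b'"
    "\<forall>k. \<forall>t\<ge>0. ((\<lambda>s. a s k) has_vector_derivative a' t k) (at t within {0..})"
    "\<forall>k. \<forall>t\<ge>0. ((\<lambda>s. b s k) has_vector_derivative b' t k) (at t within {0..})"
    by auto
  with Suc show ?case
    by (auto intro!: rapid_add exI[of _ "\<lambda>t k. a' t k + b' t k"] derivative_eq_intros)
qed (simp add: rapid_add)

lemma Cd_rapid_multiplier:
  assumes "Cd_rapid d c" and lin: "\<And>k. bounded_linear (A k)"
    and bound: "\<And>k w. norm (A k w) \<le> K * weight k ^ p * norm w" "0 \<le> K"
  shows "Cd_rapid d (\<lambda>t k. A k (c t k))"
  using assms(1)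
proof (induction d arbitrary: c)
  case (Suc d)
  then obtain c' where c': "Cd_rapid d c'"
    "\<And>k t. t \<ge> 0 \<Longrightarrow> ((\<lambda>s. c s k) has_vector_derivative c' t k) (at t within {0..})"
    by auto
  have "((\<lambda>s. A k (c s k)) has_vector_derivative A k (c' t k)) (at t within {0..})" if "t \<ge> 0" for k t
    by (rule bounded_linear.has_vector_derivative[OF lin c'(2)[OF that]])
  then show ?case
    using Suc c' by (auto intro!: rapid_multiplier[OF _ lin bound])
qed (simp add: rapid_multiplier[OF _ lin bound])

section \<open>Synthesis of smooth functions from their Fourier coefficients\<close>

definition wave :: "complex^'n \<Rightarrow> real \<Rightarrow> real^'n" where
  "wave w \<theta> = (\<chi> i. Re (w $ i * cis \<theta>))"

text \<open>Real parts are taken in every summand, so that the sum is a real field for every family of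
  coefficients. No information is lost for the families of real fields (\<open>cvec_synth\<close>).\<close>

definition synth :: "(int^'n \<Rightarrow> complex^'n) \<Rightarrow> real^'n \<Rightarrow> real^'n" where
  "synth c x = (\<Sum>\<^sub>\<infinity>k. wave (c k) (real_freq k \<bullet> x))"

text \<open>The Fourier multiplier of \<open>\<partial>\<^sub>j\<close>; \<open>dmuls\<close> is that of an iterated partial derivative.\<close>

definition dmul :: "'n \<Rightarrow> (int^'n \<Rightarrow> complex^'n) \<Rightarrow> int^'n \<Rightarrow> complex^'n" where
  "dmul j c k = (\<i> * of_int (k $ j)) *s c k"

primrec dmuls :: "'n list \<Rightarrow> (int^'n \<Rightarrow> complex^'n) \<Rightarrow> int^'n \<Rightarrow> complex^'n" where
  "dmuls [] c = c"
| "dmuls (j # js) c = dmul j (dmuls js c)"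

lemma norm_vec_le_componentwise:
  fixes x :: "'a::real_normed_vector^'n" and y :: "'b::real_normed_vector^'n"
  shows "(\<And>i. norm (x $ i) \<le> norm (y $ i)) \<Longrightarrow> norm x \<le> norm y"
  unfolding norm_vec_def by (rule L2_set_mono) auto

lemma norm_wave_le: "norm (wave w \<theta>) \<le> norm w"
proof (rule norm_vec_le_componentwise)
  show "norm (wave w \<theta> $ i) \<le> norm (w $ i)" for i
    using abs_Re_le_cmod[of "w $ i * cis \<theta>"] by (simp add: wave_def norm_mult)
qed

lemma bounded_linear_wave: "bounded_linear (\<lambda>w. wave w \<theta>)"
proof (rule bounded_linear_intro[where K = 1])
  show "wave (x + y) \<theta> = wave x \<theta> + wave y \<theta>" for x y :: "complex^'n"
    by (simp add: wave_def vec_eq_iff distrib_right)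
  show "wave (r *\<^sub>R x) \<theta> = r *\<^sub>R wave x \<theta>" for r and x :: "complex^'n"
    by (simp add: wave_def vec_eq_iff)
qed (simp add: norm_wave_le)

lemma continuous_on_wave [continuous_intros]:
  fixes f :: "'a::topological_space \<Rightarrow> complex^'n"
  assumes "continuous_on S f" "continuous_on S g"
  shows "continuous_on S (\<lambda>x. wave (f x) (g x))"
  unfolding wave_def using assms by (intro continuous_intros)

lemma has_vector_derivative_cis:
  "((\<lambda>h. cis (a + h * s)) has_vector_derivative \<i> * of_real s * cis (a + h * s)) (at h within S)"
proof -
  have "((\<lambda>z. exp (\<i> * (of_real a + z * of_real s))) has_field_derivative
      \<i> * of_real s * exp (\<i> * (of_real a + of_real h * of_real s))) (at (of_real h))"
    by (auto intro!: derivative_eq_intros)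
  then have "((\<lambda>h. exp (\<i> * (of_real a + of_real h * of_real s))) has_vector_derivative
      \<i> * of_real s * exp (\<i> * (of_real a + of_real h * of_real s))) (at h within S)"
    by (rule has_vector_derivative_real_field)
  then show ?thesis by (simp add: cis_conv_exp)
qed

lemma has_vector_derivative_wave:
  "((\<lambda>h. wave w (a + h * s)) has_vector_derivative wave ((\<i> * of_real s) *s w) (a + h * s)) (at h within S)"
proof -
  let ?L = "\<lambda>z. (\<chi> i. Re (w $ i * z))"
  have "norm (?L z) \<le> norm (norm z *\<^sub>R w)" for z
  proof (rule norm_vec_le_componentwise)
    show "norm (?L z $ i) \<le> norm ((norm z *\<^sub>R w) $ i)" for i
      using abs_Re_le_cmod[of "w $ i * z"] by (simp add: norm_mult mult.commute)
  qed
  then have "norm (?L z) \<le> norm z * norm w" for z by simp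
  then have "bounded_linear ?L"
    by (intro bounded_linear_intro[where K = "norm w"]) (auto simp: vec_eq_iff algebra_simps)
  from bounded_linear.has_vector_derivative[OF this has_vector_derivative_cis]
  have "((\<lambda>h. ?L (cis (a + h * s))) has_vector_derivative ?L (\<i> * of_real s * cis (a + h * s))) (at h within S)" .
  then show ?thesis by (simp add: wave_def mult_ac)
qed

lemma norm_smult: "norm (a *s w) = norm a * norm (w :: complex^'n)"
  by (simp add: norm_vec_def norm_mult L2_set_right_distrib)

lemma bounded_linear_smult: "bounded_linear (\<lambda>w :: complex^'n. a *s w)"
  by (rule bounded_linear_intro[where K = "norm a"])
    (auto simp: norm_smult vec_eq_iff algebra_simps)

lemma norm_dmul_le: "norm ((\<i> * of_int (k $ j)) *s (w :: complex^'n)) \<le> 1 * weight k ^ 1 * norm w"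
  using component_le_norm_cart[of "real_freq k" j]
  by (auto simp: norm_smult norm_mult weight_def real_freq_nth intro!: mult_right_mono)

lemma rapid_dmul: "rapid c \<Longrightarrow> rapid (\<lambda>t. dmul j (c t))"
  unfolding dmul_def[abs_def]
  by (rule rapid_multiplier[OF _ bounded_linear_smult norm_dmul_le]) auto

lemma rapid_dmuls: "rapid c \<Longrightarrow> rapid (\<lambda>t. dmuls js (c t))"
  by (induction js) (auto intro: rapid_dmul)

lemma summable_wave:
  assumes "rapid c" "t \<ge> 0"
  shows "(\<lambda>k. wave (c t k) (real_freq k \<bullet> x)) summable_on UNIV"
proof -
  obtain M where M: "M summable_on UNIV" "\<And>s k. s \<in> {0..t} \<Longrightarrow> norm (c s k) \<le> M k"
    using rapid_majorant0[OF assms(1)] by metis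
  have "norm (wave (c t k) (real_freq k \<bullet> x)) \<le> M k" for k
    by (rule order_trans[OF norm_wave_le M(2)]) (use assms in auto)
  then show ?thesis by (rule summable_on_of_norm_le[OF M(1)])
qed

text \<open>Only values of the series on a line enter, so this is term by term differentiation in one
  real variable.\<close>

lemma synth_has_partial:
  assumes c: "rapid (\<lambda>_::real. c)"
  shows "((\<lambda>h. synth c (x + h *\<^sub>R axis j 1)) has_vector_derivative synth (dmul j c) x) (at 0)"
proof -
  obtain M where M0: "M summable_on UNIV" "\<And>t k. t \<in> {0..0::real} \<Longrightarrow> norm (dmul j c k) \<le> M k"
    using rapid_majorant0[OF rapid_dmul[OF c, of j], of 0] by metis
  have M: "M summable_on UNIV" "\<And>k. norm (dmul j c k) \<le> M k" using M0(1) M0(2)[of 0] by auto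
  have eq: "real_freq k \<bullet> (x + h *\<^sub>R axis j 1) = real_freq k \<bullet> x + h * real_of_int (k $ j)" for k h
    by (simp add: inner_add_right inner_axis real_freq_nth)
  have "((\<lambda>h. \<Sum>\<^sub>\<infinity>k. wave (c k) (real_freq k \<bullet> (x + h *\<^sub>R axis j 1))) has_vector_derivative
      (\<Sum>\<^sub>\<infinity>k. wave (dmul j c k) (real_freq k \<bullet> (x + 0 *\<^sub>R axis j 1)))) (at 0 within {-1..1})"
  proof (rule has_vector_derivative_infsum[where M = M])
    show "((\<lambda>h. wave (c k) (real_freq k \<bullet> (x + h *\<^sub>R axis j 1))) has_vector_derivative
        wave (dmul j c k) (real_freq k \<bullet> (x + h *\<^sub>R axis j 1))) (at h within {-1..1})" for k h
      unfolding eq dmul_def using has_vector_derivative_wave[of "c k" _ "real_of_int (k $ j)"] by simp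
    show "continuous_on {-1..1} (\<lambda>h. wave (dmul j c k) (real_freq k \<bullet> (x + h *\<^sub>R axis j 1)))" for k
      by (intro continuous_intros)
    show "norm (wave (dmul j c k) (real_freq k \<bullet> (x + h *\<^sub>R axis j 1))) \<le> M k" for k h
      using norm_wave_le M(2) order_trans by blast
    show "(\<lambda>k. wave (c k) (real_freq k \<bullet> (x + h *\<^sub>R axis j 1))) summable_on UNIV" for h
      using summable_wave[OF c] by blast
  qed (use M in auto)
  then show ?thesis
    by (simp add: synth_def at_within_Icc_at)
qed

lemma partial_synth:
  assumes "rapid (\<lambda>_::real. c)"
  shows "partial j (synth c) = synth (dmul j c)"
  using synth_has_partial[OF assms] by (auto simp: partial_def vector_derivative_at)

lemma partials_synth:
  assumes "rapid (\<lambda>_::real. c)"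
  shows "partials js (synth c) = synth (dmuls js c)"
  by (induction js) (auto simp: partial_synth[OF rapid_dmuls[OF assms]])

lemma periodic_synth: "periodic_2pi (synth c)"
proof -
  have "wave (c k) (real_freq k \<bullet> (x + axis i (2 * pi))) = wave (c k) (real_freq k \<bullet> x)" for k x i
  proof -
    have "cis (real_freq k \<bullet> (x + axis i (2 * pi))) = cis (real_freq k \<bullet> x) * cis (2 * pi * of_int (k $ i))"
      by (simp add: inner_add_right inner_axis real_freq_nth cis_mult mult.commute)
    then show ?thesis by (simp add: wave_def)
  qed
  then show ?thesis by (simp add: periodic_2pi_def synth_def)
qed

lemma continuous_on_synth:
  assumes c: "rapid c"
  shows "continuous_on ({0..} \<times> UNIV) (\<lambda>(t, x). synth (c t) x)"
proof (rule continuous_on_half_line)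
  fix T :: real assume "T > 0"
  obtain M where M: "M summable_on UNIV" "\<And>s k. s \<in> {0..T} \<Longrightarrow> norm (c s k) \<le> M k"
    using rapid_majorant0[OF c] by metis
  have "continuous_on ({0..T} \<times> UNIV) (\<lambda>p. \<Sum>\<^sub>\<infinity>k. wave (c (fst p) k) (real_freq k \<bullet> snd p))"
  proof (rule continuous_on_infsum[OF _ _ M(1)])
    show "continuous_on ({0..T} \<times> UNIV) (\<lambda>p. wave (c (fst p) k) (real_freq k \<bullet> snd p))" for k
      by (intro continuous_intros continuous_on_compose2[OF rapid_continuous[OF c]]) auto
    show "norm (wave (c (fst p) k) (real_freq k \<bullet> snd p)) \<le> M k" if "p \<in> {0..T} \<times> UNIV" for p k
      using order_trans[OF norm_wave_le M(2)] that by (metis mem_Times_iff)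
  qed
  then show "continuous_on ({0..T} \<times> UNIV) (\<lambda>(t, x). synth (c t) x)"
    by (simp add: synth_def case_prod_beta)
qed

lemma continuous_synth: "rapid (\<lambda>_::real. c) \<Longrightarrow> continuous_on S (synth c)"
  using continuous_on_compose2[OF continuous_on_synth, of "\<lambda>_. c" S "\<lambda>x. (0, x)"]
    continuous_on_Pair[OF continuous_on_const continuous_on_id, of S "0::real"]
  by auto

lemma smooth_torus_synth:
  assumes "rapid (\<lambda>_::real. c)"
  shows "smooth_torus (synth c)"
  unfolding smooth_torus_def partially_differentiable_def partials_synth[OF assms]
  using periodic_synth continuous_synth[OF rapid_dmuls[OF assms]]
    synth_has_partial[OF rapid_dmuls[OF assms]]
  by (auto simp del: dmuls.simps) (metis differentiableI_vector)

lemma synth_has_time_derivative: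
  assumes c: "rapid c" and c': "rapid c'"
    and deriv: "\<And>k t. t \<ge> 0 \<Longrightarrow> ((\<lambda>s. c s k) has_vector_derivative c' t k) (at t within {0..})"
    and t: "t \<ge> 0"
  shows "((\<lambda>s. synth (c s) x) has_vector_derivative synth (c' t) x) (at t within {0..})"
proof (rule has_vector_derivative_half_line)
  obtain M where M: "M summable_on UNIV" "\<And>s k. s \<in> {0..t+1} \<Longrightarrow> norm (c' s k) \<le> M k"
    using rapid_majorant0[OF c'] by metis
  show "((\<lambda>s. synth (c s) x) has_vector_derivative synth (c' t) x) (at t within {0..t+1})"
    unfolding synth_def
  proof (rule has_vector_derivative_infsum[where M = M])
    show "((\<lambda>s. wave (c s k) (real_freq k \<bullet> x)) has_vector_derivative wave (c' s k) (real_freq k \<bullet> x))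
        (at s within {0..t+1})" if "s \<in> {0..t+1}" for s k
      using that by (intro bounded_linear.has_vector_derivative[OF bounded_linear_wave]
          has_vector_derivative_within_subset[OF deriv]) auto
    show "continuous_on {0..t+1} (\<lambda>s. wave (c' s k) (real_freq k \<bullet> x))" for k
      by (intro continuous_intros rapid_continuous_on[OF c']) auto
    show "norm (wave (c' s k) (real_freq k \<bullet> x)) \<le> M k" if "s \<in> {0..t+1}" for s k
      using norm_wave_le M(2)[OF that] order_trans by blast
    show "(\<lambda>k. wave (c s k) (real_freq k \<bullet> x)) summable_on UNIV" if "s \<in> {0..t+1}" for s
      using summable_wave[OF c] that by simp
  qed (use M t in auto)
qed (use t in auto)

lemma at_within_half_line_neq_bot: "t \<ge> 0 \<Longrightarrow> at t within {0::real..} \<noteq> bot"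
proof -
  assume t: "t \<ge> 0"
  have "t islimpt {t..t+1}" by (rule islimpt_Icc[THEN iffD2]) auto
  then have "t islimpt {0..}" by (rule islimpt_subset) (use t in auto)
  then show ?thesis by (simp add: trivial_limit_within)
qed

lemma time_deriv_eqI:
  assumes "((\<lambda>s. f s x) has_vector_derivative D) (at t within {0..})" "t \<ge> 0"
  shows "time_deriv {0..} f t x = D"
  unfolding time_deriv_def
  using vector_derivative_within[OF at_within_half_line_neq_bot] assms by blast

lemma time_deriv_cong:
  assumes "\<And>s x. s \<in> I \<Longrightarrow> f s x = g s x" "t \<in> I"
  shows "time_deriv I f t = time_deriv I g t"
proof
  fix x
  have "((\<lambda>s. f s x) has_vector_derivative D) (at t within I) \<longleftrightarrow>
      ((\<lambda>s. g s x) has_vector_derivative D) (at t within I)" for D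
  proof
    show "((\<lambda>s. g s x) has_vector_derivative D) (at t within I)"
      if "((\<lambda>s. f s x) has_vector_derivative D) (at t within I)"
      by (rule has_vector_derivative_transform[OF assms(2) _ that]) (simp add: assms(1))
    show "((\<lambda>s. f s x) has_vector_derivative D) (at t within I)"
      if "((\<lambda>s. g s x) has_vector_derivative D) (at t within I)"
      by (rule has_vector_derivative_transform[OF assms(2) _ that]) (simp add: assms(1))
  qed
  then show "time_deriv I f t x = time_deriv I g t x"
    by (simp add: time_deriv_def vector_derivative_def)
qed

text \<open>Peeling off the first time derivative instead of the last one makes induction on the order
  possible.\<close>

lemma Cd_smooth_Suc_iff:
  "Cd_smooth (Suc d) I f \<longleftrightarrow> Cd_smooth 0 I f \<and>
     (\<forall>t\<in>I. \<forall>x. (\<lambda>s. f s x) differentiable (at t within I)) \<and> Cd_smooth d I (time_deriv I f)"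
proof -
  have le: "(\<forall>j\<le>Suc d. P j) \<longleftrightarrow> P 0 \<and> (\<forall>j\<le>d. P (Suc j))" for P
    by (metis Suc_le_mono le0 not0_implies_Suc)
  have rearrange: "((A \<and> A') \<and> (B \<and> B') \<and> (C \<and> C')) \<longleftrightarrow> ((True \<and> B \<and> C) \<and> A \<and> (A' \<and> B' \<and> C'))"
    for A A' B B' C C' by blast
  have all: "(\<forall>j<0::nat. P j) \<longleftrightarrow> True" "(\<forall>j\<le>0::nat. P j) \<longleftrightarrow> P 0" for P :: "nat \<Rightarrow> bool"
    by auto
  show ?thesis
    unfolding Cd_smooth_def le All_less_Suc2 all funpow_Suc_right o_apply funpow_0
    by (rule rearrange)
qed

lemma Cd_smooth_0_cong:
  assumes "\<And>t x. t \<in> I \<Longrightarrow> f t x = g t x" "Cd_smooth 0 I f"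
  shows "Cd_smooth 0 I g"
proof -
  have eq: "f t = g t" if "t \<in> I" for t using assms(1) that by auto
  then have "continuous_on (I \<times> UNIV) (\<lambda>(t, x). partials js (f t) x) \<longleftrightarrow>
      continuous_on (I \<times> UNIV) (\<lambda>(t, x). partials js (g t) x)" for js
    by (intro continuous_on_cong) auto
  then show ?thesis using assms(2) eq by (auto simp: Cd_smooth_def)
qed

lemma Cd_smooth_cong:
  assumes "\<And>t x. t \<in> I \<Longrightarrow> f t x = g t x"
  shows "Cd_smooth d I f \<Longrightarrow> Cd_smooth d I g"
  using assms
proof (induction d arbitrary: f g)
  case 0
  then show ?case using Cd_smooth_0_cong[of I f g] by simp
next
  case (Suc d)
  have "(\<lambda>s. g s x) differentiable (at t within I)" if "t \<in> I" for t x
  proof -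
    have "(\<lambda>s. f s x) differentiable (at t within I)"
      using Suc.prems(1) that by (simp add: Cd_smooth_Suc_iff)
    then obtain D where "((\<lambda>s. f s x) has_vector_derivative D) (at t within I)"
      using vector_derivative_works by blast
    then have "((\<lambda>s. g s x) has_vector_derivative D) (at t within I)"
      by (rule has_vector_derivative_transform[OF that, rotated]) (simp add: Suc.prems(2))
    then show ?thesis by (rule differentiableI_vector)
  qed
  moreover have "Cd_smooth d I (time_deriv I g)"
    using Suc.IH[of "time_deriv I f" "time_deriv I g"] Suc.prems time_deriv_cong[of I f g]
    by (simp add: Cd_smooth_Suc_iff)
  moreover have "Cd_smooth 0 I g"
    by (rule Cd_smooth_0_cong[OF Suc.prems(2)]) (use Suc.prems(1) in \<open>simp_all add: Cd_smooth_Suc_iff\<close>)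
  ultimately show ?case by (simp add: Cd_smooth_Suc_iff)
qed

lemma Cd_smooth_0_synth: "rapid c \<Longrightarrow> Cd_smooth 0 {0..} (\<lambda>t. synth (c t))"
proof -
  assume c: "rapid c"
  have "continuous_on ({0..} \<times> UNIV) (\<lambda>(t, x). partials js (synth (c t)) x)" for js
    by (rule continuous_on_eq[OF continuous_on_synth[OF rapid_dmuls[OF c, of js]]])
      (auto simp: partials_synth[OF rapid_at[OF c]])
  then show ?thesis
    by (auto simp: Cd_smooth_def smooth_torus_synth[OF rapid_at[OF c]])
qed

lemma Cd_smooth_synth: "Cd_rapid d c \<Longrightarrow> Cd_smooth d {0..} (\<lambda>t. synth (c t))"
proof (induction d arbitrary: c)
  case 0
  then show ?case by (simp add: Cd_smooth_0_synth)
next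
  case (Suc d)
  then obtain c' where c': "Cd_rapid d c'" and c: "rapid c"
    "\<And>k t. t \<ge> 0 \<Longrightarrow> ((\<lambda>s. c s k) has_vector_derivative c' t k) (at t within {0..})"
    by auto
  have D: "((\<lambda>s. synth (c s) x) has_vector_derivative synth (c' t) x) (at t within {0..})" if "t \<ge> 0" for t x
    by (rule synth_has_time_derivative[OF c(1) Cd_rapid_imp_rapid[OF c'] c(2) that])
  have "Cd_smooth d {0..} (time_deriv {0..} (\<lambda>t. synth (c t)))"
    by (rule Cd_smooth_cong[OF _ Suc.IH[OF c']]) (simp add: time_deriv_eqI[OF D])
  then show ?case
    using Cd_smooth_0_synth[OF c(1)] D by (auto simp: Cd_smooth_Suc_iff intro: differentiableI_vector)
qed

section \<open>Fourier coefficients of periodic functions\<close>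

definition cvec :: "real^'n \<Rightarrow> complex^'n" where
  "cvec y = (\<chi> i. of_real (y $ i))"

lemma cvec_nth [simp]: "cvec y $ i = of_real (y $ i)"
  by (simp add: cvec_def)

lemma norm_cvec [simp]: "norm (cvec y) = norm y"
  by (simp add: norm_vec_def)

lemma bounded_linear_cvec: "bounded_linear cvec"
  by (rule bounded_linear_intro[where K = 1]) (auto simp: vec_eq_iff scaleR_conv_of_real[where 'a = complex])

lemma bounded_bilinear_smult: "bounded_bilinear ((*s) :: complex \<Rightarrow> complex^'n \<Rightarrow> complex^'n)"
proof
  show "\<exists>K. \<forall>a b. norm (a *s b :: complex^'n) \<le> norm a * norm b * K"
    by (intro exI[of _ 1]) (simp add: norm_smult)
qed (auto simp: vec_eq_iff algebra_simps)

lemmas continuous_on_smult [continuous_intros] = bounded_bilinear.continuous_on[OF bounded_bilinear_smult]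
lemmas continuous_on_cvec [continuous_intros] = bounded_linear.continuous_on[OF bounded_linear_cvec]

lemma mem_torus_cell: "x \<in> torus_cell \<longleftrightarrow> (\<forall>i. 0 \<le> x $ i \<and> x $ i \<le> 2 * pi)"
  by (simp add: torus_cell_def mem_box_cart)

lemma compact_torus_cell: "compact torus_cell"
  by (simp add: torus_cell_def)

lemma content_torus_cell: "measure lborel (torus_cell :: (real^'n) set) = (2 * pi) ^ CARD('n)"
  unfolding torus_cell_def by (subst content_cbox_cart) (auto simp: interval_ne_empty_cart)

lemma integrable_torus_cell:
  fixes f :: "real^'n \<Rightarrow> 'b::banach"
  shows "continuous_on torus_cell f \<Longrightarrow> f integrable_on torus_cell"
  by (simp add: torus_cell_def integrable_continuous)

text \<open>Cutting the translated cell along the hyperplane \<open>x\<^sub>j = 2\<pi>\<close> and moving the part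
  beyond it back by one period restores the original cell.\<close>

lemma integral_torus_cell_shift:
  fixes f :: "real^'n \<Rightarrow> 'b::euclidean_space"
  assumes per: "periodic_2pi f" and cont: "continuous_on UNIV f" and s: "0 \<le> s" "s \<le> 2 * pi"
  shows "integral torus_cell (\<lambda>x. f (x + s *\<^sub>R axis j 1)) = integral torus_cell f"
proof -
  let ?e = "axis j 1 :: real^'n" and ?b = "(\<chi> i. 2 * pi) :: real^'n"
  let ?B = "cbox 0 (?b + s *\<^sub>R ?e)"
  have e: "?e \<in> Basis" by (auto simp: Basis_vec_def)
  have x_e: "x \<bullet> ?e = x $ j" for x by (simp add: inner_axis)
  have int: "f integrable_on cbox a b" for a b
    by (rule integrable_continuous[OF continuous_on_subset[OF cont]]) simp
  have ax: "?e $ i = (if i = j then 1 else 0)" for i by (simp add: axis_def)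
  have b1: "?B \<inter> {x. x \<bullet> ?e \<le> s} = cbox 0 (?b + (s - 2 * pi) *\<^sub>R ?e)"
  proof (intro set_eqI iffI)
    fix x assume "x \<in> cbox 0 (?b + (s - 2 * pi) *\<^sub>R ?e)"
    then have x: "0 \<le> x $ i" "x $ i \<le> 2 * pi + (s - 2 * pi) * (if i = j then 1 else 0)" for i
      by (auto simp: mem_box_cart ax)
    have "x $ i \<le> 2 * pi + s * (if i = j then 1 else 0)" for i
      using x(2)[of i] s by (auto split: if_splits)
    then show "x \<in> ?B \<inter> {x. x \<bullet> ?e \<le> s}"
      using x(1) x(2)[of j] by (auto simp: mem_box_cart x_e ax)
  qed (use s in \<open>auto simp: mem_box_cart x_e ax split: if_splits\<close>)
  have b2: "?B \<inter> {x. x \<bullet> ?e \<ge> s} = cbox (0 + s *\<^sub>R ?e) (?b + s *\<^sub>R ?e)"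
    using s by (auto simp: mem_box_cart x_e ax split: if_splits) (metis order_trans)
  have b3: "?B \<inter> {x. x \<bullet> ?e \<le> 2 * pi} = cbox 0 ?b"
    using s by (auto simp: mem_box_cart x_e ax split: if_splits) (smt (verit))
  have b4: "?B \<inter> {x. x \<bullet> ?e \<ge> 2 * pi} = cbox (0 + (2 * pi) *\<^sub>R ?e) (?b + (s - 2 * pi) *\<^sub>R ?e + (2 * pi) *\<^sub>R ?e)"
    using s by (auto simp: mem_box_cart x_e ax algebra_simps split: if_splits) (smt (verit) pi_ge_zero)
  have "integral (cbox (0 + (2 * pi) *\<^sub>R ?e) (?b + (s - 2 * pi) *\<^sub>R ?e + (2 * pi) *\<^sub>R ?e)) f
      = integral (cbox 0 (?b + (s - 2 * pi) *\<^sub>R ?e)) (f \<circ> ((+) ((2 * pi) *\<^sub>R ?e)))"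
    by (rule integral_shift_cbox_plus[symmetric])
  also have "f \<circ> ((+) ((2 * pi) *\<^sub>R ?e)) = f"
  proof
    fix x
    have "(2 * pi) *\<^sub>R ?e = axis j (2 * pi)" by (simp add: vec_eq_iff axis_def)
    then show "(f \<circ> ((+) ((2 * pi) *\<^sub>R ?e))) x = f x"
      using per by (simp add: periodic_2pi_def add.commute)
  qed
  finally have sh: "integral (?B \<inter> {x. x \<bullet> ?e \<ge> 2 * pi}) f = integral (?B \<inter> {x. x \<bullet> ?e \<le> s}) f"
    by (simp only: b4 b1)
  have "integral torus_cell (\<lambda>x. f (x + s *\<^sub>R ?e)) = integral (cbox 0 ?b) (f \<circ> ((+) (s *\<^sub>R ?e)))"
    by (simp add: torus_cell_def o_def add.commute)
  also have "\<dots> = integral (?B \<inter> {x. x \<bullet> ?e \<ge> s}) f"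
    by (simp only: integral_shift_cbox_plus b2)
  also have "\<dots> = integral (cbox 0 ?b) f"
    using integral_split[OF int e, of 0 "?b + s *\<^sub>R ?e" s]
      integral_split[OF int e, of 0 "?b + s *\<^sub>R ?e" "2 * pi"] sh by (simp only: b3) simp
  finally show ?thesis by (simp add: torus_cell_def)
qed

text \<open>The integral of a translate over the cell is constant, so its derivative, the integral
  of the partial derivative, vanishes. This replaces integration by parts.\<close>

lemma integral_partial_periodic:
  fixes f f' :: "real^'n \<Rightarrow> 'b::euclidean_space"
  assumes per: "periodic_2pi f" and cont: "continuous_on UNIV f" and cont': "continuous_on UNIV f'"
    and deriv: "\<And>x. ((\<lambda>h. f (x + h *\<^sub>R axis j 1)) has_vector_derivative f' x) (at 0)"
  shows "integral torus_cell f' = 0"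
proof -
  let ?e = "axis j 1 :: real^'n"
  have d: "((\<lambda>h. f (x + h *\<^sub>R ?e)) has_vector_derivative f' (x + h *\<^sub>R ?e)) (at h within S)" for x h S
  proof -
    have "((\<lambda>u. f ((x + h *\<^sub>R ?e) + u *\<^sub>R ?e)) has_vector_derivative f' (x + h *\<^sub>R ?e)) (at (h - h))"
      using deriv by simp
    moreover have "((\<lambda>u. u - h) has_vector_derivative 1) (at h)"
      by (auto intro!: derivative_eq_intros)
    ultimately have "((\<lambda>u. f ((x + h *\<^sub>R ?e) + u *\<^sub>R ?e)) \<circ> (\<lambda>u. u - h) has_vector_derivative 1 *\<^sub>R f' (x + h *\<^sub>R ?e)) (at h)"
      by (intro vector_diff_chain_at) auto
    moreover have "(x + h *\<^sub>R ?e) + (u - h) *\<^sub>R ?e = x + u *\<^sub>R ?e" for u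
      by (simp add: scaleR_left_diff_distrib)
    ultimately have "((\<lambda>h. f (x + h *\<^sub>R ?e)) has_vector_derivative f' (x + h *\<^sub>R ?e)) (at h)"
      by (simp only: o_def scaleR_one)
    then show ?thesis by (rule has_vector_derivative_at_within)
  qed
  have shifted: "((\<lambda>h. integral torus_cell (\<lambda>x. f (x + h *\<^sub>R ?e))) has_vector_derivative
      integral torus_cell (\<lambda>x. f' (x + 0 *\<^sub>R ?e))) (at 0 within {0..2 * pi})"
    unfolding torus_cell_def
  proof (rule leibniz_rule_vector_derivative)
    show "((\<lambda>h. f (x + h *\<^sub>R ?e)) has_vector_derivative f' (x + h *\<^sub>R ?e)) (at h within {0..2 * pi})"
      for x h by (rule d)
    show "(\<lambda>x. f (x + h *\<^sub>R ?e)) integrable_on cbox 0 (\<chi> i. 2 * pi)" for h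
      by (intro integrable_continuous continuous_on_compose2[OF cont] continuous_intros) auto
    show "continuous_on ({0..2 * pi} \<times> cbox 0 (\<chi> i. 2 * pi)) (\<lambda>(h, x). f' (x + h *\<^sub>R ?e))"
      unfolding case_prod_beta
      by (intro continuous_on_compose2[OF cont'] continuous_intros) auto
  qed (auto simp: less_imp_le[OF pi_gt_zero])
  have "((\<lambda>h. integral torus_cell f) has_vector_derivative integral torus_cell (\<lambda>x. f' (x + 0 *\<^sub>R ?e)))
      (at 0 within {0..2 * pi})"
    by (rule has_vector_derivative_transform[OF _ _ shifted])
      (simp_all add: integral_torus_cell_shift[OF per cont])
  moreover have "((\<lambda>h. integral torus_cell f) has_vector_derivative 0) (at 0 within {0..2 * pi})"
    by simp
  ultimately show ?thesis
    using vector_derivative_unique_within_closed_interval[of 0 "2 * pi" 0 "\<lambda>h. integral torus_cell f"]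
    by simp
qed

text \<open>As a single vector-valued integral the coefficient can be estimated and differentiated without
  passing to components.\<close>

lemma fourier_coeff_eq:
  fixes f :: "real^'n \<Rightarrow> real^'n"
  assumes "continuous_on torus_cell f"
  shows "fourier_coeff f k =
    (1 / (2 * pi) ^ CARD('n)) *\<^sub>R integral torus_cell (\<lambda>x. cis (- (real_freq k \<bullet> x)) *s cvec (f x))"
proof -
  let ?F = "\<lambda>x. cis (- (real_freq k \<bullet> x)) *s cvec (f x)"
  have int: "?F integrable_on torus_cell"
    by (intro integrable_torus_cell continuous_intros assms)
  have "integral torus_cell ?F $ i = integral torus_cell (\<lambda>x. of_real (f x $ i) * cis (- (real_freq k \<bullet> x)))" for i
    using integral_linear[OF int bounded_linear_vec_nth, of i] by (simp add: o_def mult.commute)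
  then show ?thesis
    by (simp add: fourier_coeff_def vec_eq_iff scaleR_conv_of_real[where 'a = complex])
qed

lemma norm_fourier_coeff_le:
  fixes f :: "real^'n \<Rightarrow> real^'n"
  assumes "continuous_on torus_cell f" "\<And>x. x \<in> torus_cell \<Longrightarrow> norm (f x) \<le> B"
  shows "norm (fourier_coeff f k) \<le> B"
proof -
  have B: "0 \<le> B" using order_trans[OF norm_ge_zero assms(2)[of 0]] by (simp add: mem_torus_cell)
  have "norm (integral torus_cell (\<lambda>x. cis (- (real_freq k \<bullet> x)) *s cvec (f x))) \<le> B * measure lborel (torus_cell :: (real^'n) set)"
    unfolding torus_cell_def
    by (rule integrable_bound[OF B]) 
      (auto simp: norm_smult assms(2)[unfolded torus_cell_def] intro!: integrable_continuous continuous_intros assms(1)[unfolded torus_cell_def])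
  then show ?thesis
    by (simp add: fourier_coeff_eq[OF assms(1)] content_torus_cell field_simps)
qed

lemma has_derivative_cis_partial:
  "((\<lambda>h. cis (real_freq k \<bullet> (x + h *\<^sub>R axis j 1))) has_vector_derivative
     (\<i> * of_int (k $ j)) * cis (real_freq k \<bullet> x)) (at 0)"
  using has_vector_derivative_cis[of "real_freq k \<bullet> x" "of_int (k $ j)" 0 UNIV]
  by (simp add: inner_add_right inner_axis real_freq_nth)

lemma periodic_cis: "periodic_2pi (\<lambda>x. cis (real_freq k \<bullet> x))"
proof -
  have "cis (real_freq k \<bullet> (x + axis i (2 * pi))) = cis (real_freq k \<bullet> x) * cis (2 * pi * of_int (k $ i))" for x i
    by (simp add: inner_add_right inner_axis real_freq_nth cis_mult mult.commute)
  then show ?thesis by (simp add: periodic_2pi_def)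
qed

lemma integral_cis:
  "integral torus_cell (\<lambda>x::real^'n. cis (real_freq k \<bullet> x)) = (if k = 0 then of_real ((2 * pi) ^ CARD('n)) else 0)"
proof (cases "k = 0")
  case True
  then show ?thesis
    using integral_const[of "1::complex" 0 "(\<chi> i. 2 * pi) :: real^'n"] content_torus_cell[where 'n = 'n]
    by (simp add: torus_cell_def scaleR_conv_of_real)
next
  case False
  then obtain j where j: "k $ j \<noteq> 0" by (auto simp: vec_eq_iff)
  have "integral torus_cell (\<lambda>x. (\<i> * of_int (k $ j)) * cis (real_freq k \<bullet> x)) = 0"
    by (rule integral_partial_periodic[OF periodic_cis _ _ has_derivative_cis_partial])
      (intro continuous_intros)+
  then show ?thesis using False j by simp
qed

lemma smooth_torus_continuous: "smooth_torus f \<Longrightarrow> continuous_on S f"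
  unfolding smooth_torus_def by (metis continuous_on_subset partials.simps(1) subset_UNIV)

lemma partials_append: "partials (js @ ks) f = partials js (partials ks f)"
  by (induction js) auto

lemma smooth_torus_has_partial:
  "smooth_torus f \<Longrightarrow> ((\<lambda>h. f (x + h *\<^sub>R axis j 1)) has_vector_derivative partial j f x) (at 0)"
  unfolding smooth_torus_def partially_differentiable_def partial_def
  by (metis partials.simps(1) vector_derivative_works)

lemma smooth_torus_partial:
  assumes "smooth_torus f"
  shows "smooth_torus (partial j f)"
proof -
  have "f (x + axis i (2 * pi) + h *\<^sub>R axis j 1) = f (x + h *\<^sub>R axis j 1)" for x i h
    using assms unfolding smooth_torus_def periodic_2pi_def by (metis add.assoc add.commute)
  then have "periodic_2pi (partial j f)"
    by (simp add: periodic_2pi_def partial_def)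
  moreover have "partials js (partial j f) = partials (js @ [j]) f" for js
    by (simp add: partials_append)
  ultimately show ?thesis
    using assms unfolding smooth_torus_def by metis
qed

lemma smooth_torus_partials: "smooth_torus f \<Longrightarrow> smooth_torus (partials js f)"
  by (induction js) (auto intro: smooth_torus_partial)

text \<open>The integral of \<open>\<partial>\<^sub>j (exp (- i k \<bullet> x) f x)\<close> over the cell vanishes; expand it by the
  product rule.\<close>

lemma fourier_coeff_partial:
  fixes f :: "real^'n \<Rightarrow> real^'n"
  assumes f: "smooth_torus f"
  shows "fourier_coeff (partial j f) k = dmul j (fourier_coeff f) k"
proof -
  have cf: "continuous_on S f" and cf': "continuous_on S (partial j f)" for S
    using smooth_torus_continuous f smooth_torus_partial by blast+
  let ?c = "\<lambda>x. cis (- (real_freq k \<bullet> x))"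
  let ?g = "\<lambda>x. ?c x *s cvec (f x)"
  let ?g' = "\<lambda>x. ?c x *s cvec (partial j f x) + (- \<i> * of_int (k $ j)) *s (?c x *s cvec (f x))"
  have "integral torus_cell ?g' = 0"
  proof (rule integral_partial_periodic[of ?g _ j])
    have c: "?c (x + axis i (2 * pi)) = ?c x" for x i
      using periodic_cis[of "- k"] by (simp add: periodic_2pi_def real_freq_uminus)
    show "periodic_2pi ?g"
      using f by (simp add: periodic_2pi_def smooth_torus_def c)
    show "continuous_on UNIV ?g" "continuous_on UNIV ?g'"
      by (intro continuous_intros cf cf')+
    fix x :: "real^'n"
    have 1: "((\<lambda>h. ?c (x + h *\<^sub>R axis j 1)) has_vector_derivative (- \<i> * of_int (k $ j)) * ?c x) (at 0)"
      using has_derivative_cis_partial[of "- k" x j] by (simp add: real_freq_uminus)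
    have 2: "((\<lambda>h. cvec (f (x + h *\<^sub>R axis j 1))) has_vector_derivative cvec (partial j f x)) (at 0)"
      by (rule bounded_linear.has_vector_derivative[OF bounded_linear_cvec smooth_torus_has_partial[OF f]])
    show "((\<lambda>h. ?g (x + h *\<^sub>R axis j 1)) has_vector_derivative ?g' x) (at 0)"
      using bounded_bilinear.has_vector_derivative[OF bounded_bilinear_smult 1 2]
      by (simp add: vector_smult_assoc)
  qed
  moreover have "integral torus_cell ?g' = integral torus_cell (\<lambda>x. ?c x *s cvec (partial j f x))
      + (- \<i> * of_int (k $ j)) *s integral torus_cell (\<lambda>x. ?c x *s cvec (f x))"
  proof -
    have i: "(\<lambda>x. ?c x *s cvec (f x)) integrable_on torus_cell"
      by (intro integrable_torus_cell continuous_intros cf)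
    have i': "(\<lambda>x. ?c x *s cvec (partial j f x)) integrable_on torus_cell"
      by (intro integrable_torus_cell continuous_intros cf')
    have i2: "(\<lambda>x. (- \<i> * of_int (k $ j)) *s (?c x *s cvec (f x))) integrable_on torus_cell"
      by (intro integrable_torus_cell continuous_intros cf)
    have "integral torus_cell (\<lambda>x. (- \<i> * of_int (k $ j)) *s (?c x *s cvec (f x))) =
        (- \<i> * of_int (k $ j)) *s integral torus_cell (\<lambda>x. ?c x *s cvec (f x))"
      using integral_linear[OF i bounded_linear_smult, of "- \<i> * of_int (k $ j)"]
      by (simp only: o_def)
    then show ?thesis
      by (simp only: integral_add[OF i' i2])
  qed
  ultimately show ?thesis
    unfolding dmul_def fourier_coeff_eq[OF cf] fourier_coeff_eq[OF cf']
    by (simp add: vec_eq_iff scaleR_conv_of_real[where 'a = complex] add_eq_0_iff)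
qed

lemma fourier_coeff_partials:
  "smooth_torus f \<Longrightarrow> fourier_coeff (partials js f) = dmuls js (fourier_coeff f)"
  by (induction js) (auto simp: fun_eq_iff fourier_coeff_partial smooth_torus_partials dmul_def)

lemma norm_dmuls_replicate: "norm (dmuls (replicate m j) c k) = \<bar>real_of_int (k $ j)\<bar> ^ m * norm (c k)"
  by (induction m) (auto simp: dmul_def norm_smult norm_mult)

text \<open>Derivatives in the coordinate directions suffice for decay in all directions, since some
  coordinate of \<open>k\<close> has absolute value at least \<open>|k| / n\<close>.\<close>

lemma weight_power_le:
  "weight (k :: int^'n) ^ m \<le> 2 ^ m * (1 + real CARD('n) ^ m * (\<Sum>j\<in>UNIV. \<bar>real_of_int (k $ j)\<bar> ^ m))"
proof -
  let ?M = "Max ((\<lambda>j. \<bar>real_of_int (k $ j)\<bar>) ` UNIV)"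
  have le: "\<bar>real_of_int (k $ j)\<bar> \<le> ?M" for j by (intro Max_ge) auto
  have "?M \<in> (\<lambda>j. \<bar>real_of_int (k $ j)\<bar>) ` UNIV" by (rule Max_in) auto
  then obtain j where j: "?M = \<bar>real_of_int (k $ j)\<bar>" by (rule imageE)
  have "norm (real_freq k) \<le> (\<Sum>j\<in>UNIV. \<bar>real_freq k $ j\<bar>)" by (rule norm_le_l1_cart)
  also have "\<dots> \<le> (\<Sum>j\<in>(UNIV::'n set). ?M)" by (intro sum_mono) (simp add: le real_freq_nth)
  finally have n: "norm (real_freq k) \<le> real CARD('n) * \<bar>real_of_int (k $ j)\<bar>" using j by simp
  have "weight k ^ m \<le> (2 * max 1 (norm (real_freq k))) ^ m"
    by (intro power_mono) (auto simp: weight_def)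
  also have "\<dots> = 2 ^ m * (max 1 (norm (real_freq k))) ^ m" by (simp add: power_mult_distrib)
  also have "(max 1 (norm (real_freq k))) ^ m \<le> 1 + norm (real_freq k) ^ m"
    by (auto simp: max_def)
  also have "norm (real_freq k) ^ m \<le> (real CARD('n) * \<bar>real_of_int (k $ j)\<bar>) ^ m"
    by (intro power_mono n) auto
  also have "\<dots> = real CARD('n) ^ m * \<bar>real_of_int (k $ j)\<bar> ^ m" by (simp add: power_mult_distrib)
  also have "\<bar>real_of_int (k $ j)\<bar> ^ m \<le> (\<Sum>j\<in>UNIV. \<bar>real_of_int (k $ j)\<bar> ^ m)"
    by (rule member_le_sum) auto
  finally show ?thesis by simp
qed

lemma Cd_smooth_0D:
  assumes "Cd_smooth d I f"
  shows "t \<in> I \<Longrightarrow> smooth_torus (f t)"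
    and "continuous_on (I \<times> UNIV) (\<lambda>(t, x). partials js (f t) x)"
  using assms by (force simp: Cd_smooth_def)+

lemma continuous_on_compact_norm_bound:
  assumes "compact K" "continuous_on K f"
  shows "\<exists>B. \<forall>x\<in>K. norm (f x) \<le> B"
  using compact_imp_bounded[OF compact_continuous_image[OF assms(2,1)]]
  by (simp add: bounded_iff)

text \<open>The derivative \<open>\<partial>\<^sub>j\<^sup>m f\<close> is bounded on compact sets, and its coefficients are those of \<open>f\<close>
  times \<open>(i k\<^sub>j)\<^sup>m\<close>.\<close>

lemma rapid_fourier_coeff:
  fixes f :: "real \<Rightarrow> real^'n \<Rightarrow> real^'n"
  assumes f: "Cd_smooth 0 {0..} f"
  shows "rapid (\<lambda>t. fourier_coeff (f t))"
proof (rule rapidI)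
  note sm = Cd_smooth_0D(1)[OF f] and ct = Cd_smooth_0D(2)[OF f]
  show "continuous_on {0..} (\<lambda>t. fourier_coeff (f t) k)" for k
  proof -
    let ?I = "\<lambda>t. (1 / (2 * pi) ^ CARD('n)) *\<^sub>R integral torus_cell (\<lambda>x. cis (- (real_freq k \<bullet> x)) *s cvec (f t x))"
    have "continuous_on ({0..} \<times> torus_cell) (\<lambda>p. f (fst p) (snd p))"
      using ct[of "[]"] by (auto simp: case_prod_beta intro: continuous_on_subset)
    then have "continuous_on ({0..} \<times> cbox 0 (\<chi> i. 2 * pi)) (\<lambda>(t, x). cis (- (real_freq k \<bullet> x)) *s cvec (f t x))"
      unfolding case_prod_beta torus_cell_def by (intro continuous_intros)
    then have "continuous_on {0..} (\<lambda>t. integral torus_cell (\<lambda>x. cis (- (real_freq k \<bullet> x)) *s cvec (f t x)))"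
      unfolding torus_cell_def by (rule integral_continuous_on_param)
    then have "continuous_on {0..} ?I" by (rule continuous_on_scaleR[OF continuous_on_const])
    then show ?thesis
      by (rule continuous_on_eq) (simp add: fourier_coeff_eq smooth_torus_continuous[OF sm])
  qed
  fix m and T :: real
  have bound: "\<exists>B. \<forall>t\<in>{0..T}. \<forall>x\<in>torus_cell. norm (partials js (f t) x) \<le> B" for js
  proof -
    have "\<exists>B. \<forall>p\<in>{0..T} \<times> torus_cell. norm ((\<lambda>(t, x). partials js (f t) x) p) \<le> B"
      by (rule continuous_on_compact_norm_bound)
        (auto intro: compact_Times compact_torus_cell continuous_on_subset[OF ct])
    then show ?thesis by auto
  qed
  obtain B where B: "\<And>j t x. t \<in> {0..T} \<Longrightarrow> x \<in> torus_cell \<Longrightarrow> norm (partials (replicate m j) (f t) x) \<le> B j"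
    using bound[of "replicate m _"] by metis
  obtain B0 where B0: "\<And>t x. t \<in> {0..T} \<Longrightarrow> x \<in> torus_cell \<Longrightarrow> norm (f t x) \<le> B0"
    using bound[of "[]"] by (metis partials.simps(1))
  have "weight k ^ m * norm (fourier_coeff (f t) k) \<le> 2 ^ m * (B0 + real CARD('n) ^ m * (\<Sum>j\<in>UNIV. B j))"
    if t: "t \<in> {0..T}" for t k
  proof -
    let ?c = "fourier_coeff (f t)"
    have s: "smooth_torus (f t)" using sm t by auto
    have j: "\<bar>real_of_int (k $ j)\<bar> ^ m * norm (?c k) \<le> B j" for j
      using norm_fourier_coeff_le[OF smooth_torus_continuous[OF smooth_torus_partials[OF s]] B[OF t]]
      by (metis fourier_coeff_partials[OF s] norm_dmuls_replicate)
    have 0: "norm (?c k) \<le> B0"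
      using norm_fourier_coeff_le[OF smooth_torus_continuous[OF s] B0[OF t]] .
    have "weight k ^ m * norm (?c k) \<le> (2 ^ m * (1 + real CARD('n) ^ m * (\<Sum>j\<in>UNIV. \<bar>real_of_int (k $ j)\<bar> ^ m))) * norm (?c k)"
      by (intro mult_right_mono weight_power_le) auto
    also have "\<dots> = 2 ^ m * (norm (?c k) + real CARD('n) ^ m * (\<Sum>j\<in>UNIV. \<bar>real_of_int (k $ j)\<bar> ^ m * norm (?c k)))"
      by (simp add: algebra_simps sum_distrib_left sum_distrib_right)
    also have "\<dots> \<le> 2 ^ m * (B0 + real CARD('n) ^ m * (\<Sum>j\<in>UNIV. B j))"
      by (intro mult_left_mono add_mono sum_mono 0 j) auto
    finally show ?thesis .
  qed
  then show "\<exists>C. \<forall>t\<in>{0..T}. \<forall>k. weight k ^ m * norm (fourier_coeff (f t) k) \<le> C" by blast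
qed

lemma fourier_coeff_has_vector_derivative:
  fixes f f' :: "real \<Rightarrow> real^'n \<Rightarrow> real^'n"
  assumes deriv: "\<And>t x. t \<ge> 0 \<Longrightarrow> ((\<lambda>s. f s x) has_vector_derivative f' t x) (at t within {0..})"
    and cont: "\<And>t. t \<ge> 0 \<Longrightarrow> continuous_on torus_cell (f t)"
    and cont': "continuous_on ({0..} \<times> UNIV) (\<lambda>(t, x). f' t x)" and t: "t \<ge> 0"
  shows "((\<lambda>s. fourier_coeff (f s) k) has_vector_derivative fourier_coeff (f' t) k) (at t within {0..})"
proof -
  let ?J = "\<lambda>f. (1 / (2 * pi) ^ CARD('n)) *\<^sub>R integral torus_cell (\<lambda>x. cis (- (real_freq k \<bullet> x)) *s cvec (f x))"
  have c': "continuous_on ({0..} \<times> torus_cell) (\<lambda>p. f' (fst p) (snd p))"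
    using cont' by (auto simp: case_prod_beta intro: continuous_on_subset)
  have ct': "continuous_on torus_cell (f' t)"
    using continuous_on_compose2[OF c', of torus_cell "\<lambda>x. (t, x)"] t
      continuous_on_Pair[OF continuous_on_const continuous_on_id, of torus_cell t] by auto
  have "((\<lambda>s. integral torus_cell (\<lambda>x. cis (- (real_freq k \<bullet> x)) *s cvec (f s x))) has_vector_derivative
      integral torus_cell (\<lambda>x. cis (- (real_freq k \<bullet> x)) *s cvec (f' t x))) (at t within {0..})"
    unfolding torus_cell_def
  proof (rule leibniz_rule_vector_derivative)
    fix s x assume "s \<in> {0::real..}"
    then show "((\<lambda>s. cis (- (real_freq k \<bullet> x)) *s cvec (f s x)) has_vector_derivative
        cis (- (real_freq k \<bullet> x)) *s cvec (f' s x)) (at s within {0..})"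
      by (intro bounded_linear.has_vector_derivative[OF bounded_linear_smult]
          bounded_linear.has_vector_derivative[OF bounded_linear_cvec] deriv) auto
  next
    fix s :: real assume "s \<in> {0..}"
    then show "(\<lambda>x. cis (- (real_freq k \<bullet> x)) *s cvec (f s x)) integrable_on cbox 0 (\<chi> i. 2 * pi)"
      using cont[of s] by (intro integrable_continuous continuous_intros) (auto simp: torus_cell_def)
  next
    show "continuous_on ({0..} \<times> cbox 0 (\<chi> i. 2 * pi)) (\<lambda>(s, x). cis (- (real_freq k \<bullet> x)) *s cvec (f' s x))"
      unfolding case_prod_beta using c' unfolding torus_cell_def by (intro continuous_intros)
  qed (use t in auto)
  then have J: "((\<lambda>s. ?J (f s)) has_vector_derivative ?J (f' t)) (at t within {0..})"
    by (rule bounded_linear.has_vector_derivative[OF bounded_linear_scaleR_right])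
  show ?thesis
    unfolding fourier_coeff_eq[OF ct']
    by (rule has_vector_derivative_transform[OF _ _ J]) (simp_all add: t fourier_coeff_eq cont)
qed

lemma Cd_rapid_fourier_coeff:
  "Cd_smooth d {0..} f \<Longrightarrow> Cd_rapid d (\<lambda>t. fourier_coeff (f t))"
proof (induction d arbitrary: f)
  case 0
  then show ?case by (simp add: rapid_fourier_coeff)
next
  case (Suc d)
  let ?f' = "time_deriv {0..} f"
  have f: "Cd_smooth 0 {0..} f" and f': "Cd_smooth d {0..} ?f'"
    and diff: "\<And>t x. t \<ge> 0 \<Longrightarrow> (\<lambda>s. f s x) differentiable (at t within {0..})"
    using Suc.prems by (auto simp: Cd_smooth_Suc_iff)
  have "((\<lambda>s. fourier_coeff (f s) k) has_vector_derivative fourier_coeff (?f' t) k) (at t within {0..})"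
    if "t \<ge> 0" for t k
  proof (rule fourier_coeff_has_vector_derivative[OF _ _ _ that])
    show "((\<lambda>s. f s x) has_vector_derivative ?f' t x) (at t within {0..})" if "t \<ge> 0" for t x
      using diff[OF that, of x] by (simp add: time_deriv_def vector_derivative_works)
    show "continuous_on torus_cell (f t)" if "t \<ge> 0" for t
      using Cd_smooth_0D(1)[OF f] that smooth_torus_continuous by auto
    show "continuous_on ({0..} \<times> UNIV) (\<lambda>(t, x). ?f' t x)"
      using Cd_smooth_0D(2)[OF f', of "[]"] by simp
  qed
  then show ?case using Suc.IH[OF f'] rapid_fourier_coeff[OF f] by auto
qed

section \<open>Uniqueness and inversion of Fourier series\<close>

text \<open>Only multiples of exponentials and sums are generators. Products are derived, whence
  orthogonality to the exponentials passes to all trigonometric polynomials by a simple induction.\<close>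

inductive trig_poly :: "(real^'n \<Rightarrow> complex) \<Rightarrow> bool" where
  mono: "trig_poly (\<lambda>x. c * cis (real_freq k \<bullet> x))"
| add: "trig_poly f \<Longrightarrow> trig_poly g \<Longrightarrow> trig_poly (\<lambda>x. f x + g x)"

lemma trig_poly_const: "trig_poly (\<lambda>x. c)"
  using trig_poly.mono[of c 0] by simp

lemma trig_poly_sum: "finite A \<Longrightarrow> (\<And>i. i \<in> A \<Longrightarrow> trig_poly (f i)) \<Longrightarrow> trig_poly (\<lambda>x. \<Sum>i\<in>A. f i x)"
  by (induction A rule: finite_induct) (auto intro: trig_poly_const trig_poly.add)

lemma trig_poly_mult_mono: "trig_poly f \<Longrightarrow> trig_poly (\<lambda>x. f x * (c * cis (real_freq k \<bullet> x)))"
proof (induction rule: trig_poly.induct)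
  case (mono d l)
  have "(\<lambda>x. d * cis (real_freq l \<bullet> x) * (c * cis (real_freq k \<bullet> x))) =
      (\<lambda>x. (d * c) * cis (real_freq (l + k) \<bullet> x))"
    by (simp add: fun_eq_iff real_freq_add inner_add_left flip: cis_mult)
  then show ?case by (simp only: trig_poly.mono)
next
  case (add f g)
  then show ?case using trig_poly.add[OF add.IH] by (simp add: distrib_right)
qed

lemma trig_poly_mult:
  assumes "trig_poly g" "trig_poly f"
  shows "trig_poly (\<lambda>x. f x * g x)"
  using assms(1)
proof (induction rule: trig_poly.induct)
  case (mono c k)
  then show ?case by (rule trig_poly_mult_mono[OF assms(2)])
next
  case (add g h)
  then show ?case using trig_poly.add[OF add.IH] by (simp add: distrib_left)
qed

lemma continuous_trig_poly: "trig_poly f \<Longrightarrow> continuous_on S f"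
  by (induction rule: trig_poly.induct) (auto intro!: continuous_intros)

text \<open>The torus as the compact product of unit circles in \<open>\<complex>\<^sup>n\<close>. A real polynomial in the
  real and imaginary parts of the coordinates is a trigonometric polynomial in the angles.\<close>

definition torus_map :: "real^'n \<Rightarrow> complex^'n" where
  "torus_map x = (\<chi> i. cis (x $ i))"

lemma continuous_torus_map: "continuous_on S torus_map"
  unfolding torus_map_def by (intro continuous_intros)

lemma trig_poly_cis_nth: "trig_poly (\<lambda>x. cis (x $ i))" "trig_poly (\<lambda>x. cis (- (x $ i)))"
proof -
  have "real_freq (axis i 1) \<bullet> x = x $ i" for x :: "real^'a"
  proof -
    have "real_freq (axis i 1) = axis i 1" by (simp add: vec_eq_iff real_freq_nth axis_def)
    then show ?thesis by (simp add: inner_axis')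
  qed
  then show "trig_poly (\<lambda>x. cis (x $ i))" "trig_poly (\<lambda>x. cis (- (x $ i)))"
    using trig_poly.mono[of 1 "axis i 1"] trig_poly.mono[of 1 "- axis i 1"]
    by (simp_all add: real_freq_uminus)
qed

lemma trig_poly_real_polynomial:
  assumes "real_polynomial_function p"
  shows "trig_poly (\<lambda>x::real^'n. of_real (p (torus_map x)))"
  using assms
proof (induction rule: real_polynomial_function.induct)
  case (linear p)
  then interpret bounded_linear p .
  have pz: "p z = (\<Sum>i\<in>UNIV. Re (z $ i) * p (axis i 1) + Im (z $ i) * p (axis i \<i>))" for z :: "complex^'n"
  proof -
    have "z = (\<Sum>i\<in>UNIV. Re (z $ i) *\<^sub>R axis i 1 + Im (z $ i) *\<^sub>R axis i \<i>)"
      by (simp add: vec_eq_iff axis_def if_distrib[of "\<lambda>x. _ *\<^sub>R x"] sum.delta complex_eq_iff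
          sum.distrib cong: if_cong)
    then have "p z = p (\<Sum>i\<in>UNIV. Re (z $ i) *\<^sub>R axis i 1 + Im (z $ i) *\<^sub>R axis i \<i>)" by simp
    then show ?thesis by (simp add: sum add scaleR)
  qed
  have euler: "of_real (Re (cis a) * P + Im (cis a) * Q) =
      (of_real P / 2 + of_real Q / (2 * \<i>)) * cis a + (of_real P / 2 - of_real Q / (2 * \<i>)) * cis (- a)" for a P Q
    by (simp add: complex_eq_iff field_simps)
  have "of_real (p (torus_map x)) = (\<Sum>i\<in>UNIV.
      (of_real (p (axis i 1)) / 2 + of_real (p (axis i \<i>)) / (2 * \<i>)) * cis (x $ i) +
      (of_real (p (axis i 1)) / 2 - of_real (p (axis i \<i>)) / (2 * \<i>)) * cis (- (x $ i)))" for x :: "real^'n"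
  proof -
    have "p (torus_map x) = (\<Sum>i\<in>UNIV. Re (cis (x $ i)) * p (axis i 1) + Im (cis (x $ i)) * p (axis i \<i>))"
      using pz[of "torus_map x"] by (simp only: torus_map_def vec_lambda_beta)
    then show ?thesis by (simp only: of_real_sum euler)
  qed
  moreover have "trig_poly (\<lambda>x::real^'n. \<Sum>i\<in>UNIV.
      (of_real (p (axis i 1)) / 2 + of_real (p (axis i \<i>)) / (2 * \<i>)) * cis (x $ i) +
      (of_real (p (axis i 1)) / 2 - of_real (p (axis i \<i>)) / (2 * \<i>)) * cis (- (x $ i)))"
    by (intro trig_poly_sum trig_poly.add trig_poly_mult trig_poly_const trig_poly_cis_nth) auto
  ultimately show ?case by simp
next
  case (add p q)
  then show ?case using trig_poly.add[OF add.IH] by simp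
next
  case (mult p q)
  then show ?case using trig_poly_mult[OF mult.IH(2,1)] by simp
qed (rule trig_poly_const)

lemma periodic_lattice:
  fixes f :: "real^'n \<Rightarrow> 'b"
  assumes "periodic_2pi f"
  shows "f (x + (2 * pi) *\<^sub>R real_freq k) = f x"
proof -
  have nat: "f (y + axis i (2 * pi * real m)) = f y" for y i m
  proof (induction m)
    case 0
    have "(axis i (2 * pi * real 0) :: real^'n) = 0" by (simp add: vec_eq_iff axis_def)
    then show ?case by (simp only: add_0_right)
  next
    case (Suc m)
    have "axis i (2 * pi * real (Suc m)) = axis i (2 * pi * real m) + axis i (2 * pi)"
      by (simp add: vec_eq_iff axis_def algebra_simps)
    then show ?case
      using assms Suc unfolding periodic_2pi_def by (metis add.assoc)
  qed
  have int: "f (y + axis i (2 * pi * real_of_int m)) = f y" for y i m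
  proof (cases m rule: int_cases2)
    case (nonneg n)
    then show ?thesis using nat[of y i n] by simp
  next
    case (nonpos n)
    have "axis i (2 * pi * real_of_int m) + axis i (2 * pi * real n) = 0"
      using nonpos by (simp add: vec_eq_iff axis_def)
    then show ?thesis
      using nat[of "y + axis i (2 * pi * real_of_int m)" i n] by (simp add: add.assoc)
  qed
  have "f (y + (\<Sum>i\<in>A. axis i (2 * pi * real_of_int (k $ i)))) = f y" if "finite A" for y A
    using that
  proof (induction A arbitrary: y rule: finite_induct)
    case (insert i A)
    then show ?case using int[of "y + (\<Sum>i\<in>A. axis i (2 * pi * real_of_int (k $ i)))" i "k $ i"]
      by (simp add: add_ac)
  qed simp
  moreover have "(\<Sum>i\<in>UNIV. axis i (2 * pi * real_of_int (k $ i))) = (2 * pi) *\<^sub>R real_freq k"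
    by (simp add: vec_eq_iff axis_def real_freq_nth sum.delta)
  ultimately show ?thesis by (metis finite_class.finite_UNIV)
qed

lemma exists_torus_cell_representative: "\<exists>k. x + (2 * pi) *\<^sub>R real_freq k \<in> torus_cell"
proof
  let ?k = "\<chi> i. - \<lfloor>x $ i / (2 * pi)\<rfloor>"
  have "0 \<le> x $ i - 2 * pi * of_int \<lfloor>x $ i / (2 * pi)\<rfloor> \<and> x $ i - 2 * pi * of_int \<lfloor>x $ i / (2 * pi)\<rfloor> \<le> 2 * pi" for i
  proof -
    have "of_int \<lfloor>x $ i / (2 * pi)\<rfloor> \<le> x $ i / (2 * pi)" "x $ i / (2 * pi) \<le> of_int \<lfloor>x $ i / (2 * pi)\<rfloor> + 1"
      using floor_correct[of "x $ i / (2 * pi)"] by linarith+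
    then have "of_int \<lfloor>x $ i / (2 * pi)\<rfloor> * (2 * pi) \<le> x $ i"
      "x $ i \<le> (of_int \<lfloor>x $ i / (2 * pi)\<rfloor> + 1) * (2 * pi)"
      by (simp_all only: pos_le_divide_eq pos_divide_le_eq mult_pos_pos pi_gt_zero zero_less_numeral)
    then show ?thesis by (simp only: distrib_right) (simp only: mult.commute mult_1, linarith)
  qed
  then show "x + (2 * pi) *\<^sub>R real_freq ?k \<in> torus_cell"
    by (simp add: mem_torus_cell real_freq_nth)
qed

lemma torus_map_eqD:
  assumes "torus_map x = torus_map y"
  obtains k where "y = x + (2 * pi) *\<^sub>R real_freq k"
proof -
  have "\<exists>m::int. y $ i = x $ i + 2 * pi * m" for i
  proof -
    have "cis (x $ i) = cis (y $ i)" using assms by (simp add: torus_map_def vec_eq_iff)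
    then have "sin (y $ i) = sin (x $ i) \<and> cos (y $ i) = cos (x $ i)"
      by (simp add: complex_eq_iff)
    then obtain n :: int where "y $ i = x $ i + 2 * pi * of_int n"
      using sin_cos_eq_iff by metis
    then show ?thesis by blast
  qed
  then obtain m where m: "\<And>i. y $ i = x $ i + 2 * pi * of_int (m i)" by metis
  show ?thesis
    by (rule that[of "\<chi> i. m i"]) (simp add: vec_eq_iff real_freq_nth m)
qed

text \<open>A continuous periodic function descends to the product of circles because a compact
  quotient map is closed. Approximating it there by polynomials shows that the integral of
  its square vanishes if it is orthogonal to all exponentials.\<close>

lemma periodic_eq_0_if_fourier_coeffs_0:
  fixes g :: "real^'n \<Rightarrow> real"
  assumes per: "periodic_2pi g" and cont: "continuous_on UNIV g"
    and orth: "\<And>k. integral torus_cell (\<lambda>x. of_real (g x) * cis (real_freq k \<bullet> x)) = 0"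
  shows "g x = 0"
proof -
  let ?S = "torus_map ` torus_cell"
  have contc: "continuous_on S g" for S using cont continuous_on_subset by blast
  have S: "compact ?S" by (rule compact_continuous_image[OF continuous_torus_map compact_torus_cell])
  define G where "G z = g (inv_into torus_cell torus_map z)" for z
  have G: "G (torus_map x) = g x" if "x \<in> torus_cell" for x
  proof -
    have "torus_map x = torus_map (inv_into torus_cell torus_map (torus_map x))"
      using that by (simp add: f_inv_into_f)
    then obtain k where "inv_into torus_cell torus_map (torus_map x) = x + (2 * pi) *\<^sub>R real_freq k"
      by (rule torus_map_eqD)
    then show ?thesis by (simp add: G_def periodic_lattice[OF per])
  qed
  have contG: "continuous_on ?S G"
  proof (subst continuous_on_closed_vimage[OF compact_imp_closed[OF S]], intro allI impI)
    fix B :: "real set" assume "closed B"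
    then have "closed (g -` B \<inter> torus_cell)"
      using iffD1[OF continuous_on_closed_vimage[OF compact_imp_closed[OF compact_torus_cell]] contc]
      by (elim allE[of _ B]) simp
    from compact_Int_closed[OF compact_torus_cell this] have "compact (g -` B \<inter> torus_cell)"
      by (simp add: Int_ac)
    then have "compact (torus_map ` (g -` B \<inter> torus_cell))"
      by (rule compact_continuous_image[OF continuous_torus_map])
    moreover have "G -` B \<inter> ?S = torus_map ` (g -` B \<inter> torus_cell)" using G by auto
    ultimately show "closed (G -` B \<inter> ?S)" by (simp add: compact_imp_closed)
  qed
  have trig: "integral torus_cell (\<lambda>x. of_real (g x) * h x) = 0" if "trig_poly h" for h
    using that
  proof (induction rule: trig_poly.induct)
    case (mono c k)
    have "integral torus_cell (\<lambda>x. of_real (g x) * (c * cis (real_freq k \<bullet> x))) =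
        integral torus_cell (\<lambda>x. c * (of_real (g x) * cis (real_freq k \<bullet> x)))"
      by (simp add: mult_ac)
    then show ?case using orth[of k] by simp
  next
    case (add f h)
    have "(\<lambda>x. of_real (g x) * f x) integrable_on torus_cell" "(\<lambda>x. of_real (g x) * h x) integrable_on torus_cell"
      by (intro integrable_torus_cell continuous_intros contc continuous_trig_poly add)+
    then show ?case using add by (simp add: distrib_left integral_add)
  qed
  \<comment> \<open>positive, because \<open>B\<close> is in the denominator of the accuracy \<open>d\<close> below\<close>
  obtain B where B: "\<And>x. x \<in> torus_cell \<Longrightarrow> \<bar>g x\<bar> \<le> B" and B0: "0 < B"
  proof -
    obtain B where "\<forall>x\<in>torus_cell. norm (g x) \<le> B"
      using continuous_on_compact_norm_bound[OF compact_torus_cell contc] by blast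
    then show ?thesis by (intro that[of "max 1 B"]) (auto intro: max.coboundedI2)
  qed
  let ?V = "measure lborel (torus_cell :: (real^'n) set)"
  have V: "?V > 0" by (simp add: content_torus_cell)
  have small: "integral torus_cell (\<lambda>x. (g x)\<^sup>2) \<le> e" if e: "e > 0" for e
  proof -
    define d where "d = e / (B * ?V)"
    have d: "d > 0" using e B0 V by (simp add: d_def)
    obtain p where p: "polynomial_function p" "\<forall>z\<in>?S. norm (G z - p z) < d"
      using Stone_Weierstrass_polynomial_function[OF S contG d] by blast
    let ?h = "\<lambda>x. p (torus_map x)"
    have tp: "trig_poly (\<lambda>x. of_real (?h x) :: complex)"
      using p(1) by (intro trig_poly_real_polynomial) (simp add: real_polynomial_function_eq)
    have ch: "continuous_on T ?h" for T
    proof -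
      have "continuous_on T (\<lambda>x. Re (of_real (?h x)))"
        using continuous_trig_poly[OF tp] by (rule continuous_on_Re)
      then show ?thesis by simp
    qed
    have i1: "(\<lambda>x. g x * ?h x) integrable_on torus_cell"
      by (intro integrable_torus_cell continuous_intros contc ch)
    have i2: "(\<lambda>x. (g x)\<^sup>2 - g x * ?h x) integrable_on torus_cell"
      by (intro integrable_torus_cell continuous_intros contc ch)
    have i3: "(\<lambda>x. (g x)\<^sup>2) integrable_on torus_cell"
      by (intro integrable_torus_cell continuous_intros contc)
    have "of_real (integral torus_cell (\<lambda>x. g x * ?h x)) = (0::complex)"
      using trig[OF tp] integral_linear[OF i1 bounded_linear_of_real[where 'a = complex]]
      by (simp add: o_def)
    then have "integral torus_cell (\<lambda>x. (g x)\<^sup>2) = integral torus_cell (\<lambda>x. (g x)\<^sup>2 - g x * ?h x)"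
      by (simp add: integral_diff[OF i3 i1])
    also have "\<dots> \<le> integral torus_cell (\<lambda>x::real^'n. B * d)"
    proof (rule integral_le[OF i2])
      show "(\<lambda>x::real^'n. B * d) integrable_on torus_cell"
        by (intro integrable_torus_cell continuous_intros)
      fix x :: "real^'n" assume x: "x \<in> torus_cell"
      have "(g x)\<^sup>2 - g x * ?h x = g x * (G (torus_map x) - p (torus_map x))"
        by (simp add: G[OF x] power2_eq_square algebra_simps)
      also have "\<dots> \<le> \<bar>g x\<bar> * \<bar>G (torus_map x) - p (torus_map x)\<bar>"
        by (metis abs_ge_self abs_mult)
      also have "\<dots> \<le> B * d"
        using p(2) x B[OF x] by (intro mult_mono) (auto intro: less_imp_le)
      finally show "(g x)\<^sup>2 - g x * ?h x \<le> B * d" .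
    qed
    also have "\<dots> = e" using B0 V by (simp add: d_def torus_cell_def)
    finally show ?thesis .
  qed
  have "integral torus_cell (\<lambda>x. (g x)\<^sup>2) = 0"
  proof (rule antisym)
    show "integral torus_cell (\<lambda>x. (g x)\<^sup>2) \<le> 0" using small by (metis field_le_epsilon add_0)
    show "0 \<le> integral torus_cell (\<lambda>x. (g x)\<^sup>2)" by (rule integral_nonneg) (auto intro!: integrable_torus_cell continuous_intros contc)
  qed
  then have zero: "g y = 0" if "y \<in> torus_cell" for y
    using that unfolding torus_cell_def
    by (subst (asm) integral_cbox_eq_0_iff) (auto intro!: continuous_intros contc simp: interval_ne_empty_cart)
  obtain k where "x + (2 * pi) *\<^sub>R real_freq k \<in> torus_cell" using exists_torus_cell_representative by blast
  from zero[OF this] show ?thesis by (simp add: periodic_lattice[OF per])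
qed

lemma fourier_coeff_nth:
  "fourier_coeff f k $ i = of_real (1 / (2 * pi) ^ CARD('n)) *
     integral torus_cell (\<lambda>x::real^'n. of_real (f x $ i) * cis (real_freq (- k) \<bullet> x))"
  by (simp add: fourier_coeff_def real_freq_uminus)

lemma fourier_coeff_diff:
  assumes "continuous_on torus_cell f" "continuous_on torus_cell g"
  shows "fourier_coeff (\<lambda>x. f x - g x) k = fourier_coeff f k - fourier_coeff g k"
proof -
  have d: "continuous_on torus_cell (\<lambda>x. f x - g x)" by (intro continuous_intros assms)
  have i: "(\<lambda>x. cis (- (real_freq k \<bullet> x)) *s cvec (f x)) integrable_on torus_cell"
    "(\<lambda>x. cis (- (real_freq k \<bullet> x)) *s cvec (g x)) integrable_on torus_cell"
    by (intro integrable_torus_cell continuous_intros assms)+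
  have "cis (- (real_freq k \<bullet> x)) *s cvec (f x - g x) =
      cis (- (real_freq k \<bullet> x)) *s cvec (f x) - cis (- (real_freq k \<bullet> x)) *s cvec (g x)" for x
    by (simp add: vec_eq_iff algebra_simps)
  then show ?thesis
    by (simp add: fourier_coeff_eq assms d integral_diff[OF i] scaleR_diff_right)
qed

lemma eq_if_fourier_coeff_eq:
  fixes f g :: "real^'n \<Rightarrow> real^'n"
  assumes f: "periodic_2pi f" "continuous_on UNIV f" and g: "periodic_2pi g" "continuous_on UNIV g"
    and eq: "\<And>k. fourier_coeff f k = fourier_coeff g k"
  shows "f x = g x"
proof -
  have c: "continuous_on torus_cell f" "continuous_on torus_cell g"
    using f g continuous_on_subset by blast+
  have "(f x - g x) $ i = 0" for i
  proof (rule periodic_eq_0_if_fourier_coeffs_0[where g = "\<lambda>x. (f x - g x) $ i"])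
    show "periodic_2pi (\<lambda>x. (f x - g x) $ i)" using f g by (simp add: periodic_2pi_def)
    show "continuous_on UNIV (\<lambda>x. (f x - g x) $ i)" by (intro continuous_intros f g)
    fix k
    have "fourier_coeff (\<lambda>x. f x - g x) (- k) $ i = 0"
      by (simp add: fourier_coeff_diff[OF c] eq)
    then show "integral torus_cell (\<lambda>x. of_real ((f x - g x) $ i) * cis (real_freq k \<bullet> x)) = 0"
      unfolding fourier_coeff_nth by simp
  qed
  then show ?thesis by (simp add: vec_eq_iff)
qed

text \<open>The condition on the coefficients that characterises real fields.\<close>

definition hermitian :: "(int^'n \<Rightarrow> complex^'n) \<Rightarrow> bool" where
  "hermitian c \<longleftrightarrow> (\<forall>k i. c (- k) $ i = cnj (c k $ i))"

lemma hermitian_fourier_coeff: "hermitian (fourier_coeff f)"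
  by (simp add: hermitian_def fourier_coeff_uminus)

lemma bij_uminus_vec: "bij (uminus :: int^'n \<Rightarrow> int^'n)"
  by (rule bij_betwI[of _ _ _ uminus]) auto

lemma summable_modes:
  assumes "rapid (\<lambda>_::real. c)"
  shows "(\<lambda>l. cis (\<theta> l) *s (c l :: complex^'n)) summable_on UNIV"
proof -
  obtain M where M: "M summable_on UNIV" "\<And>t k. t \<in> {0..0::real} \<Longrightarrow> norm (c k) \<le> M k"
    using rapid_majorant0[OF assms] by metis
  show ?thesis
    by (rule summable_on_of_norm_le[OF M(1)]) (use M(2)[of 0] in \<open>simp add: norm_smult\<close>)
qed

text \<open>The reflection \<open>l \<mapsto> - l\<close> turns the series of a Hermitian family into its conjugate, so
  the series is real already.\<close>

lemma cvec_synth: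
  assumes c: "rapid (\<lambda>_::real. c)" and herm: "hermitian c"
  shows "cvec (synth c x) = (\<Sum>\<^sub>\<infinity>l. cis (real_freq l \<bullet> x) *s c l)"
proof -
  have "cvec (synth c x) $ i = (\<Sum>\<^sub>\<infinity>l. cis (real_freq l \<bullet> x) *s c l) $ i" for i
  proof -
    let ?g = "\<lambda>l. c l $ i * cis (real_freq l \<bullet> x)"
    have g: "?g summable_on UNIV"
      using summable_on_bounded_linear[OF bounded_linear_vec_nth[of i]
          summable_modes[OF c, of "\<lambda>l. real_freq l \<bullet> x"]]
      by (simp add: mult.commute)
    have "infsum ?g UNIV = (\<Sum>\<^sub>\<infinity>l. ?g (- l))"
      using infsum_reindex_bij_betw[OF bij_uminus_vec, of ?g] by simp
    also have "\<dots> = (\<Sum>\<^sub>\<infinity>l. cnj (?g l))"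
      using herm by (simp add: hermitian_def real_freq_uminus cis_cnj)
    also have "\<dots> = cnj (infsum ?g UNIV)" by (rule infsum_cnj)
    finally have "infsum ?g UNIV \<in> \<real>"
      unfolding Reals_cnj_iff by (rule sym)
    then have real: "of_real (Re (infsum ?g UNIV)) = infsum ?g UNIV" by (rule of_real_Re)
    have "synth c x $ i = (\<Sum>\<^sub>\<infinity>l. wave (c l) (real_freq l \<bullet> x) $ i)"
      unfolding synth_def
      by (rule infsum_linear_image[OF bounded_linear_vec_nth summable_wave[OF c order_refl], symmetric])
    also have "\<dots> = Re (infsum ?g UNIV)"
      by (simp only: wave_def vec_lambda_beta infsum_Re[OF g])
    finally have "cvec (synth c x) $ i = infsum ?g UNIV" using real by simp
    also have "\<dots> = (\<Sum>\<^sub>\<infinity>l. (cis (real_freq l \<bullet> x) *s c l) $ i)" by (simp add: mult.commute)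
    also have "\<dots> = (\<Sum>\<^sub>\<infinity>l. cis (real_freq l \<bullet> x) *s c l) $ i"
      by (rule infsum_linear_image[OF bounded_linear_vec_nth summable_modes[OF c]])
    finally show ?thesis .
  qed
  then show ?thesis by (simp add: vec_eq_iff)
qed

text \<open>Orthogonality of the exponentials, after integration term by term.\<close>

lemma fourier_coeff_synth:
  fixes c :: "int^'n \<Rightarrow> complex^'n"
  assumes c: "rapid (\<lambda>_::real. c)" and herm: "hermitian c"
  shows "fourier_coeff (synth c) k = c k"
proof -
  obtain M where M: "M summable_on UNIV" "\<And>t k. t \<in> {0..0::real} \<Longrightarrow> norm (c k) \<le> M k"
    using rapid_majorant0[OF c] by metis
  let ?f = "\<lambda>l x. cis (real_freq (l - k) \<bullet> x) *s c l"
  have "((\<lambda>l. integral torus_cell (?f l)) has_sum integral torus_cell (\<lambda>x. \<Sum>\<^sub>\<infinity>l. ?f l x)) UNIV"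
    unfolding torus_cell_def
    by (rule has_sum_integral_termwise[OF _ _ M(1)])
      (use M(2)[of 0] in \<open>auto simp: norm_smult intro!: continuous_intros\<close>)
  moreover have "integral torus_cell (?f l) = (if l = k then (2 * pi) ^ CARD('n) *\<^sub>R c k else 0)" for l
  proof -
    have lin: "bounded_linear (\<lambda>z. z *s c l)"
      by (rule bounded_bilinear.bounded_linear_left[OF bounded_bilinear_smult])
    have "(\<lambda>x. cis (real_freq (l - k) \<bullet> x)) integrable_on torus_cell"
      by (intro integrable_torus_cell continuous_intros)
    from integral_linear[OF this lin]
    have "integral torus_cell (?f l) = integral torus_cell (\<lambda>x. cis (real_freq (l - k) \<bullet> x)) *s c l"
      by (simp add: o_def)
    then show ?thesis
    proof (cases "l = k")
      case True
      then show ?thesis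
        using \<open>integral torus_cell (?f l) = _\<close> unfolding integral_cis True
        by (simp add: vec_eq_iff scaleR_conv_of_real[where 'a = complex])
    qed (simp add: integral_cis)
  qed
  ultimately have hs: "((\<lambda>l. if l = k then (2 * pi) ^ CARD('n) *\<^sub>R c k else 0) has_sum
      integral torus_cell (\<lambda>x. \<Sum>\<^sub>\<infinity>l. ?f l x)) UNIV" by simp
  have "((\<lambda>l. if l = k then (2 * pi) ^ CARD('n) *\<^sub>R c k else 0) has_sum (2 * pi) ^ CARD('n) *\<^sub>R c k) UNIV"
    by (rule has_sum_finite_neutralI[of "{k}"]) auto
  with hs have "integral torus_cell (\<lambda>x. \<Sum>\<^sub>\<infinity>l. ?f l x) = (2 * pi) ^ CARD('n) *\<^sub>R c k"
    by (rule has_sum_unique)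
  moreover have "cis (- (real_freq k \<bullet> x)) *s cvec (synth c x) = (\<Sum>\<^sub>\<infinity>l. ?f l x)" for x
  proof -
    have "cis (- (real_freq k \<bullet> x)) *s cvec (synth c x) = (\<Sum>\<^sub>\<infinity>l. cis (- (real_freq k \<bullet> x)) *s (cis (real_freq l \<bullet> x) *s c l))"
      unfolding cvec_synth[OF c herm]
      by (rule infsum_linear_image[OF bounded_linear_smult summable_modes[OF c], symmetric])
    then show ?thesis
      by (simp add: real_freq_diff inner_diff_left cis_mult vector_smult_assoc)
  qed
  ultimately show ?thesis
    by (simp add: fourier_coeff_eq[OF continuous_synth[OF c]])
qed

lemma rapid_fourier_coeff_const: "smooth_torus f \<Longrightarrow> rapid (\<lambda>_::real. fourier_coeff f)"
proof (rule rapid_fourier_coeff)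
  assume f: "smooth_torus f"
  have "continuous_on ({0..} \<times> UNIV) (\<lambda>p::real \<times> (real^'a). partials js f (snd p))" for js
    by (rule continuous_on_compose2[OF smooth_torus_continuous[OF smooth_torus_partials[OF f]]])
      (auto intro: continuous_intros)
  then show "Cd_smooth 0 {0..} (\<lambda>_. f)"
    using f by (auto simp: Cd_smooth_def case_prod_beta)
qed

lemma synth_fourier_coeff:
  assumes f: "smooth_torus f"
  shows "synth (fourier_coeff f) x = f x"
proof (rule eq_if_fourier_coeff_eq[where f = "synth (fourier_coeff f)" and g = f])
  note r = rapid_fourier_coeff_const[OF f]
  show "periodic_2pi (synth (fourier_coeff f))" "continuous_on UNIV (synth (fourier_coeff f))"
    "periodic_2pi f" "continuous_on UNIV f"
    using f periodic_synth continuous_synth[OF r] smooth_torus_continuous[OF f]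
    by (auto simp: smooth_torus_def)
  show "fourier_coeff (synth (fourier_coeff f)) k = fourier_coeff f k" for k
    by (rule fourier_coeff_synth[OF r hermitian_fourier_coeff])
qed

section \<open>The equation in Fourier space\<close>

text \<open>Bilinear, without conjugation of \<open>w\<close>: \<open>i fdot k w\<close> is the coefficient of a divergence.\<close>

definition fdot :: "int^'n \<Rightarrow> complex^'n \<Rightarrow> complex" where
  "fdot k w = (\<Sum>j\<in>UNIV. of_int (k $ j) * w $ j)"

text \<open>The coefficients of \<open>a \<cdot> \<nabla> b\<close>. The factor would be \<open>k - l\<close> for general \<open>a\<close>; it may be
  replaced by \<open>k\<close> because \<open>a\<close> is divergence free.\<close>

definition transport :: "(int^'n \<Rightarrow> complex^'n) \<Rightarrow> (int^'n \<Rightarrow> complex^'n) \<Rightarrow> int^'n \<Rightarrow> complex^'n" where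
  "transport a b k = (\<Sum>\<^sub>\<infinity>l. (\<i> * fdot k (a l)) *s b (k - l))"

definition solenoidal :: "(int^'n \<Rightarrow> complex^'n) \<Rightarrow> bool" where
  "solenoidal a \<longleftrightarrow> (\<forall>k. fdot k (a k) = 0)"

lemma solenoidal_fourier_coeff:
  assumes f: "smooth_torus f" and div: "\<And>x. divergence f x = 0"
  shows "solenoidal (fourier_coeff f)"
  unfolding solenoidal_def fdot_def
proof
  fix k :: "int^'a"
  have c: "continuous_on torus_cell (partial j f)" for j
    by (rule smooth_torus_continuous[OF smooth_torus_partial[OF f]])
  have i: "(\<lambda>x. of_real (partial j f x $ j) * cis (- (real_freq k \<bullet> x))) integrable_on torus_cell" for j
    by (intro integrable_torus_cell continuous_intros c)
  have "(\<Sum>j\<in>UNIV. fourier_coeff (partial j f) k $ j) = of_real (1 / (2 * pi) ^ CARD('a)) *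
      integral torus_cell (\<lambda>x. \<Sum>j\<in>UNIV. of_real (partial j f x $ j) * cis (- (real_freq k \<bullet> x)))"
    by (simp add: fourier_coeff_def integral_sum[OF _ i] sum_distrib_left)
  also have "(\<lambda>x. \<Sum>j\<in>UNIV. of_real (partial j f x $ j) * cis (- (real_freq k \<bullet> x))) = (\<lambda>x. of_real (divergence f x) * cis (- (real_freq k \<bullet> x)))"
    by (simp add: divergence_def sum_distrib_right)
  finally have "\<i> * (\<Sum>j\<in>UNIV. of_int (k $ j) * fourier_coeff f k $ j) = 0"
    by (simp add: fourier_coeff_partial[OF f] dmul_def div sum_distrib_left mult.assoc)
  then show "(\<Sum>j\<in>UNIV. of_int (k $ j) * fourier_coeff f k $ j) = 0" by simp
qed

text \<open>Only \<open>v\<close> is expanded into its Fourier series. Multiplying \<open>\<partial>\<^sub>j u\<close> by one of its modes shifts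
  the coefficients of \<open>\<partial>\<^sub>j u\<close>, so a single series has to be integrated term by term.\<close>

lemma fourier_coeff_advection:
  fixes v u :: "real^'n \<Rightarrow> real^'n"
  assumes v: "smooth_torus v" and u: "smooth_torus u" and div: "\<And>x. divergence v x = 0"
  shows "fourier_coeff (advection v u) k = transport (fourier_coeff v) (fourier_coeff u) k"
proof -
  let ?a = "fourier_coeff v" and ?b = "fourier_coeff u"
  have cu: "continuous_on S (partial j u)" for j S
    by (rule smooth_torus_continuous[OF smooth_torus_partial[OF u]])
  have cv: "continuous_on S v" for S by (rule smooth_torus_continuous[OF v])
  have cadv: "continuous_on torus_cell (advection v u)"
    unfolding advection_def by (intro continuous_intros cu cv)
  note ra = rapid_fourier_coeff_const[OF v]
  obtain M where M: "M summable_on UNIV" "\<And>t l. t \<in> {0..0::real} \<Longrightarrow> norm (?a l) \<le> M l"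
    using rapid_majorant0[OF ra] by metis
  have M': "norm (?a l) \<le> M l" "norm (?a l $ j) \<le> M l" for l j
    using M(2)[of 0 l] Finite_Cartesian_Product.norm_nth_le[of "?a l" j] by auto
  have "\<exists>B. \<forall>x\<in>torus_cell. norm (partial j u x) \<le> B" for j
    by (rule continuous_on_compact_norm_bound[OF compact_torus_cell cu])
  then obtain B where B: "\<And>j x. x \<in> torus_cell \<Longrightarrow> norm (partial j u x) \<le> B j" by metis
  let ?f = "\<lambda>l x. \<Sum>j\<in>UNIV. (?a l $ j * cis (- (real_freq (k - l) \<bullet> x))) *s cvec (partial j u x)"
  have adv: "cis (- (real_freq k \<bullet> x)) *s cvec (advection v u x) = (\<Sum>\<^sub>\<infinity>l. ?f l x)" for x
  proof -
    have vj: "((\<lambda>l. cis (real_freq l \<bullet> x) * ?a l $ j) has_sum of_real (v x $ j)) UNIV" for j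
    proof -
      have "((\<lambda>l. cis (real_freq l \<bullet> x) *s ?a l) has_sum cvec (v x)) UNIV"
        using has_sum_infsum[OF summable_modes[OF ra, of "\<lambda>l. real_freq l \<bullet> x"]]
        by (simp add: cvec_synth[OF ra hermitian_fourier_coeff, symmetric] synth_fourier_coeff[OF v])
      from has_sum_bounded_linear[OF bounded_linear_vec_nth this, of j] show ?thesis by simp
    qed
    have "((\<lambda>l. \<Sum>j\<in>UNIV. (cis (- (real_freq k \<bullet> x)) * (cis (real_freq l \<bullet> x) * ?a l $ j)) *s cvec (partial j u x)) has_sum
       (\<Sum>j\<in>UNIV. (cis (- (real_freq k \<bullet> x)) * of_real (v x $ j)) *s cvec (partial j u x))) UNIV"
    proof (rule has_sum_sum)
      fix j :: 'n
      have lin: "bounded_linear (\<lambda>z. (cis (- (real_freq k \<bullet> x)) * z) *s cvec (partial j u x))"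
        by (rule bounded_linear_compose[OF bounded_bilinear.bounded_linear_left[OF bounded_bilinear_smult] bounded_linear_mult_right])
      show "((\<lambda>l. (cis (- (real_freq k \<bullet> x)) * (cis (real_freq l \<bullet> x) * ?a l $ j)) *s cvec (partial j u x)) has_sum
       (cis (- (real_freq k \<bullet> x)) * of_real (v x $ j)) *s cvec (partial j u x)) UNIV"
        by (rule has_sum_bounded_linear[OF lin vj])
    qed simp
    moreover have "(\<Sum>j\<in>UNIV. (cis (- (real_freq k \<bullet> x)) * (cis (real_freq l \<bullet> x) * ?a l $ j)) *s cvec (partial j u x)) = ?f l x" for l
      by (intro sum.cong refl) (simp add: real_freq_diff inner_diff_left mult_ac cis_mult)
    moreover have "(\<Sum>j\<in>UNIV. (cis (- (real_freq k \<bullet> x)) * of_real (v x $ j)) *s cvec (partial j u x)) =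
        cis (- (real_freq k \<bullet> x)) *s cvec (advection v u x)"
      by (simp add: vec_eq_iff advection_def sum_distrib_left mult.assoc)
    ultimately have "((\<lambda>l. ?f l x) has_sum cis (- (real_freq k \<bullet> x)) *s cvec (advection v u x)) UNIV"
      by (simp only:)
    then show ?thesis by (rule infsumI[symmetric])
  qed
  have "((\<lambda>l. integral torus_cell (?f l)) has_sum integral torus_cell (\<lambda>x. \<Sum>\<^sub>\<infinity>l. ?f l x)) UNIV"
    unfolding torus_cell_def
  proof (rule has_sum_integral_termwise)
    show "continuous_on (cbox 0 (\<chi> i. 2 * pi)) (?f l)" for l
      by (intro continuous_intros cu)
    show "(\<lambda>l. M l * (\<Sum>j\<in>UNIV. B j)) summable_on UNIV"
      by (rule summable_on_cmult_left[OF M(1)])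
    fix l and x :: "real^'n" assume "x \<in> cbox 0 (\<chi> i. 2 * pi)"
    then have x: "x \<in> torus_cell" by (simp add: torus_cell_def)
    have "norm (?f l x) \<le> (\<Sum>j\<in>UNIV. M l * B j)"
      by (rule sum_norm_le) (auto simp: norm_smult norm_mult intro!: mult_mono M' B[OF x] order_trans[OF norm_ge_zero M'(1)])
    then show "norm (?f l x) \<le> M l * (\<Sum>j\<in>UNIV. B j)" by (simp add: sum_distrib_left)
  qed
  then have "((\<lambda>l. (1 / (2 * pi) ^ CARD('n)) *\<^sub>R integral torus_cell (?f l)) has_sum
      (1 / (2 * pi) ^ CARD('n)) *\<^sub>R integral torus_cell (\<lambda>x. \<Sum>\<^sub>\<infinity>l. ?f l x)) UNIV"
    by (rule has_sum_bounded_linear[OF bounded_linear_scaleR_right])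
  moreover have "(1 / (2 * pi) ^ CARD('n)) *\<^sub>R integral torus_cell (\<lambda>x. \<Sum>\<^sub>\<infinity>l. ?f l x) = fourier_coeff (advection v u) k"
    by (simp add: fourier_coeff_eq[OF cadv] adv)
  moreover have "(1 / (2 * pi) ^ CARD('n)) *\<^sub>R integral torus_cell (?f l) =
      (\<i> * (\<Sum>j\<in>UNIV. of_int (k $ j) * ?a l $ j)) *s ?b (k - l)" for l
  proof -
    let ?m = "k - l"
    have i: "(\<lambda>x. cis (- (real_freq ?m \<bullet> x)) *s cvec (partial j u x)) integrable_on torus_cell" for j
      by (intro integrable_torus_cell continuous_intros cu)
    have i': "(\<lambda>x. (?a l $ j * cis (- (real_freq ?m \<bullet> x))) *s cvec (partial j u x)) integrable_on torus_cell" for j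
      by (intro integrable_torus_cell continuous_intros cu)
    have "integral torus_cell (\<lambda>x. (?a l $ j * cis (- (real_freq ?m \<bullet> x))) *s cvec (partial j u x)) =
        ?a l $ j *s integral torus_cell (\<lambda>x. cis (- (real_freq ?m \<bullet> x)) *s cvec (partial j u x))" for j
      using integral_linear[OF i bounded_linear_smult, of "?a l $ j" j] by (simp add: o_def vector_smult_assoc)
    then have "(1 / (2 * pi) ^ CARD('n)) *\<^sub>R integral torus_cell (?f l) =
       (\<Sum>j\<in>UNIV. ?a l $ j *s fourier_coeff (partial j u) ?m)"
      by (simp add: integral_sum[OF _ i'] fourier_coeff_eq[OF cu] scaleR_sum_right vec_eq_iff mult.left_commute
          scaleR_conv_of_real[where 'a = complex])
    also have "\<dots> = (\<i> * (\<Sum>j\<in>UNIV. of_int (?m $ j) * ?a l $ j)) *s ?b ?m"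
      by (simp add: fourier_coeff_partial[OF u] dmul_def vec_eq_iff sum_distrib_left sum_distrib_right mult_ac)
    also have "(\<Sum>j\<in>UNIV. of_int (?m $ j) * ?a l $ j) = (\<Sum>j\<in>UNIV. of_int (k $ j) * ?a l $ j)"
      using solenoidal_fourier_coeff[OF v div] by (simp add: solenoidal_def fdot_def left_diff_distrib sum_subtractf)
    finally show ?thesis .
  qed
  ultimately show ?thesis by (simp add: transport_def fdot_def infsumI)
qed

lemma fdot_add: "fdot k (x + y) = fdot k x + fdot k y"
  by (simp add: fdot_def distrib_left sum.distrib)

lemma fdot_smult: "fdot k (z *s w) = z * fdot k w"
  by (simp add: fdot_def sum_distrib_left mult.left_commute)

lemma fdot_diff_left: "fdot (k - l) w = fdot k w - fdot l w"
  by (simp add: fdot_def left_diff_distrib sum_subtractf)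

lemma norm_fdot_le: "norm (fdot k w) \<le> norm (real_freq k) * norm w"
proof -
  have "norm (fdot k w) \<le> (\<Sum>j\<in>UNIV. \<bar>real_freq k $ j\<bar> * \<bar>norm (w $ j)\<bar>)"
    unfolding fdot_def by (rule sum_norm_le) (simp add: norm_mult real_freq_nth)
  also have "\<dots> \<le> L2_set (\<lambda>j. real_freq k $ j) UNIV * L2_set (\<lambda>j. norm (w $ j)) UNIV"
    by (rule L2_set_mult_ineq)
  also have "\<dots> = norm (real_freq k) * norm w"
    by (simp add: norm_vec_def L2_set_def)
  finally show ?thesis .
qed

lemma bounded_linear_fdot: "bounded_linear (fdot k)"
proof (rule bounded_linear_intro[where K = "norm (real_freq k)"])
  show "fdot k (r *\<^sub>R x) = r *\<^sub>R fdot k x" for r x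
    by (simp add: fdot_def scaleR_sum_right)
  show "norm (fdot k x) \<le> norm x * norm (real_freq k)" for x
    using norm_fdot_le[of k x] by (simp add: mult.commute)
qed (rule fdot_add)

section \<open>The Leray symbol\<close>

lemma leray_symbol_eq:
  "leray_symbol k w = (if k = 0 then w
     else w - (fdot k w / of_real ((norm (real_freq k))\<^sup>2)) *s cvec (real_freq k))"
proof -
  have "(\<chi> i. of_int (k $ i)) = cvec (real_freq k)"
    by (simp add: vec_eq_iff real_freq_nth)
  then show ?thesis by (simp add: leray_symbol_def fdot_def)
qed

lemma inner_complex_eq_Re: "x \<bullet> y = Re (x * cnj y)" for x y :: complex
  by (simp add: inner_complex_def)

lemma inner_smult_self: "(z *s w) \<bullet> w = Re z * (norm (w :: complex^'n))\<^sup>2"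
proof -
  have "(z *s w) \<bullet> w = (\<Sum>i\<in>UNIV. Re (z * of_real ((norm (w $ i))\<^sup>2)))"
    unfolding inner_vec_def inner_complex_eq_Re
    by (simp only: vector_smult_component mult.assoc flip: complex_norm_square)
  also have "\<dots> = Re z * (\<Sum>i\<in>UNIV. (norm (w $ i))\<^sup>2)"
    by (simp add: sum_distrib_left)
  finally show ?thesis
    by (simp add: norm_vec_def L2_set_def sum_nonneg)
qed

lemma inner_smult_freq: "(z *s cvec (real_freq k)) \<bullet> w = Re (z * cnj (fdot k w))"
  unfolding inner_vec_def inner_complex_eq_Re fdot_def
  by (simp add: real_freq_nth sum_distrib_left cnj_sum mult.assoc Re_sum)

lemma leray_symbol_add: "leray_symbol k (x + y) = leray_symbol k x + leray_symbol k y"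
  by (simp add: leray_symbol_eq fdot_add add_divide_distrib vec_eq_iff algebra_simps)

lemma leray_symbol_smult: "leray_symbol k (z *s w) = z *s leray_symbol k w"
  by (simp add: leray_symbol_eq fdot_smult vec_eq_iff algebra_simps)

text \<open>Pythagoras: \<open>|P\<^sub>k w|\<^sup>2 = |w|\<^sup>2 - |k \<bullet> w|\<^sup>2 / |k|\<^sup>2\<close>.\<close>

lemma norm_leray_symbol_le: "norm (leray_symbol k w) \<le> norm w"
proof (cases "k = 0")
  case False
  let ?s = "fdot k w / of_real ((norm (real_freq k))\<^sup>2)" and ?f = "cvec (real_freq k)"
  have "(leray_symbol k w) \<bullet> (leray_symbol k w) = w \<bullet> w - 2 * ((?s *s ?f) \<bullet> w) + (?s *s ?f) \<bullet> (?s *s ?f)"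
    using False by (simp add: leray_symbol_eq inner_diff_left inner_diff_right inner_commute)
  also have "(?s *s ?f) \<bullet> w = (norm (fdot k w))\<^sup>2 / (norm (real_freq k))\<^sup>2"
  proof -
    have "?s * cnj (fdot k w) = of_real ((norm (fdot k w))\<^sup>2 / (norm (real_freq k))\<^sup>2)"
      using complex_norm_square[of "fdot k w"] by (simp add: mult.commute)
    then show ?thesis by (simp only: inner_smult_freq Re_complex_of_real)
  qed
  also have "(?s *s ?f) \<bullet> (?s *s ?f) = (norm (fdot k w))\<^sup>2 / (norm (real_freq k))\<^sup>2"
  proof -
    have "(?s *s ?f) \<bullet> (?s *s ?f) = (norm ?s * norm (real_freq k))\<^sup>2"
      by (simp add: norm_smult flip: power2_norm_eq_inner)
    also have "\<dots> = (norm (fdot k w))\<^sup>2 / (norm (real_freq k))\<^sup>2"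
    proof -
      have "norm ?s = norm (fdot k w) / (norm (real_freq k))\<^sup>2"
        by (simp only: norm_divide norm_of_real abs_power2)
      then show ?thesis
        using False by (simp add: power_mult_distrib power_divide power2_eq_square)
    qed
    finally show ?thesis .
  qed
  finally have "(leray_symbol k w) \<bullet> (leray_symbol k w) = w \<bullet> w - (norm (fdot k w))\<^sup>2 / (norm (real_freq k))\<^sup>2"
    by simp
  then have "(leray_symbol k w) \<bullet> (leray_symbol k w) \<le> w \<bullet> w"
    by simp
  then show ?thesis by (simp add: norm_le)
qed (simp add: leray_symbol_eq)

lemma bounded_linear_leray_symbol: "bounded_linear (leray_symbol k)"
proof (rule bounded_linear_intro[where K = 1])
  show "leray_symbol k (r *\<^sub>R x) = r *\<^sub>R leray_symbol k x" for r x
  proof -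
    have "r *\<^sub>R y = of_real r *s y" for y :: "complex^'a"
      by (simp add: vec_eq_iff scaleR_conv_of_real[where 'a = complex])
    then show ?thesis by (simp add: leray_symbol_smult)
  qed
qed (simp_all add: leray_symbol_add norm_leray_symbol_le)

text \<open>The mean flow \<open>a\<^sub>0\<close> only rotates the phases of the coefficients, also after projection,
  as the projection is self-adjoint; here \<open>r\<close> stands for \<open>fdot k a\<^sub>0\<close>, which is real.\<close>

lemma inner_leray_symbol_imaginary: "leray_symbol k ((\<i> * of_real r) *s w) \<bullet> w = 0"
proof (cases "k = 0")
  case True
  then show ?thesis by (simp add: leray_symbol_eq inner_smult_self)
next
  case False
  have "((\<i> * of_real r) * (fdot k w / of_real ((norm (real_freq k))\<^sup>2))) * cnj (fdot k w) =
      \<i> * of_real (r * (norm (fdot k w))\<^sup>2 / (norm (real_freq k))\<^sup>2)"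
    using complex_norm_square[of "fdot k w"] by (simp add: mult.assoc)
  then show ?thesis
    using False by (simp add: leray_symbol_smult)
      (simp add: leray_symbol_eq inner_diff_left vector_ssub_ldistrib inner_smult_self
        vector_smult_assoc inner_smult_freq)
qed

section \<open>Convolutions of rapidly decaying families\<close>

text \<open>After the weight has been split between the factors, \<open>a\<close> is summed over \<open>l\<close> and \<open>b\<close> need
  only be bounded. The kernel \<open>F\<close> is left general because it is used for the transport term and
  for the sum of the sizes of its summands.\<close>

lemma rapid_convolution:
  fixes F :: "real \<Rightarrow> int^'n \<Rightarrow> int^'n \<Rightarrow> 'b::banach"
  assumes a: "rapid a" and b: "rapid b"
    and cont: "\<And>k l. continuous_on {0..} (\<lambda>t. F t k l)"
    and bound: "\<And>t k l. t \<ge> 0 \<Longrightarrow> norm (F t k l) \<le> (weight l * norm (a t l)) * (weight (k - l) * norm (b t (k - l)))"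
  shows "rapid (\<lambda>t k. \<Sum>\<^sub>\<infinity>l. F t k l)"
    and "\<And>T k. \<exists>M. M summable_on UNIV \<and> (\<forall>t\<in>{0..T}. \<forall>l. norm (F t k l) \<le> M l)"
proof -
  have maj: "\<exists>M C. M summable_on UNIV \<and> 0 \<le> C \<and> (\<forall>t\<in>{0..T}. \<forall>k l. weight k ^ m * norm (F t k l) \<le> M l * C)" for m T
  proof -
    obtain M where M: "M summable_on UNIV" "\<And>l. 0 \<le> M l"
      "\<And>t l. t \<in> {0..T} \<Longrightarrow> weight l ^ Suc m * norm (a t l) \<le> M l"
      using rapid_majorant[OF a] by metis
    obtain C where C: "0 \<le> C" "\<And>t l. t \<in> {0..T} \<Longrightarrow> weight l ^ Suc m * norm (b t l) \<le> C"
      using rapid_bound[OF b] by metis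
    have "weight k ^ m * norm (F t k l) \<le> M l * C" if t: "t \<in> {0..T}" for t k l
    proof -
      have "weight k ^ m * norm (F t k l) \<le> (weight (k - l) ^ m * weight l ^ m) *
          ((weight l * norm (a t l)) * (weight (k - l) * norm (b t (k - l))))"
        using t by (intro mult_mono weight_power_submult bound) auto
      also have "\<dots> = (weight l ^ Suc m * norm (a t l)) * (weight (k - l) ^ Suc m * norm (b t (k - l)))"
        by simp
      also have "\<dots> \<le> M l * C"
        using M(2,3) C t by (intro mult_mono) auto
      finally show ?thesis .
    qed
    then show ?thesis using M(1) C(1) by blast
  qed
  show m0: "\<exists>M. M summable_on UNIV \<and> (\<forall>t\<in>{0..T}. \<forall>l. norm (F t k l) \<le> M l)" for T k
  proof -
    obtain M C where "M summable_on UNIV" "\<forall>t\<in>{0..T}. \<forall>k l. weight k ^ 0 * norm (F t k l) \<le> M l * C"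
      using maj[of T 0] by blast
    then show ?thesis
      by (intro exI[of _ "\<lambda>l. M l * C"]) (auto intro: summable_on_cmult_left)
  qed
  show "rapid (\<lambda>t k. \<Sum>\<^sub>\<infinity>l. F t k l)"
  proof (rule rapidI)
    fix k
    show "continuous_on {0..} (\<lambda>t. \<Sum>\<^sub>\<infinity>l. F t k l)"
    proof (rule continuous_on_half_line_real)
      fix T :: real
      obtain M where M: "M summable_on UNIV" "\<And>t l. t \<in> {0..T} \<Longrightarrow> norm (F t k l) \<le> M l"
        using m0[of T k] by blast
      show "continuous_on {0..T} (\<lambda>t. \<Sum>\<^sub>\<infinity>l. F t k l)"
        by (rule continuous_on_infsum[OF continuous_on_subset[OF cont] M(2) M(1)]) auto
    qed
  next
    fix m T
    obtain M C where M: "M summable_on UNIV" "0 \<le> C"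
      "\<And>t k l. t \<in> {0..T} \<Longrightarrow> weight k ^ m * norm (F t k l) \<le> M l * C"
      using maj[of T m] by blast
    have MC: "(\<lambda>l. M l * C) summable_on UNIV" by (rule summable_on_cmult_left[OF M(1)])
    have "weight k ^ m * norm (\<Sum>\<^sub>\<infinity>l. F t k l) \<le> (\<Sum>\<^sub>\<infinity>l. M l * C)" if t: "t \<in> {0..T}" for t k
    proof -
      have le: "norm (F t k l) \<le> (M l * C) / weight k ^ m" for l
        using M(3)[OF t, of k l] by (simp add: field_simps)
      have "norm (\<Sum>\<^sub>\<infinity>l. F t k l) \<le> (\<Sum>\<^sub>\<infinity>l. (M l * C) / weight k ^ m)"
        by (rule norm_infsum_le_infsum[OF _ le])
          (use summable_on_cmult_left[OF MC, of "1 / weight k ^ m"] in simp)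
      also have "\<dots> = (\<Sum>\<^sub>\<infinity>l. M l * C) / weight k ^ m"
        using infsum_cmult_left'[of "\<lambda>l. M l * C" "1 / weight k ^ m" UNIV] by simp
      finally show ?thesis by (simp add: field_simps)
    qed
    then show "\<exists>C. \<forall>t\<in>{0..T}. \<forall>k. weight k ^ m * norm (\<Sum>\<^sub>\<infinity>l. F t k l) \<le> C" by blast
  qed
qed

lemma norm_transport_term_le:
  "norm ((\<i> * fdot k (x :: complex^'n)) *s (y :: complex^'n)) \<le> norm (real_freq k) * norm x * norm y"
  by (simp add: norm_smult norm_mult mult_right_mono norm_fdot_le)

lemma norm_transport_term_le_weight:
  fixes x y :: "complex^'n"
  shows "norm ((\<i> * fdot k x) *s y) \<le> (weight l * norm x) * (weight (k - l) * norm y)"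
proof -
  have "norm (real_freq k) \<le> weight (k - l) * weight l"
    using weight_submult[of k l] by (simp add: weight_def)
  then have "norm (real_freq k) * (norm x * norm y) \<le> (weight (k - l) * weight l) * (norm x * norm y)"
    by (rule mult_right_mono) simp
  then show ?thesis
    using norm_transport_term_le[of k x y] by (simp add: mult_ac)
qed

lemma continuous_on_transport_term:
  assumes "rapid a" "rapid b" "S \<subseteq> {0..}"
  shows "continuous_on S (\<lambda>t. (\<i> * fdot k (a t l)) *s b t (k - l))"
  by (intro continuous_intros bounded_linear.continuous_on[OF bounded_linear_fdot] rapid_continuous_on assms)

lemma rapid_transport: "rapid a \<Longrightarrow> rapid b \<Longrightarrow> rapid (\<lambda>t. transport (a t) (b t))"
  unfolding transport_def[abs_def]
  by (rule rapid_convolution(1)[where a = a and b = b])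
    (assumption | rule continuous_on_transport_term norm_transport_term_le_weight order_refl)+

lemma transport_majorant:
  fixes a b :: "real \<Rightarrow> int^'n \<Rightarrow> complex^'n"
  assumes "rapid a" "rapid b"
  shows "\<exists>M. M summable_on UNIV \<and> (\<forall>t\<in>{0..T}. \<forall>l. norm ((\<i> * fdot k (a t l)) *s b t (k - l)) \<le> M l)"
  by (rule rapid_convolution(2)[OF assms, where F = "\<lambda>t k l. (\<i> * fdot k (a t l)) *s b t (k - l)"])
    (rule continuous_on_transport_term norm_transport_term_le_weight assms order_refl)+

lemma summable_transport:
  fixes a b :: "real \<Rightarrow> int^'n \<Rightarrow> complex^'n"
  assumes "rapid a" "rapid b" "t \<ge> 0"
  shows "(\<lambda>l. (\<i> * fdot k (a t l)) *s b t (k - l)) summable_on UNIV"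
  using transport_majorant[OF assms(1,2), of t k] assms(3) summable_on_of_norm_le by fastforce

lemma transport_has_vector_derivative:
  assumes a: "rapid a" "rapid a'" and b: "rapid b" "rapid b'"
    and da: "\<And>k t. t \<ge> 0 \<Longrightarrow> ((\<lambda>s. a s k) has_vector_derivative a' t k) (at t within {0..})"
    and db: "\<And>k t. t \<ge> 0 \<Longrightarrow> ((\<lambda>s. b s k) has_vector_derivative b' t k) (at t within {0..})"
    and t: "t \<ge> 0"
  shows "((\<lambda>s. transport (a s) (b s) k) has_vector_derivative
    transport (a' t) (b t) k + transport (a t) (b' t) k) (at t within {0..})"
proof (rule has_vector_derivative_half_line)
  let ?F = "\<lambda>a b t l. (\<i> * fdot k (a t l)) *s b t (k - l)"
  obtain M1 where M1: "M1 summable_on UNIV" "\<And>s l. s \<in> {0..t+1} \<Longrightarrow> norm (?F a' b s l) \<le> M1 l"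
    using transport_majorant[OF a(2) b(1), of "t+1" k] by blast
  obtain M2 where M2: "M2 summable_on UNIV" "\<And>s l. s \<in> {0..t+1} \<Longrightarrow> norm (?F a b' s l) \<le> M2 l"
    using transport_majorant[OF a(1) b(2), of "t+1" k] by blast
  have "((\<lambda>s. \<Sum>\<^sub>\<infinity>l. ?F a b s l) has_vector_derivative (\<Sum>\<^sub>\<infinity>l. ?F a b' t l + ?F a' b t l)) (at t within {0..t+1})"
  proof (rule has_vector_derivative_infsum)
    show "((\<lambda>s. ?F a b s l) has_vector_derivative ?F a b' s l + ?F a' b s l) (at s within {0..t+1})"
      if "s \<in> {0..t+1}" for s l
    proof -
      have 1: "((\<lambda>s. \<i> * fdot k (a s l)) has_vector_derivative \<i> * fdot k (a' s l)) (at s within {0..})"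
        using that by (intro has_vector_derivative_mult_right bounded_linear.has_vector_derivative[OF bounded_linear_fdot] da) auto
      have 2: "((\<lambda>s. b s (k - l)) has_vector_derivative b' s (k - l)) (at s within {0..})"
        using that by (intro db) auto
      show ?thesis
        by (rule has_vector_derivative_within_subset[OF bounded_bilinear.has_vector_derivative[OF bounded_bilinear_smult 1 2]]) auto
    qed
    show "continuous_on {0..t+1} (\<lambda>s. ?F a b' s l + ?F a' b s l)" for l
      by (intro continuous_on_add continuous_on_transport_term a b) auto
    show "norm (?F a b' s l + ?F a' b s l) \<le> M2 l + M1 l" if "s \<in> {0..t+1}" for s l
      by (rule norm_triangle_le) (use M1(2)[OF that] M2(2)[OF that] in \<open>auto intro: add_mono\<close>)
    show "(\<lambda>l. M2 l + M1 l) summable_on UNIV" by (rule summable_on_add[OF M2(1) M1(1)])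
    show "(\<lambda>l. ?F a b s l) summable_on UNIV" if "s \<in> {0..t+1}" for s
      using summable_transport[OF a(1) b(1)] that by simp
  qed (use t in auto)
  moreover have "(\<Sum>\<^sub>\<infinity>l. ?F a b' t l + ?F a' b t l) = transport (a' t) (b t) k + transport (a t) (b' t) k"
    unfolding transport_def using infsum_add[OF summable_transport[OF a(1) b(2) t] summable_transport[OF a(2) b(1) t]]
    by (simp add: add.commute)
  ultimately show "((\<lambda>s. transport (a s) (b s) k) has_vector_derivative
    transport (a' t) (b t) k + transport (a t) (b' t) k) (at t within {0..t+1})"
    by (simp add: transport_def)
qed (use t in auto)

lemma Cd_rapid_transport:
  "Cd_rapid d a \<Longrightarrow> Cd_rapid d b \<Longrightarrow> Cd_rapid d (\<lambda>t. transport (a t) (b t))"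
proof (induction d arbitrary: a b)
  case 0
  then show ?case by (simp add: rapid_transport)
next
  case (Suc d)
  obtain a' b' where a': "Cd_rapid d a'" "\<And>k t. t \<ge> 0 \<Longrightarrow> ((\<lambda>s. a s k) has_vector_derivative a' t k) (at t within {0..})"
    and b': "Cd_rapid d b'" "\<And>k t. t \<ge> 0 \<Longrightarrow> ((\<lambda>s. b s k) has_vector_derivative b' t k) (at t within {0..})"
    using Suc.prems by auto
  have r: "rapid a" "rapid b" "rapid a'" "rapid b'"
    using Suc.prems a' b' Cd_rapid_imp_rapid by blast+
  have "Cd_rapid d (\<lambda>t k. transport (a' t) (b t) k + transport (a t) (b' t) k)"
    by (intro Cd_rapid_add Suc.IH[OF a'(1) Cd_rapid_Suc_D[OF Suc.prems(2)]]
        Suc.IH[OF Cd_rapid_Suc_D[OF Suc.prems(1)] b'(1)])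
  then show ?case
    using rapid_transport[OF r(1,2)] transport_has_vector_derivative[OF r(1,3,2,4) a'(2) b'(2)] by auto
qed

section \<open>The seminorms on coefficients\<close>

definition cnorm :: "nat \<Rightarrow> (int^'n \<Rightarrow> complex^'n) \<Rightarrow> real" where
  "cnorm d c = (\<Sum>\<^sub>\<infinity>k\<in>UNIV - {0}. norm (real_freq k) ^ d * norm (c k))"

lemma normA_eq_cnorm: "normA d f = cnorm d (fourier_coeff f)"
  by (simp add: normA_def cnorm_def)

lemma cnorm_majorant:
  assumes "rapid c"
  obtains M where "M summable_on UNIV"
    "\<And>t k. t \<in> {0..T} \<Longrightarrow> norm (real_freq k) ^ d * norm (c t k) \<le> M k"
proof -
  obtain M where M: "M summable_on UNIV" "\<And>t k. t \<in> {0..T} \<Longrightarrow> weight k ^ d * norm (c t k) \<le> M k"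
    using rapid_majorant[OF assms] by metis
  have "norm (real_freq k) ^ d * norm (c t k) \<le> M k" if "t \<in> {0..T}" for t k
    by (rule order_trans[OF mult_right_mono[OF power_mono] M(2)[OF that]]) (auto simp: weight_def)
  with M(1) show ?thesis using that by blast
qed

lemma summable_cnorm:
  assumes "rapid c" "t \<ge> 0"
  shows "(\<lambda>k. norm (real_freq k) ^ d * norm (c t k)) summable_on X"
proof -
  obtain M where M: "M summable_on UNIV" "\<And>s k. s \<in> {0..t} \<Longrightarrow> norm (real_freq k) ^ d * norm (c s k) \<le> M k"
    using cnorm_majorant[OF assms(1)] by metis
  have "(\<lambda>k. norm (real_freq k) ^ d * norm (c t k)) summable_on UNIV"
    by (rule summable_on_of_norm_le[OF M(1)]) (use M(2)[of t] assms in auto)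
  then show ?thesis by (rule summable_on_subset_banach) simp
qed

lemma continuous_cnorm:
  assumes "rapid c" "S \<subseteq> {0..}"
  shows "continuous_on S (\<lambda>t. cnorm d (c t))"
proof -
  have "continuous_on {0..} (\<lambda>t. cnorm d (c t))"
  proof (rule continuous_on_half_line_real)
    fix T :: real
    obtain M where M: "M summable_on UNIV" "\<And>s k. s \<in> {0..T} \<Longrightarrow> norm (real_freq k) ^ d * norm (c s k) \<le> M k"
      using cnorm_majorant[OF assms(1)] by metis
    show "continuous_on {0..T} (\<lambda>t. cnorm d (c t))"
      unfolding cnorm_def
    proof (rule continuous_on_infsum)
      show "continuous_on {0..T} (\<lambda>t. norm (real_freq k) ^ d * norm (c t k))" for k
        by (intro continuous_intros rapid_continuous_on[OF assms(1)]) auto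
      show "M summable_on UNIV - {0}" by (rule summable_on_subset_banach[OF M(1)]) simp
      show "norm (norm (real_freq k) ^ d * norm (c t k)) \<le> M k" if "t \<in> {0..T}" for t k
        using M(2)[OF that] by simp
    qed
  qed
  then show ?thesis using assms(2) continuous_on_subset by blast
qed

lemma cnorm_nonneg: "0 \<le> cnorm d c"
  unfolding cnorm_def by (rule infsum_nonneg) simp

lemma cnorm_eq_infsum_UNIV:
  "cnorm d c = (\<Sum>\<^sub>\<infinity>k. if k = 0 then 0 else norm (real_freq k) ^ d * norm (c k))"
  unfolding cnorm_def by (rule infsum_cong_neutral) auto

text \<open>Fubini's theorem after the shear \<open>(l, k) \<mapsto> (l, k - l)\<close> of the lattice.\<close>

lemma convolution_has_sum:
  fixes f g :: "int^'n \<Rightarrow> real"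
  assumes f: "f summable_on UNIV" "\<And>k. 0 \<le> f k" and g: "g summable_on UNIV" "\<And>k. 0 \<le> g k"
  shows "((\<lambda>k. \<Sum>\<^sub>\<infinity>l. f l * g (k - l)) has_sum (infsum f UNIV * infsum g UNIV)) UNIV"
    and "\<And>k. (\<lambda>l. f l * g (k - l)) summable_on UNIV"
proof -
  have prod: "(\<lambda>(l, m). f l * g m) summable_on UNIV \<times> UNIV"
  proof -
    have "(\<lambda>p. norm (f (fst p) * g (snd p))) summable_on UNIV \<times> UNIV"
      unfolding Infinite_Sum.abs_summable_on_Sigma_iff
    proof (intro conjI ballI)
      show "(\<lambda>y. norm (f (fst (x, y)) * g (snd (x, y)))) summable_on UNIV" for x
        using f g by (simp add: abs_mult summable_on_cmult_right)
      show "(\<lambda>x. norm (\<Sum>\<^sub>\<infinity>y. norm (f (fst (x, y)) * g (snd (x, y))))) summable_on UNIV"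
        using f g by (simp add: abs_mult infsum_cmult_right' summable_on_cmult_left infsum_nonneg)
    qed
    from abs_summable_summable[OF this] show ?thesis by (simp add: case_prod_unfold)
  qed
  have bij: "bij_betw (\<lambda>(l, k). (l, k - l)) (UNIV \<times> UNIV) (UNIV \<times> (UNIV :: (int^'n) set))"
    by (rule bij_betwI[of _ _ _ "\<lambda>(l, m). (l, m + l)"]) auto
  have lk: "(\<lambda>(l, k). f l * g (k - l)) summable_on UNIV \<times> UNIV"
    using prod summable_on_reindex_bij_betw[OF bij, of "\<lambda>(l, m). f l * g m"]
    by (simp add: case_prod_unfold)
  then have kl: "(\<lambda>(k, l). f l * g (k - l)) summable_on UNIV \<times> UNIV"
    by (subst (asm) summable_on_swap) simp
  show "(\<lambda>l. f l * g (k - l)) summable_on UNIV" for k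
    using summable_on_SigmaD1[OF kl, of k] by simp
  have "(\<lambda>k. \<Sum>\<^sub>\<infinity>l. f l * g (k - l)) summable_on UNIV"
    using summable_on_Sigma_banach[OF kl] by simp
  moreover have "(\<Sum>\<^sub>\<infinity>k. \<Sum>\<^sub>\<infinity>l. f l * g (k - l)) = infsum f UNIV * infsum g UNIV"
  proof -
    have "(\<Sum>\<^sub>\<infinity>k. \<Sum>\<^sub>\<infinity>l. f l * g (k - l)) = (\<Sum>\<^sub>\<infinity>l. \<Sum>\<^sub>\<infinity>k. f l * g (k - l))"
      by (rule infsum_swap_banach[OF kl])
    also have "\<dots> = (\<Sum>\<^sub>\<infinity>l. f l * infsum g UNIV)"
    proof (rule infsum_cong)
      fix l :: "int^'n"
      have "bij (\<lambda>k. k - l)" by (rule bij_betwI[of _ _ _ "\<lambda>k. k + l"]) auto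
      from infsum_reindex_bij_betw[OF this, of g] show "(\<Sum>\<^sub>\<infinity>k. f l * g (k - l)) = f l * infsum g UNIV"
        by (simp add: infsum_cmult_right')
    qed
    also have "\<dots> = infsum f UNIV * infsum g UNIV" by (rule infsum_cmult_left')
    finally show ?thesis .
  qed
  ultimately show "((\<lambda>k. \<Sum>\<^sub>\<infinity>l. f l * g (k - l)) has_sum (infsum f UNIV * infsum g UNIV)) UNIV"
    by (simp add: has_sum_iff)
qed

text \<open>A majorant of the transport term with the derivative on \<open>c\<close>. The mode \<open>l = 0\<close> is excluded
  because it is accounted for by \<open>inner_leray_symbol_imaginary\<close>.\<close>

definition interaction :: "(int^'n \<Rightarrow> complex^'n) \<Rightarrow> (int^'n \<Rightarrow> complex^'n) \<Rightarrow> int^'n \<Rightarrow> real" where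
  "interaction a c k = (\<Sum>\<^sub>\<infinity>l. (if l = 0 then 0 else norm (a l)) * (norm (real_freq (k - l)) * norm (c (k - l))))"

lemma rapid_interaction:
  assumes "rapid a" "rapid c"
  shows "rapid (\<lambda>t. interaction (a t) (c t))"
  unfolding interaction_def[abs_def]
proof (rule rapid_convolution(1)[OF assms])
  fix k l :: "int^'a"
  show "continuous_on {0..} (\<lambda>t. (if l = 0 then 0 else norm (a t l)) * (norm (real_freq (k - l)) * norm (c t (k - l))))"
    by (cases "l = 0") (simp, simp only: if_False, intro continuous_on_mult continuous_on_const
        continuous_on_norm rapid_continuous[OF assms(1)] rapid_continuous[OF assms(2)])
  fix t :: real
  have "norm (a t l) \<le> weight l * norm (a t l)"
    using mult_right_mono[OF weight_ge_1[of l] norm_ge_zero[of "a t l"]] by simp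
  moreover have "norm (real_freq (k - l)) * norm (c t (k - l)) \<le> weight (k - l) * norm (c t (k - l))"
    by (intro mult_right_mono) (auto simp: weight_def)
  ultimately show "norm ((if l = 0 then 0 else norm (a t l)) * (norm (real_freq (k - l)) * norm (c t (k - l))))
      \<le> (weight l * norm (a t l)) * (weight (k - l) * norm (c t (k - l)))"
    by (auto intro!: mult_mono simp: abs_mult)
qed

text \<open>The triangle inequality \<open>|k| \<le> |l| + |k - l|\<close> and the binomial theorem distribute the
  \<open>d\<close> derivatives over the two factors.\<close>

lemma infsum_interaction_le:
  assumes a: "rapid a" and c: "rapid c" and t: "t \<ge> 0"
  shows "(\<Sum>\<^sub>\<infinity>k\<in>UNIV - {0}. norm (real_freq k) ^ d * interaction (a t) (c t) k) \<le>
    (\<Sum>j\<le>d. real (d choose j) * (cnorm j (a t) * cnorm (d + 1 - j) (c t)))"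
proof -
  define f where "f j l = (if l = 0 then 0 else norm (real_freq l) ^ j * norm (a t l))" for j l
  define g where "g j l = (if l = 0 then 0 else norm (real_freq l) ^ j * norm (c t l))" for j l
  have f: "f j summable_on UNIV" "0 \<le> f j l" "infsum (f j) UNIV = cnorm j (a t)" for j l
  proof -
    show "f j summable_on UNIV"
      by (rule summable_on_of_norm_le[OF summable_cnorm[OF a t, of j]]) (simp add: f_def)
  qed (simp_all add: f_def[abs_def] cnorm_eq_infsum_UNIV)
  have g: "g j summable_on UNIV" "0 \<le> g j l" "infsum (g j) UNIV = cnorm j (c t)" for j l
  proof -
    show "g j summable_on UNIV"
      by (rule summable_on_of_norm_le[OF summable_cnorm[OF c t, of j]]) (simp add: g_def)
  qed (simp_all add: g_def[abs_def] cnorm_eq_infsum_UNIV)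
  let ?C = "\<lambda>j k. \<Sum>\<^sub>\<infinity>l. f j l * g (d + 1 - j) (k - l)"
  have conv: "(?C j has_sum (cnorm j (a t) * cnorm (d + 1 - j) (c t))) UNIV"
    "(\<lambda>l. f j l * g (d + 1 - j) (k - l)) summable_on UNIV" for j k
    using convolution_has_sum[OF f(1,2) g(1,2), of j "d + 1 - j"] by (simp_all only: f(3) g(3))
  have le: "norm (real_freq k) ^ d * interaction (a t) (c t) k \<le> (\<Sum>j\<le>d. real (d choose j) * ?C j k)" for k
  proof -
    have "interaction (a t) (c t) k = (\<Sum>\<^sub>\<infinity>l. f 0 l * g 1 (k - l))"
      unfolding interaction_def by (rule infsum_cong) (simp add: f_def g_def)
    then have "norm (real_freq k) ^ d * interaction (a t) (c t) k = (\<Sum>\<^sub>\<infinity>l. norm (real_freq k) ^ d * (f 0 l * g 1 (k - l)))"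
      by (simp add: infsum_cmult_right')
    also have "\<dots> \<le> (\<Sum>\<^sub>\<infinity>l. \<Sum>j\<le>d. real (d choose j) * (f j l * g (d + 1 - j) (k - l)))"
    proof (rule infsum_mono)
      show "(\<lambda>l. norm (real_freq k) ^ d * (f 0 l * g 1 (k - l))) summable_on UNIV"
        by (rule summable_on_cmult_right[OF convolution_has_sum(2)[OF f(1,2) g(1,2)]])
      show "(\<lambda>l. \<Sum>j\<le>d. real (d choose j) * (f j l * g (d + 1 - j) (k - l))) summable_on UNIV"
        using has_sum_sum[of "{..d}" "\<lambda>j l. real (d choose j) * (f j l * g (d + 1 - j) (k - l))"]
          has_sum_infsum[OF summable_on_cmult_right[OF conv(2)]] by (meson finite_atMost summable_on_def)
      fix l
      have "norm (real_freq k) \<le> norm (real_freq l) + norm (real_freq (k - l))"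
        using norm_triangle_ineq[of "real_freq l" "real_freq (k - l)"] by (simp add: real_freq_diff)
      then have "norm (real_freq k) ^ d \<le> (norm (real_freq l) + norm (real_freq (k - l))) ^ d"
        by (rule power_mono) simp
      also have "\<dots> = (\<Sum>j\<le>d. real (d choose j) * norm (real_freq l) ^ j * norm (real_freq (k - l)) ^ (d - j))"
        by (rule binomial_ring)
      finally have "norm (real_freq k) ^ d * (f 0 l * g 1 (k - l)) \<le>
          (\<Sum>j\<le>d. real (d choose j) * norm (real_freq l) ^ j * norm (real_freq (k - l)) ^ (d - j)) * (f 0 l * g 1 (k - l))"
        by (rule mult_right_mono) (simp add: f g)
      also have "\<dots> = (\<Sum>j\<le>d. real (d choose j) * (f j l * g (d + 1 - j) (k - l)))"
        unfolding sum_distrib_right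
        by (rule sum.cong) (auto simp: f_def g_def Suc_diff_le)
      finally show "norm (real_freq k) ^ d * (f 0 l * g 1 (k - l)) \<le> (\<Sum>j\<le>d. real (d choose j) * (f j l * g (d + 1 - j) (k - l)))" .
    qed
    also have "\<dots> = (\<Sum>j\<le>d. real (d choose j) * ?C j k)"
      by (rule infsumI, rule has_sum_sum) (simp, rule has_sum_cmult_right[OF has_sum_infsum[OF conv(2)]])
    finally show ?thesis .
  qed
  have hs: "((\<lambda>k. \<Sum>j\<le>d. real (d choose j) * ?C j k) has_sum
      (\<Sum>j\<le>d. real (d choose j) * (cnorm j (a t) * cnorm (d + 1 - j) (c t)))) UNIV"
    by (rule has_sum_sum) (simp, rule has_sum_cmult_right[OF conv(1)])
  have int0: "0 \<le> interaction (a t) (c t) k" for k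
    unfolding interaction_def by (rule infsum_nonneg) auto
  have "(\<Sum>\<^sub>\<infinity>k\<in>UNIV - {0}. norm (real_freq k) ^ d * interaction (a t) (c t) k) \<le>
      (\<Sum>\<^sub>\<infinity>k. \<Sum>j\<le>d. real (d choose j) * ?C j k)"
  proof (rule infsum_mono_neutral)
    show "(\<lambda>k. \<Sum>j\<le>d. real (d choose j) * ?C j k) summable_on UNIV" using hs by (rule has_sum_imp_summable)
    then have "(\<lambda>k. norm (real_freq k) ^ d * interaction (a t) (c t) k) summable_on UNIV"
      by (rule summable_on_of_norm_le) (use le int0 in auto)
    then show "(\<lambda>k. norm (real_freq k) ^ d * interaction (a t) (c t) k) summable_on UNIV - {0}"
      by (rule summable_on_subset_banach) simp
    show "norm (real_freq k) ^ d * interaction (a t) (c t) k \<le> (\<Sum>j\<le>d. real (d choose j) * ?C j k)" for k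
      by (rule le)
    show "0 \<le> (\<Sum>j\<le>d. real (d choose j) * ?C j k)" for k
      by (intro sum_nonneg mult_nonneg_nonneg infsum_nonneg) (auto simp: f g)
  qed auto
  then show ?thesis using hs by (simp add: infsumI)
qed

abbreviation visc :: "real \<Rightarrow> int^'n \<Rightarrow> real" where
  "visc \<nu> k \<equiv> \<nu> * (norm (real_freq k))\<^sup>2"

abbreviation fourier_rhs ::
  "real \<Rightarrow> (int^'n \<Rightarrow> complex^'n) \<Rightarrow> (int^'n \<Rightarrow> complex^'n) \<Rightarrow> int^'n \<Rightarrow> complex^'n" where
  "fourier_rhs \<nu> a c k \<equiv> (- visc \<nu> k) *\<^sub>R c k + leray_symbol k (transport a c k)"

definition fourier_solution ::
  "real \<Rightarrow> (real \<Rightarrow> int^'n \<Rightarrow> complex^'n) \<Rightarrow> (real \<Rightarrow> int^'n \<Rightarrow> complex^'n) \<Rightarrow> bool" where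
  "fourier_solution \<nu> a c \<longleftrightarrow> (\<forall>k. \<forall>t\<ge>0. ((\<lambda>s. c s k) has_vector_derivative fourier_rhs \<nu> (a t) (c t) k)
     (at t within {0..}))"

lemma norm_visc_le: "norm ((- visc \<nu> k) *\<^sub>R (w :: complex^'n)) \<le> \<bar>\<nu>\<bar> * weight k ^ 2 * norm w"
proof -
  have "\<bar>\<nu>\<bar> * (norm (real_freq k))\<^sup>2 * norm w \<le> \<bar>\<nu>\<bar> * weight k ^ 2 * norm w"
    by (intro mult_right_mono mult_left_mono power_mono) (auto simp: weight_def)
  then show ?thesis by (simp add: abs_mult)
qed

lemma fourier_solutionD:
  "fourier_solution \<nu> a c \<Longrightarrow> t \<ge> 0 \<Longrightarrow> ((\<lambda>s. c s k) has_vector_derivative fourier_rhs \<nu> (a t) (c t) k)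
     (at t within {0..})"
  by (simp add: fourier_solution_def)

section \<open>A priori bounds\<close>

lemma summable_interaction:
  assumes "rapid a" "rapid c" "t \<ge> 0"
  shows "(\<lambda>l. (if l = 0 then 0 else norm (a t l)) * (norm (real_freq (k - l)) * norm (c t (k - l)))) summable_on UNIV"
proof (rule convolution_has_sum(2)[where g = "\<lambda>m. norm (real_freq m) * norm (c t m)"])
  show "(\<lambda>l. if l = 0 then 0 else norm (a t l)) summable_on UNIV"
    by (rule summable_on_of_norm_le[OF summable_cnorm[OF assms(1,3), of 0]]) simp
  show "(\<lambda>m. norm (real_freq m) * norm (c t m)) summable_on UNIV"
    using summable_cnorm[OF assms(2,3), of 1 UNIV] by simp
qed auto

lemma interaction_nonneg: "0 \<le> interaction a c k"
  unfolding interaction_def by (rule infsum_nonneg) auto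

text \<open>The mode \<open>l = 0\<close> contributes nothing by \<open>inner_leray_symbol_imaginary\<close>. In the other modes
  \<open>a\<^sub>l \<bullet> k = a\<^sub>l \<bullet> (k - l)\<close>, which puts the derivative on \<open>c\<close> and none on \<open>a\<close>.\<close>

lemma inner_transport_le:
  assumes a: "rapid a" and c: "rapid c" and t: "t \<ge> 0"
    and div: "solenoidal (a t)" and herm: "hermitian (a t)"
  shows "leray_symbol k (transport (a t) (c t) k) \<bullet> c t k \<le> interaction (a t) (c t) k * norm (c t k)"
proof -
  let ?F = "\<lambda>l. (\<i> * fdot k (a t l)) *s c t (k - l)"
  let ?M = "\<lambda>l. (if l = 0 then 0 else norm (a t l)) * (norm (real_freq (k - l)) * norm (c t (k - l)))"
  let ?R = "\<Sum>\<^sub>\<infinity>l\<in>UNIV - {0}. ?F l"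
  have F: "?F summable_on X" for X
    by (rule summable_on_subset_banach[OF summable_transport[OF a c t]]) simp
  have M: "?M summable_on X" for X
    by (rule summable_on_subset_banach[OF summable_interaction[OF a c t]]) simp
  have "transport (a t) (c t) k = infsum ?F (insert 0 (UNIV - {0}))"
    by (simp add: transport_def insert_absorb)
  also have "\<dots> = ?F 0 + ?R"
    by (rule infsum_insert[OF F]) simp
  finally have split: "transport (a t) (c t) k = ?F 0 + ?R" .
  have "norm (?F l) \<le> ?M l" if "l \<in> UNIV - {0}" for l
  proof -
    have "fdot k (a t l) = fdot (k - l) (a t l)"
      using div by (simp add: solenoidal_def fdot_diff_left)
    then have "norm (?F l) \<le> norm (real_freq (k - l)) * norm (a t l) * norm (c t (k - l))"
      using norm_transport_term_le[of "k - l" "a t l" "c t (k - l)"] by simp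
    then show ?thesis using that by (simp add: mult_ac)
  qed
  then have "norm ?R \<le> infsum ?M (UNIV - {0})" by (rule norm_infsum_le_infsum[OF M])
  also have "\<dots> = interaction (a t) (c t) k"
    unfolding interaction_def by (rule infsum_cong_neutral) auto
  finally have R: "norm ?R \<le> interaction (a t) (c t) k" .
  have "cnj (a t 0 $ j) = a t 0 $ j" for j
    using herm unfolding hermitian_def by (metis minus_zero)
  then have "cnj (fdot k (a t 0)) = fdot k (a t 0)"
    by (simp add: fdot_def cnj_sum)
  then have "fdot k (a t 0) \<in> \<real>" by (simp add: Reals_cnj_iff)
  then obtain r where r: "fdot k (a t 0) = of_real r" by (auto elim: Reals_cases)
  have "leray_symbol k (transport (a t) (c t) k) \<bullet> c t k = leray_symbol k ?R \<bullet> c t k"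
    unfolding split leray_symbol_add inner_add_left using inner_leray_symbol_imaginary[of k r "c t k"] by (simp add: r)
  also have "\<dots> \<le> norm (leray_symbol k ?R) * norm (c t k)" by (rule norm_cauchy_schwarz)
  also have "\<dots> \<le> interaction (a t) (c t) k * norm (c t k)"
    by (intro mult_right_mono order_trans[OF norm_leray_symbol_le R]) simp
  finally show ?thesis .
qed

text \<open>Summed over all modes, the top order interaction is absorbed by the viscosity at the
  price \<open>\<kappa>\<close>, and the next one by \<open>d \<parallel>a\<parallel>\<^sub>1\<close>.\<close>

lemma interaction_balance_le:
  assumes a: "rapid a" and c: "rapid c" and t: "t \<ge> 0"
    and \<kappa>: "\<And>x. x \<ge> 1 \<Longrightarrow> cnorm 0 (a t) * x - \<nu> * x\<^sup>2 \<le> \<kappa>"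
  shows "(\<Sum>\<^sub>\<infinity>k\<in>UNIV - {0}. norm (real_freq k) ^ d * interaction (a t) (c t) k)
      - \<nu> * cnorm (d + 2) (c t) - (\<kappa> + real d * cnorm 1 (a t)) * cnorm d (c t)
    \<le> (\<Sum>j=2..d. real (d choose j) * (cnorm j (a t) * cnorm (d + 1 - j) (c t)))"
proof -
  let ?x = "\<lambda>j. real (d choose j) * (cnorm j (a t) * cnorm (d + 1 - j) (c t))"
  have split: "(\<Sum>j\<le>d. ?x j) = cnorm 0 (a t) * cnorm (d + 1) (c t) + real d * cnorm 1 (a t) * cnorm d (c t) + (\<Sum>j=2..d. ?x j)"
  proof (cases "d = 0")
    case False
    then have "{..d} = insert 0 (insert 1 {2..d})" by auto
    then show ?thesis by simp
  qed simp
  have s: "(\<lambda>k. norm (real_freq k) ^ e * norm (c t k)) summable_on UNIV - {0}" for e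
    by (rule summable_cnorm[OF c t])
  have "cnorm 0 (a t) * cnorm (d + 1) (c t) - \<nu> * cnorm (d + 2) (c t) =
      (\<Sum>\<^sub>\<infinity>k\<in>UNIV - {0}. cnorm 0 (a t) * (norm (real_freq k) ^ (d + 1) * norm (c t k)) + (- \<nu>) * (norm (real_freq k) ^ (d + 2) * norm (c t k)))"
    unfolding cnorm_def[of _ "c t"]
    by (subst infsum_add[OF summable_on_cmult_right[OF s] summable_on_cmult_right[OF s]])
      (simp add: infsum_cmult_right' infsum_uminus)
  also have "\<dots> \<le> (\<Sum>\<^sub>\<infinity>k\<in>UNIV - {0}. \<kappa> * (norm (real_freq k) ^ d * norm (c t k)))"
  proof (rule infsum_mono[OF summable_on_add[OF summable_on_cmult_right[OF s] summable_on_cmult_right[OF s]] summable_on_cmult_right[OF s]])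
    fix k :: "int^'a" assume "k \<in> UNIV - {0}"
    then have "cnorm 0 (a t) * norm (real_freq k) - visc \<nu> k \<le> \<kappa>"
      by (intro \<kappa> norm_real_freq_ge_1) simp
    then have "(cnorm 0 (a t) * norm (real_freq k) - visc \<nu> k) * (norm (real_freq k) ^ d * norm (c t k)) \<le> \<kappa> * (norm (real_freq k) ^ d * norm (c t k))"
      by (rule mult_right_mono) simp
    then show "cnorm 0 (a t) * (norm (real_freq k) ^ (d + 1) * norm (c t k)) + (- \<nu>) * (norm (real_freq k) ^ (d + 2) * norm (c t k)) \<le> \<kappa> * (norm (real_freq k) ^ d * norm (c t k))"
      by (simp add: algebra_simps power_add power2_eq_square)
  qed
  also have "\<dots> = \<kappa> * cnorm d (c t)"
    by (simp add: cnorm_def infsum_cmult_right')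
  finally show ?thesis
    using infsum_interaction_le[OF a c t, of d] split by (simp add: algebra_simps)
qed

text \<open>With \<open>A\<close> the primitive of the growth rate, \<open>exp (- A) c\<^sub>k\<close> is estimated mode by mode, and
  the bounds are summed over \<open>k\<close> afterwards; the sum of the integrands has the right sign up to
  the terms of order \<open>j \<ge> 2\<close>.\<close>

lemma a_priori_bound:
  fixes a c :: "real \<Rightarrow> int^'n \<Rightarrow> complex^'n" and \<kappa> :: "real \<Rightarrow> real" and d :: nat
  assumes a: "rapid a" and c: "rapid c" and sol: "fourier_solution \<nu> a c"
    and div: "\<And>s. s \<ge> 0 \<Longrightarrow> solenoidal (a s)" and herm: "\<And>s. s \<ge> 0 \<Longrightarrow> hermitian (a s)"
    and t: "0 \<le> t" and \<kappa>: "continuous_on {0..t} \<kappa>"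
    and \<kappa>_bound: "\<And>s x. s \<in> {0..t} \<Longrightarrow> x \<ge> 1 \<Longrightarrow> cnorm 0 (a s) * x - \<nu> * x\<^sup>2 \<le> \<kappa> s"
  defines "A \<equiv> \<lambda>s. integral {0..s} (\<lambda>s. \<kappa> s + real d * cnorm 1 (a s))"
  shows "cnorm d (c t) \<le> exp (A t) * (cnorm d (c 0) + integral {0..t} (\<lambda>s. exp (- A s) *
    (\<Sum>j=2..d. real (d choose j) * (cnorm j (a s) * cnorm (d + 1 - j) (c s)))))"
proof -
  let ?X = "UNIV - {0} :: (int^'n) set"
  define \<alpha> where "\<alpha> s = \<kappa> s + real d * cnorm 1 (a s)" for s
  have sub: "{0..t} \<subseteq> {0..}" by auto
  have \<alpha>: "continuous_on {0..t} \<alpha>"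
    unfolding \<alpha>_def[abs_def] by (intro continuous_intros \<kappa> continuous_cnorm a sub)
  have dA: "(A has_vector_derivative \<alpha> s) (at s within {0..t})" if "s \<in> {0..t}" for s
    unfolding A_def \<alpha>_def[symmetric] by (rule integral_has_vector_derivative[OF \<alpha> that])
  define E where "E s = exp (- A s)" for s
  have dE: "(E has_real_derivative (- \<alpha> s * E s)) (at s within {0..t})" if "s \<in> {0..t}" for s
  proof -
    have "(A has_real_derivative \<alpha> s) (at s within {0..t})"
      using dA[OF that] by (simp add: has_real_derivative_iff_has_vector_derivative)
    then show ?thesis unfolding E_def[abs_def] by (auto intro!: derivative_eq_intros)
  qed
  have E: "continuous_on {0..t} E"
    using dE by (intro DERIV_continuous_on)
  have Epos: "0 < E s" for s by (simp add: E_def)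
  have E0: "E 0 = 1" by (simp add: E_def A_def)
  let ?I = "\<lambda>k s. interaction (a s) (c s) k"
  \<comment> \<open>\<open>h k\<close> bounds the derivative of \<open>|k|\<^sup>d exp (- A) |c\<^sub>k|\<close>\<close>
  define h where "h k s = norm (real_freq k) ^ d *
      (E s * ?I k s - (visc \<nu> k + \<alpha> s) * (E s * norm (c s k)))" for k s
  have I: "continuous_on {0..t} (?I k)" for k
    using rapid_continuous_on[OF rapid_interaction[OF a c] sub] by simp
  have cc: "continuous_on {0..t} (\<lambda>s. c s k)" for k by (rule rapid_continuous_on[OF c sub])
  have arith: "e\<^sup>2 * x - z * e\<^sup>2 * n\<^sup>2 \<le> - (y + z) * (e * n)\<^sup>2 + e * i * (e * n)"
    if "e\<^sup>2 * x \<le> e\<^sup>2 * (- y * n\<^sup>2 + i * n)" for e i n x y z :: real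
    using that by (simp add: power_mult_distrib power2_eq_square algebra_simps)
  have expand: "(e *\<^sub>R x + (- z * e) *\<^sub>R y) \<bullet> (e *\<^sub>R y) = e\<^sup>2 * (x \<bullet> y) - z * e\<^sup>2 * (norm y)\<^sup>2"
    for e z and x y :: "complex^'n"
    unfolding power2_norm_eq_inner by (simp add: inner_diff_left power2_eq_square algebra_simps)
  have mode: "norm (real_freq k) ^ d * (E t * norm (c t k)) \<le> norm (real_freq k) ^ d * norm (c 0 k) + integral {0..t} (h k)" for k
  proof -
    let ?D = "\<lambda>s. fourier_rhs \<nu> (a s) (c s) k"
    have "norm (E t *\<^sub>R c t k) \<le> norm (E 0 *\<^sub>R c 0 k) +
        integral {0..t} (\<lambda>s. E s * ?I k s - (visc \<nu> k + \<alpha> s) * norm (E s *\<^sub>R c s k))"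
    proof (rule norm_le_integral_of_inner_deriv_le[OF t])
      fix s assume s: "s \<in> {0..t}"
      have dc: "((\<lambda>s. c s k) has_vector_derivative ?D s) (at s within {0..t})"
        by (rule has_vector_derivative_within_subset[OF fourier_solutionD[OF sol] sub]) (use s in auto)
      show "((\<lambda>s. E s *\<^sub>R c s k) has_vector_derivative (E s *\<^sub>R ?D s + (- \<alpha> s * E s) *\<^sub>R c s k)) (at s within {0..t})"
        by (rule has_vector_derivative_scaleR[OF dE[OF s] dc])
      have "?D s \<bullet> c s k \<le> - visc \<nu> k * (norm (c s k))\<^sup>2 + ?I k s * norm (c s k)"
      proof -
        have "?D s \<bullet> c s k = - visc \<nu> k * (norm (c s k))\<^sup>2 + leray_symbol k (transport (a s) (c s) k) \<bullet> c s k"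
          by (simp only: inner_add_left inner_scaleR_left power2_norm_eq_inner[of "c s k"])
        then show ?thesis
          using inner_transport_le[OF a c _ div herm, of s k] s by simp
      qed
      then have "(E s)\<^sup>2 * (?D s \<bullet> c s k) \<le> (E s)\<^sup>2 * (- visc \<nu> k * (norm (c s k))\<^sup>2 + ?I k s * norm (c s k))"
        by (rule mult_left_mono) simp
      then have "(E s)\<^sup>2 * (?D s \<bullet> c s k) - \<alpha> s * (E s)\<^sup>2 * (norm (c s k))\<^sup>2 \<le>
          - (visc \<nu> k + \<alpha> s) * (E s * norm (c s k))\<^sup>2 + E s * ?I k s * (E s * norm (c s k))"
        by (rule arith)
      moreover have "(E s *\<^sub>R ?D s + (- \<alpha> s * E s) *\<^sub>R c s k) \<bullet> (E s *\<^sub>R c s k) =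
          (E s)\<^sup>2 * (?D s \<bullet> c s k) - \<alpha> s * (E s)\<^sup>2 * (norm (c s k))\<^sup>2"
        by (rule expand)
      moreover have "norm (E s *\<^sub>R c s k) = E s * norm (c s k)" using Epos[of s] by simp
      ultimately show "(E s *\<^sub>R ?D s + (- \<alpha> s * E s) *\<^sub>R c s k) \<bullet> (E s *\<^sub>R c s k) \<le>
          - (visc \<nu> k + \<alpha> s) * (norm (E s *\<^sub>R c s k))\<^sup>2 + E s * ?I k s * norm (E s *\<^sub>R c s k)"
        by (simp only:)
    next
      show "continuous_on {0..t} (\<lambda>s. visc \<nu> k + \<alpha> s)" by (intro continuous_intros \<alpha>)
      show "continuous_on {0..t} (\<lambda>s. E s * ?I k s)" by (intro continuous_on_mult E I)
      show "0 \<le> E s * ?I k s" for s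
        by (intro mult_nonneg_nonneg less_imp_le[OF Epos] interaction_nonneg)
    qed
    then have "norm (real_freq k) ^ d * (E t * norm (c t k)) \<le> norm (real_freq k) ^ d * (norm (c 0 k) +
        integral {0..t} (\<lambda>s. E s * ?I k s - (visc \<nu> k + \<alpha> s) * (E s * norm (c s k))))"
      using Epos by (intro mult_left_mono) (simp_all add: E0 abs_of_pos)
    then show ?thesis by (simp add: h_def[abs_def] distrib_left)
  qed
  have hc: "continuous_on {0..t} (h k)" for k
    unfolding h_def[abs_def]
    by (intro continuous_on_mult continuous_on_diff continuous_on_add continuous_on_const continuous_on_norm E I \<alpha> cc)
  obtain M where M: "M summable_on ?X" "\<And>k s. s \<in> {0..t} \<Longrightarrow> norm (h k s) \<le> M k"
  proof -
    obtain M1 where M1: "M1 summable_on UNIV" "\<And>s k. s \<in> {0..t} \<Longrightarrow> norm (real_freq k) ^ d * norm (?I k s) \<le> M1 k"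
      using cnorm_majorant[OF rapid_interaction[OF a c]] by metis
    obtain M2 where M2: "M2 summable_on UNIV" "\<And>s k. s \<in> {0..t} \<Longrightarrow> norm (real_freq k) ^ (d + 2) * norm (c s k) \<le> M2 k"
      using cnorm_majorant[OF c] by metis
    obtain M3 where M3: "M3 summable_on UNIV" "\<And>s k. s \<in> {0..t} \<Longrightarrow> norm (real_freq k) ^ d * norm (c s k) \<le> M3 k"
      using cnorm_majorant[OF c] by metis
    obtain B where B: "\<forall>s\<in>{0..t}. norm (E s) \<le> B"
      using continuous_on_compact_norm_bound[OF compact_Icc E] by blast
    obtain B' where B': "\<forall>s\<in>{0..t}. norm (\<alpha> s) \<le> B'"
      using continuous_on_compact_norm_bound[OF compact_Icc \<alpha>] by blast
    have "norm (h k s) \<le> B * (M1 k + \<bar>\<nu>\<bar> * M2 k + B' * M3 k)" if s: "s \<in> {0..t}" for k s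
    proof -
      have "h k s = E s * (norm (real_freq k) ^ d * ?I k s - \<nu> * (norm (real_freq k) ^ (d + 2) * norm (c s k))
          - \<alpha> s * (norm (real_freq k) ^ d * norm (c s k)))"
        by (simp add: h_def algebra_simps power_add power2_eq_square)
      also have "norm \<dots> \<le> B * norm (norm (real_freq k) ^ d * ?I k s - \<nu> * (norm (real_freq k) ^ (d + 2) * norm (c s k))
          - \<alpha> s * (norm (real_freq k) ^ d * norm (c s k)))"
        unfolding norm_mult[of "E s"] using B s by (intro mult_right_mono) auto
      also have "\<dots> \<le> B * (M1 k + \<bar>\<nu>\<bar> * M2 k + B' * M3 k)"
      proof (rule mult_left_mono)
        have x: "norm (\<nu> * (norm (real_freq k) ^ (d + 2) * norm (c s k))) \<le> \<bar>\<nu>\<bar> * M2 k"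
          unfolding norm_mult[of \<nu>] using M2(2)[OF s, of k] by (simp add: mult_left_mono)
        have y: "norm (\<alpha> s * (norm (real_freq k) ^ d * norm (c s k))) \<le> B' * M3 k"
          unfolding norm_mult[of "\<alpha> s"]
          using M3(2)[OF s, of k] B' s norm_ge_zero[of "\<alpha> s"] by (intro mult_mono) (auto intro: order_trans)
        have z: "norm (norm (real_freq k) ^ d * ?I k s) \<le> M1 k"
          using M1(2)[OF s, of k] by (simp add: abs_mult)
        show "norm (norm (real_freq k) ^ d * ?I k s - \<nu> * (norm (real_freq k) ^ (d + 2) * norm (c s k))
          - \<alpha> s * (norm (real_freq k) ^ d * norm (c s k))) \<le> M1 k + \<bar>\<nu>\<bar> * M2 k + B' * M3 k"
          by (rule order_trans[OF norm_triangle_ineq4 add_mono[OF order_trans[OF norm_triangle_ineq4 add_mono[OF z x]] y]])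
        show "0 \<le> B" using B s norm_ge_zero order_trans by blast
      qed
      finally show ?thesis .
    qed
    moreover have "(\<lambda>k. B * (M1 k + \<bar>\<nu>\<bar> * M2 k + B' * M3 k)) summable_on UNIV"
      by (intro summable_on_cmult_right summable_on_add M1(1) M2(1) M3(1))
    then have "(\<lambda>k. B * (M1 k + \<bar>\<nu>\<bar> * M2 k + B' * M3 k)) summable_on ?X"
      by (rule summable_on_subset_banach) simp
    ultimately show thesis using that by blast
  qed
  have hint: "((\<lambda>k. integral {0..t} (h k)) has_sum integral {0..t} (\<lambda>s. \<Sum>\<^sub>\<infinity>k\<in>?X. h k s)) ?X"
    using has_sum_integral_termwise[of 0 t h ?X M] hc M by simp
  let ?b = "\<lambda>s. \<Sum>j=2..d. real (d choose j) * (cnorm j (a s) * cnorm (d + 1 - j) (c s))"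
  have hsum: "(\<Sum>\<^sub>\<infinity>k\<in>?X. h k s) \<le> E s * ?b s" if s: "s \<in> {0..t}" for s
  proof -
    have s0: "s \<ge> 0" using s by simp
    have su: "(\<lambda>k. norm (real_freq k) ^ e * norm (c s k)) summable_on ?X" for e
      by (rule summable_cnorm[OF c s0])
    have si: "(\<lambda>k. norm (real_freq k) ^ d * ?I k s) summable_on ?X"
      using summable_cnorm[OF rapid_interaction[OF a c] s0, of d ?X]
      by (simp add: abs_of_nonneg[OF interaction_nonneg])
    have "((\<lambda>k. E s * (norm (real_freq k) ^ d * ?I k s + ((- \<nu>) * (norm (real_freq k) ^ (d + 2) * norm (c s k))
          + (- \<alpha> s) * (norm (real_freq k) ^ d * norm (c s k))))) has_sum
        E s * ((\<Sum>\<^sub>\<infinity>k\<in>?X. norm (real_freq k) ^ d * ?I k s) + ((- \<nu>) * cnorm (d + 2) (c s) + (- \<alpha> s) * cnorm d (c s)))) ?X"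
      unfolding cnorm_def[of _ "c s"]
      by (intro has_sum_cmult_right has_sum_add has_sum_infsum si su)
    moreover have "h k s = E s * (norm (real_freq k) ^ d * ?I k s + ((- \<nu>) * (norm (real_freq k) ^ (d + 2) * norm (c s k))
          + (- \<alpha> s) * (norm (real_freq k) ^ d * norm (c s k))))" for k
      by (simp add: h_def algebra_simps power_add power2_eq_square)
    ultimately have "(\<Sum>\<^sub>\<infinity>k\<in>?X. h k s) = E s * ((\<Sum>\<^sub>\<infinity>k\<in>?X. norm (real_freq k) ^ d * ?I k s) + ((- \<nu>) * cnorm (d + 2) (c s) + (- \<alpha> s) * cnorm d (c s)))"
      by (simp add: infsumI)
    also have "\<dots> \<le> E s * ?b s"
      using interaction_balance_le[OF a c s0 \<kappa>_bound[OF s], of d] Epos[of s]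
      by (intro mult_left_mono) (auto simp: \<alpha>_def algebra_simps)
    finally show ?thesis .
  qed
  have "E t * cnorm d (c t) \<le> cnorm d (c 0) + integral {0..t} (\<lambda>s. \<Sum>\<^sub>\<infinity>k\<in>?X. h k s)"
  proof (rule has_sum_mono)
    show "((\<lambda>k. norm (real_freq k) ^ d * (E t * norm (c t k))) has_sum E t * cnorm d (c t)) ?X"
      using has_sum_cmult_right[OF has_sum_infsum[OF summable_cnorm[OF c t]], of "E t" d ?X]
      by (simp add: cnorm_def mult_ac)
    show "((\<lambda>k. norm (real_freq k) ^ d * norm (c 0 k) + integral {0..t} (h k)) has_sum
        cnorm d (c 0) + integral {0..t} (\<lambda>s. \<Sum>\<^sub>\<infinity>k\<in>?X. h k s)) ?X"
      unfolding cnorm_def by (intro has_sum_add hint has_sum_infsum summable_cnorm c) simp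
  qed (rule mode)
  also have "integral {0..t} (\<lambda>s. \<Sum>\<^sub>\<infinity>k\<in>?X. h k s) \<le> integral {0..t} (\<lambda>s. E s * ?b s)"
  proof (rule integral_le)
    show "(\<lambda>s. \<Sum>\<^sub>\<infinity>k\<in>?X. h k s) integrable_on {0..t}"
      by (intro integrable_continuous_real continuous_on_infsum[OF hc M(2) M(1)])
    show "(\<lambda>s. E s * ?b s) integrable_on {0..t}"
      by (intro integrable_continuous_real continuous_on_mult continuous_on_sum continuous_on_const
          E continuous_cnorm a c sub)
  qed (rule hsum)
  finally have "exp (A t) * (E t * cnorm d (c t)) \<le> exp (A t) * (cnorm d (c 0) + integral {0..t} (\<lambda>s. E s * ?b s))"
    by (intro mult_left_mono) auto
  then show ?thesis
    by (simp add: E_def exp_minus_inverse flip: mult.assoc)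
qed

section \<open>Uniqueness in Fourier space\<close>

lemma fdot_zero [simp]: "fdot 0 w = 0"
  by (simp add: fdot_def)

text \<open>The transport term is a divergence, hence it has mean zero.\<close>

lemma fourier_solution_zero_mode:
  assumes sol: "fourier_solution \<nu> a c" and t: "t \<ge> 0"
  shows "c t 0 = c 0 0"
proof -
  have "transport (a s) (c s) 0 = 0" for s
    by (simp add: transport_def)
  then have "((\<lambda>s. c s 0) has_vector_derivative 0) (at s within {0..})" if "s \<in> {0..}" for s
    using fourier_solutionD[OF sol, of s 0] that by (simp add: leray_symbol_eq)
  from has_vector_derivative_zero_constant[OF _ this] obtain z where "\<And>s. s \<in> {0..} \<Longrightarrow> c s 0 = z"
    by auto
  then show ?thesis using t by simp
qed

text \<open>The maximum of a parabola; here the constant \<open>1 / (4 \<nu>)\<close> arises.\<close>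

lemma quadratic_le:
  fixes \<nu> :: real
  assumes "\<nu> > 0"
  shows "V * x - \<nu> * x\<^sup>2 \<le> 1 / (4 * \<nu>) * V\<^sup>2"
proof -
  have "0 \<le> (V - 2 * \<nu> * x)\<^sup>2 / (4 * \<nu>)" using assms by simp
  also have "\<dots> = 1 / (4 * \<nu>) * V\<^sup>2 - (V * x - \<nu> * x\<^sup>2)"
    using assms by (simp add: field_simps power2_eq_square)
  finally show ?thesis by simp
qed

lemma rapid_diff:
  assumes "rapid a" "rapid b"
  shows "rapid (\<lambda>t k. a t k - b t k)"
proof -
  have "rapid (\<lambda>t k. - b t k)"
    by (rule rapid_multiplier[OF assms(2), where K = 1 and p = 0])
      (auto intro: bounded_linear_minus bounded_linear_ident)
  from rapid_add[OF assms(1) this] show ?thesis by simp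
qed

lemma transport_diff:
  assumes "rapid a" "rapid b" "rapid c" "t \<ge> 0"
  shows "transport (a t) (\<lambda>k. b t k - c t k) k = transport (a t) (b t) k - transport (a t) (c t) k"
proof -
  note b = has_sum_infsum[OF summable_transport[OF assms(1,2,4), of k]]
    and c = has_sum_infsum[OF summable_transport[OF assms(1,3,4), of k]]
  have "((\<lambda>l. (\<i> * fdot k (a t l)) *s b t (k - l) + - ((\<i> * fdot k (a t l)) *s c t (k - l))) has_sum
      transport (a t) (b t) k + - transport (a t) (c t) k) UNIV"
    unfolding transport_def by (rule has_sum_add[OF b has_sum_bounded_linear[OF bounded_linear_minus[OF bounded_linear_ident] c]])
  moreover have "(\<i> * fdot k (a t l)) *s b t (k - l) + - ((\<i> * fdot k (a t l)) *s c t (k - l)) =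
      (\<i> * fdot k (a t l)) *s (b t (k - l) - c t (k - l))" for l
    by (simp add: vec_eq_iff algebra_simps)
  ultimately show ?thesis by (simp add: transport_def[of _ "\<lambda>k. b t k - c t k"] infsumI)
qed

text \<open>The seminorm of order 0 of the difference stays zero, which leaves the mode \<open>k = 0\<close>, and that
  one is constant in time.\<close>

lemma fourier_solution_unique:
  fixes a b c :: "real \<Rightarrow> int^'n \<Rightarrow> complex^'n"
  assumes \<nu>: "\<nu> > 0" and a: "rapid a" and b: "rapid b" and c: "rapid c"
    and div: "\<And>s. s \<ge> 0 \<Longrightarrow> solenoidal (a s)" and herm: "\<And>s. s \<ge> 0 \<Longrightarrow> hermitian (a s)"
    and sb: "fourier_solution \<nu> a b" and sc: "fourier_solution \<nu> a c"
    and init: "\<And>k. b 0 k = c 0 k" and t: "t \<ge> 0"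
  shows "b t k = c t k"
proof -
  let ?D = "\<lambda>t k. b t k - c t k"
  have D: "rapid ?D" by (rule rapid_diff[OF b c])
  have "fourier_solution \<nu> a ?D"
    unfolding fourier_solution_def
  proof (intro allI impI)
    fix k :: "int^'n" and s :: real assume s: "0 \<le> s"
    have "leray_symbol k (x - y) = leray_symbol k x - leray_symbol k y" for x y
      by (rule linear_diff[OF bounded_linear.linear[OF bounded_linear_leray_symbol]])
    then have "fourier_rhs \<nu> (a s) (b s) k -
        (fourier_rhs \<nu> (a s) (c s) k) =
        fourier_rhs \<nu> (a s) (?D s) k"
      by (simp only: transport_diff[OF a b c s] scaleR_diff_right add_diff_add)
    then show "((\<lambda>s. ?D s k) has_vector_derivative fourier_rhs \<nu> (a s) (?D s) k)
     (at s within {0..})"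
      using has_vector_derivative_diff[OF fourier_solutionD[OF sb s, of k] fourier_solutionD[OF sc s, of k]]
      by (simp only:)
  qed
  note sol = this
  show ?thesis
  proof (cases "k = 0")
    case True
    then show ?thesis using fourier_solution_zero_mode[OF sol t] init by simp
  next
    case False
    have "cnorm 0 (?D t) \<le> 0"
    proof -
      have "cnorm 0 (?D 0) = 0" by (simp add: cnorm_def init)
      moreover have "continuous_on {0..t} (\<lambda>s. 1 / (4 * \<nu>) * (cnorm 0 (a s))\<^sup>2)"
        by (intro continuous_intros continuous_cnorm a) auto
      ultimately show ?thesis
        using a_priori_bound[OF a D sol div herm t, where d = 0] quadratic_le[OF \<nu>] by simp
    qed
    then have "norm (real_freq k) ^ 0 * norm (?D t k) = 0"
      unfolding cnorm_def
      by (rule nonneg_infsum_le_0D[OF _ summable_cnorm[OF D t]]) (use False in auto)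
    then show ?thesis by simp
  qed
qed

section \<open>Existence in Fourier space\<close>

text \<open>Duhamel's formula for \<open>y' = - \<beta> y + g\<close>, and the gain of the factor \<open>\<beta> + \<rho>\<close> for
  data that grow like \<open>exp (\<rho> t)\<close>.\<close>

definition duhamel :: "real \<Rightarrow> (real \<Rightarrow> 'b::banach) \<Rightarrow> real \<Rightarrow> 'b" where
  "duhamel \<beta> g t = exp (- \<beta> * t) *\<^sub>R integral {0..t} (\<lambda>s. exp (\<beta> * s) *\<^sub>R g s)"

lemma duhamel_has_vector_derivative:
  assumes g: "continuous_on {0..} g" and t: "t \<ge> 0"
  shows "(duhamel \<beta> g has_vector_derivative (- \<beta>) *\<^sub>R duhamel \<beta> g t + g t) (at t within {0..})"
proof (rule has_vector_derivative_half_line)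
  have gc: "continuous_on {0..t+1} (\<lambda>s. exp (\<beta> * s) *\<^sub>R g s)"
    by (intro continuous_intros continuous_on_subset[OF g]) auto
  have 1: "((\<lambda>t. integral {0..t} (\<lambda>s. exp (\<beta> * s) *\<^sub>R g s)) has_vector_derivative exp (\<beta> * t) *\<^sub>R g t) (at t within {0..t+1})"
    by (rule integral_has_vector_derivative[OF gc]) (use t in auto)
  have 2: "((\<lambda>t. exp (- \<beta> * t)) has_real_derivative - \<beta> * exp (- \<beta> * t)) (at t within {0..t+1})"
    by (auto intro!: derivative_eq_intros)
  have "exp (- \<beta> * t) * exp (\<beta> * t) = 1" by (simp flip: exp_add)
  then show "(duhamel \<beta> g has_vector_derivative (- \<beta>) *\<^sub>R duhamel \<beta> g t + g t) (at t within {0..t+1})"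
    using has_vector_derivative_scaleR[OF 2 1] by (simp add: duhamel_def[abs_def] add.commute)
qed (use t in auto)

lemma norm_duhamel_le:
  assumes t: "0 \<le> t" and g: "continuous_on {0..t} g" and pos: "\<beta> + \<rho> > 0" and B: "0 \<le> B"
    and le: "\<And>s. s \<in> {0..t} \<Longrightarrow> norm (g s) \<le> B * exp (\<rho> * s)"
  shows "norm (duhamel \<beta> g t) \<le> exp (\<rho> * t) * (B / (\<beta> + \<rho>))"
proof -
  let ?\<mu> = "\<beta> + \<rho>"
  have int: "((\<lambda>s. B * exp (?\<mu> * s)) has_integral (B / ?\<mu> * exp (?\<mu> * t) - B / ?\<mu> * exp (?\<mu> * 0))) {0..t}"
  proof (rule fundamental_theorem_of_calculus[OF t])
    show "((\<lambda>s. B / ?\<mu> * exp (?\<mu> * s)) has_vector_derivative B * exp (?\<mu> * s)) (at s within {0..t})" for s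
      unfolding has_real_derivative_iff_has_vector_derivative[symmetric]
      using pos by (auto intro!: derivative_eq_intros)
  qed
  have "norm (integral {0..t} (\<lambda>s. exp (\<beta> * s) *\<^sub>R g s)) \<le> integral {0..t} (\<lambda>s. B * exp (?\<mu> * s))"
  proof (rule integral_norm_bound_integral)
    show "(\<lambda>s. exp (\<beta> * s) *\<^sub>R g s) integrable_on {0..t}"
      by (intro integrable_continuous_real continuous_intros g)
    show "(\<lambda>s. B * exp (?\<mu> * s)) integrable_on {0..t}" using int by blast
    fix s assume "s \<in> {0..t}"
    from le[OF this] have "exp (\<beta> * s) * norm (g s) \<le> exp (\<beta> * s) * (B * exp (\<rho> * s))" by simp
    also have "\<dots> = B * exp (?\<mu> * s)" by (simp add: distrib_right exp_add)
    finally show "norm (exp (\<beta> * s) *\<^sub>R g s) \<le> B * exp (?\<mu> * s)" by simp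
  qed
  also have "\<dots> \<le> B / ?\<mu> * exp (?\<mu> * t)"
    using integral_unique[OF int] B pos by simp
  finally have "exp (- \<beta> * t) * norm (integral {0..t} (\<lambda>s. exp (\<beta> * s) *\<^sub>R g s)) \<le> exp (- \<beta> * t) * (B / ?\<mu> * exp (?\<mu> * t))"
    by (rule mult_left_mono) simp
  also have "\<dots> = exp (\<rho> * t) * (B / ?\<mu>)"
  proof -
    have "exp (- \<beta> * t) * exp (?\<mu> * t) = exp (\<rho> * t)"
      by (simp add: algebra_simps flip: exp_add)
    then show ?thesis by (metis mult.assoc mult.commute)
  qed
  finally show ?thesis by (simp add: duhamel_def)
qed

text \<open>\<open>picard \<nu> a c0 p\<close> is the \<open>p\<close>-th increment of the Picard iteration, not the \<open>p\<close>-th iterate;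
  the solution is the sum over \<open>p\<close>.\<close>

primrec picard ::
  "real \<Rightarrow> (real \<Rightarrow> int^'n \<Rightarrow> complex^'n) \<Rightarrow> (int^'n \<Rightarrow> complex^'n) \<Rightarrow> nat \<Rightarrow> real \<Rightarrow> int^'n \<Rightarrow> complex^'n" where
  "picard \<nu> a c0 0 = (\<lambda>t k. exp (- visc \<nu> k * t) *\<^sub>R c0 k)"
| "picard \<nu> a c0 (Suc p) = (\<lambda>t k. duhamel (visc \<nu> k)
     (\<lambda>s. leray_symbol k (transport (a s) (picard \<nu> a c0 p s) k)) t)"

lemma rapid_leray_transport:
  assumes "rapid a" "rapid c"
  shows "rapid (\<lambda>t k. leray_symbol k (transport (a t) (c t) k))"
  by (rule rapid_multiplier[OF rapid_transport[OF assms] bounded_linear_leray_symbol, where K = 1 and p = 0])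
    (auto simp: norm_leray_symbol_le)

text \<open>A crude bound for each single increment, which makes the integrands of the iteration
  continuous. The geometric decay in \<open>p\<close> is the subject of \<open>picard_bound\<close>.\<close>

lemma rapid_picard:
  assumes \<nu>: "\<nu> > 0" and a: "rapid a" and c0: "rapid (\<lambda>_::real. c0)"
  shows "rapid (picard \<nu> a c0 p)"
proof (induction p)
  case 0
  show ?case
  proof (rule rapidI)
    show "continuous_on {0..} (\<lambda>t. picard \<nu> a c0 0 t k)" for k
      unfolding picard.simps by (intro continuous_intros)
    fix m and T :: real
    obtain C where C: "0 \<le> C" "\<And>t k. t \<in> {0..0::real} \<Longrightarrow> weight k ^ m * norm (c0 k) \<le> C"
      using rapid_bound[OF c0] by metis
    have "weight k ^ m * norm (picard \<nu> a c0 0 t k) \<le> C" if "t \<in> {0..T}" for t k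
    proof -
      have "norm (picard \<nu> a c0 0 t k) \<le> norm (c0 k)"
      proof -
        have "exp (- visc \<nu> k * t) \<le> 1" using \<nu> that by simp
        from mult_right_mono[OF this norm_ge_zero[of "c0 k"]] show ?thesis by simp
      qed
      then have "weight k ^ m * norm (picard \<nu> a c0 0 t k) \<le> weight k ^ m * norm (c0 k)"
        by (intro mult_left_mono) simp_all
      then show ?thesis by (rule order_trans) (use C(2)[of 0 k] in simp)
    qed
    then show "\<exists>C. \<forall>t\<in>{0..T}. \<forall>k. weight k ^ m * norm (picard \<nu> a c0 0 t k) \<le> C" by blast
  qed
next
  case (Suc p)
  let ?g = "\<lambda>k s. leray_symbol k (transport (a s) (picard \<nu> a c0 p s) k)"
  have g: "rapid (\<lambda>s k. ?g k s)" by (rule rapid_leray_transport[OF a Suc])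
  have gc: "continuous_on S (?g k)" if "S \<subseteq> {0..}" for k S
    using rapid_continuous_on[OF g that] by simp
  show ?case
  proof (rule rapidI)
    show "continuous_on {0..} (\<lambda>t. picard \<nu> a c0 (Suc p) t k)" for k
      unfolding picard.simps
      by (rule continuous_on_vector_derivative[OF duhamel_has_vector_derivative[OF gc]]) auto
    fix m T
    obtain C where C: "0 \<le> C" "\<And>t k. t \<in> {0..T} \<Longrightarrow> weight k ^ m * norm (?g k t) \<le> C"
      using rapid_bound[OF g] by metis
    have "weight k ^ m * norm (picard \<nu> a c0 (Suc p) t k) \<le> exp T * C" if t: "t \<in> {0..T}" for t k
    proof -
      let ?\<beta> = "visc \<nu> k"
      have \<beta>: "0 \<le> ?\<beta>" using \<nu> by simp
      \<comment> \<open>any positive \<open>\<rho>\<close> would do; it is taken to be 1\<close>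
      have "norm (duhamel ?\<beta> (?g k) t) \<le> exp (1 * t) * ((C / weight k ^ m) / (?\<beta> + 1))"
      proof (rule norm_duhamel_le)
        show "norm (?g k s) \<le> C / weight k ^ m * exp (1 * s)" if s: "s \<in> {0..t}" for s
        proof -
          have "norm (?g k s) \<le> C / weight k ^ m"
            using C(2)[of s k] s t by (simp add: field_simps)
          also have "\<dots> \<le> C / weight k ^ m * exp (1 * s)"
          proof -
            have "1 \<le> exp (1 * s)" using s by simp
            from mult_left_mono[OF this, of "C / weight k ^ m"] show ?thesis using C(1) by simp
          qed
          finally show ?thesis .
        qed
      qed (use t \<beta> C(1) in \<open>auto intro: gc\<close>)
      also have "\<dots> \<le> exp T * (C / weight k ^ m)"
      proof (rule mult_mono)
        have "x / (?\<beta> + 1) \<le> x" if "0 \<le> x" for x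
          using \<beta> that by (simp add: divide_le_eq distrib_left)
        from this[of "C / weight k ^ m"]
        show "C / weight k ^ m / (?\<beta> + 1) \<le> C / weight k ^ m" using C(1) by simp
        show "0 \<le> C / weight k ^ m / (?\<beta> + 1)" using \<beta> C(1) by simp
      qed (use t in auto)
      finally show ?thesis by (simp add: field_simps)
    qed
    then show "\<exists>C. \<forall>t\<in>{0..T}. \<forall>k. weight k ^ m * norm (picard \<nu> a c0 (Suc p) t k) \<le> C" by blast
  qed
qed

text \<open>The estimate of \<open>rapid_convolution\<close> with its constant, which must be linear in \<open>C\<close> and must
  show the factor \<open>|k|\<close> for the iteration to contract.\<close>

lemma weight_transport_le:
  fixes x y :: "int^'n \<Rightarrow> complex^'n"
  assumes M: "M summable_on UNIV" and x: "\<And>l. weight l ^ m * norm (x l) \<le> M l"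
    and y: "\<And>l. weight l ^ m * norm (y l) \<le> C" and C: "0 \<le> C"
  shows "(\<lambda>l. (\<i> * fdot k (x l)) *s y (k - l)) summable_on UNIV"
    and "weight k ^ m * norm (transport x y k) \<le> norm (real_freq k) * infsum M UNIV * C"
proof -
  let ?B = "\<lambda>l. M l * (norm (real_freq k) * C / weight k ^ m)"
  have le: "norm ((\<i> * fdot k (x l)) *s y (k - l)) \<le> ?B l" for l
  proof -
    have "weight k ^ m * norm ((\<i> * fdot k (x l)) *s y (k - l)) \<le>
        (weight (k - l) ^ m * weight l ^ m) * (norm (real_freq k) * norm (x l) * norm (y (k - l)))"
      by (intro mult_mono weight_power_submult norm_transport_term_le) simp_all
    also have "\<dots> = norm (real_freq k) * ((weight l ^ m * norm (x l)) * (weight (k - l) ^ m * norm (y (k - l))))"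
      by (simp add: mult_ac)
    also have "\<dots> \<le> norm (real_freq k) * (M l * C)"
      using x[of l] y[of "k - l"] order_trans[OF _ x[of l]] by (intro mult_left_mono mult_mono) auto
    finally show ?thesis by (simp add: field_simps)
  qed
  have B: "?B summable_on UNIV" by (rule summable_on_cmult_left[OF M])
  show "(\<lambda>l. (\<i> * fdot k (x l)) *s y (k - l)) summable_on UNIV"
    by (rule summable_on_of_norm_le[OF B le])
  have "norm (transport x y k) \<le> infsum ?B UNIV"
    unfolding transport_def by (rule norm_infsum_le_infsum[OF B le])
  also have "\<dots> = infsum M UNIV * (norm (real_freq k) * C / weight k ^ m)"
    by (rule infsum_cmult_left')
  finally show "weight k ^ m * norm (transport x y k) \<le> norm (real_freq k) * infsum M UNIV * C"
    by (simp add: field_simps)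
qed

text \<open>The derivative in the transport term costs a factor \<open>|k|\<close>, the Duhamel integral gains
  \<open>\<nu> |k|\<^sup>2 + \<rho>\<close>. By the inequality of the means the quotient is at most \<open>1 / (2 sqrt (\<nu> \<rho>))\<close>, so
  for large \<open>\<rho>\<close> the Picard iteration is a contraction in the norm with weight \<open>exp (- \<rho> t)\<close>,
  whatever the order \<open>m\<close> and the length \<open>T\<close> of the interval are.\<close>

lemma picard_bound:
  assumes \<nu>: "\<nu> > 0" and a: "rapid a" and c0: "rapid (\<lambda>_::real. c0)"
  obtains C where "0 \<le> C"
    "\<And>p t k. t \<in> {0..T} \<Longrightarrow> weight k ^ m * norm (picard \<nu> a c0 p t k) \<le> C * (1 / 2) ^ p"
proof -
  obtain M where M: "M summable_on UNIV" "\<And>k. 0 \<le> M k"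
    "\<And>t k. t \<in> {0..T} \<Longrightarrow> weight k ^ m * norm (a t k) \<le> M k"
    using rapid_majorant[OF a] by metis
  define V where "V = infsum M UNIV"
  have V: "0 \<le> V" unfolding V_def by (rule infsum_nonneg) (rule M(2))
  obtain C where C: "0 \<le> C" "\<And>t k. t \<in> {0..0::real} \<Longrightarrow> weight k ^ m * norm (c0 k) \<le> C"
    using rapid_bound[OF c0] by metis
  \<comment> \<open>the summand 1 keeps \<open>\<rho>\<close> positive if \<open>V = 0\<close>\<close>
  define \<rho> where "\<rho> = (V\<^sup>2 + 1) / \<nu>"
  have \<rho>: "\<rho> > 0" using \<nu> by (simp add: \<rho>_def add_nonneg_pos)
  have contraction: "x * V / (\<nu> * x\<^sup>2 + \<rho>) \<le> 1 / 2" for x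
  proof -
    have "2 * (x * V) \<le> \<nu> * x\<^sup>2 + V\<^sup>2 / \<nu>"
    proof -
      have "0 \<le> (\<nu> * x - V)\<^sup>2 / \<nu>" using \<nu> by simp
      also have "\<dots> = \<nu> * x\<^sup>2 + V\<^sup>2 / \<nu> - 2 * (x * V)"
        using \<nu> by (simp add: field_simps power2_eq_square)
      finally show ?thesis by simp
    qed
    also have "\<dots> \<le> \<nu> * x\<^sup>2 + \<rho>" using \<nu> by (simp add: \<rho>_def divide_right_mono)
    finally show ?thesis
      using \<nu> \<rho> by (simp add: divide_le_eq add_nonneg_pos)
  qed
  have main: "weight k ^ m * norm (picard \<nu> a c0 p t k) \<le> exp (\<rho> * t) * (C * (1 / 2) ^ p)"
    if "t \<in> {0..T}" for p t k
    using that
  proof (induction p arbitrary: t k)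
    case 0
    have "exp (- visc \<nu> k * t) \<le> 1" "1 \<le> exp (\<rho> * t)"
      using \<nu> \<rho> 0 by auto
    then have "exp (- visc \<nu> k * t) * (weight k ^ m * norm (c0 k)) \<le> exp (\<rho> * t) * C"
      using C(2)[of 0 k] by (intro mult_mono) auto
    then show ?case by (simp add: mult.left_commute)
  next
    case (Suc p)
    let ?g = "\<lambda>s. leray_symbol k (transport (a s) (picard \<nu> a c0 p s) k)"
    let ?\<beta> = "visc \<nu> k"
    let ?B = "norm (real_freq k) * V * (C * (1 / 2) ^ p) / weight k ^ m"
    have "norm (duhamel ?\<beta> ?g t) \<le> exp (\<rho> * t) * (?B / (?\<beta> + \<rho>))"
    proof (rule norm_duhamel_le)
      show "continuous_on {0..t} ?g"
        using rapid_continuous_on[OF rapid_leray_transport[OF a rapid_picard[OF \<nu> a c0]], of "{0..t}"] by simp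
      fix s assume "s \<in> {0..t}"
      then have s: "s \<in> {0..T}" using Suc.prems by auto
      have "weight k ^ m * norm (transport (a s) (picard \<nu> a c0 p s) k) \<le>
          norm (real_freq k) * infsum M UNIV * (exp (\<rho> * s) * (C * (1 / 2) ^ p))"
        by (rule weight_transport_le(2)[OF M(1) M(3)[OF s] Suc.IH[OF s]]) (use C in simp)
      then have "norm (transport (a s) (picard \<nu> a c0 p s) k) \<le> ?B * exp (\<rho> * s)"
        by (simp add: V_def field_simps)
      then show "norm (?g s) \<le> ?B * exp (\<rho> * s)"
        by (rule order_trans[OF norm_leray_symbol_le])
    qed (use Suc.prems \<nu> \<rho> V C in \<open>auto intro: add_nonneg_pos\<close>)
    also have "?B / (?\<beta> + \<rho>) = (norm (real_freq k) * V / (?\<beta> + \<rho>)) * (C * (1 / 2) ^ p / weight k ^ m)"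
      by simp
    also have "\<dots> \<le> (1 / 2) * (C * (1 / 2) ^ p / weight k ^ m)"
      using C by (intro mult_right_mono contraction) simp
    finally have "norm (duhamel ?\<beta> ?g t) \<le> exp (\<rho> * t) * ((1 / 2) * (C * (1 / 2) ^ p / weight k ^ m))"
      by simp
    then show ?case by (simp add: field_simps)
  qed
  show thesis
  proof (rule that[of "exp (\<rho> * T) * C"])
    show "0 \<le> exp (\<rho> * T) * C" using C by simp
    fix p k t assume t: "t \<in> {0..T}"
    have "exp (\<rho> * t) * (C * (1 / 2) ^ p) \<le> exp (\<rho> * T) * (C * (1 / 2) ^ p)"
      using t \<rho> C by (intro mult_right_mono) auto
    then show "weight k ^ m * norm (picard \<nu> a c0 p t k) \<le> exp (\<rho> * T) * C * (1 / 2) ^ p"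
      using main[OF t, of k p] by simp
  qed
qed

lemma summable_on_half_powers: "(\<lambda>p::nat. C * (1 / 2) ^ p :: real) summable_on UNIV"
proof (rule summable_on_cmult_right)
  show "(\<lambda>p::nat. (1 / 2) ^ p :: real) summable_on UNIV"
    by (rule summable_nonneg_imp_summable_on) (auto intro: summable_geometric)
qed

definition picard_sum ::
  "real \<Rightarrow> (real \<Rightarrow> int^'n \<Rightarrow> complex^'n) \<Rightarrow> (int^'n \<Rightarrow> complex^'n) \<Rightarrow> real \<Rightarrow> int^'n \<Rightarrow> complex^'n" where
  "picard_sum \<nu> a c0 t k = (\<Sum>\<^sub>\<infinity>p. picard \<nu> a c0 p t k)"

lemma summable_picard:
  assumes "\<nu> > 0" "rapid a" "rapid (\<lambda>_::real. c0)" "t \<ge> 0"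
  shows "(\<lambda>p. picard \<nu> a c0 p t k) summable_on UNIV"
proof -
  obtain C where C: "\<And>p s k. s \<in> {0..t} \<Longrightarrow> weight k ^ 0 * norm (picard \<nu> a c0 p s k) \<le> C * (1 / 2) ^ p"
    using picard_bound[OF assms(1-3)] by metis
  show ?thesis
    by (rule summable_on_of_norm_le[OF summable_on_half_powers[of C]]) (use C[of t] assms(4) in simp)
qed

lemma rapid_picard_sum:
  assumes \<nu>: "\<nu> > 0" and a: "rapid a" and c0: "rapid (\<lambda>_::real. c0)"
  shows "rapid (picard_sum \<nu> a c0)"
proof (rule rapidI)
  fix k
  show "continuous_on {0..} (\<lambda>t. picard_sum \<nu> a c0 t k)"
  proof (rule continuous_on_half_line_real)
    fix T :: real
    obtain C where C: "\<And>p s k. s \<in> {0..T} \<Longrightarrow> weight k ^ 0 * norm (picard \<nu> a c0 p s k) \<le> C * (1 / 2) ^ p"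
      using picard_bound[OF assms] by metis
    show "continuous_on {0..T} (\<lambda>t. picard_sum \<nu> a c0 t k)"
      unfolding picard_sum_def
    proof (rule continuous_on_infsum[OF _ _ summable_on_half_powers[of C]])
      show "continuous_on {0..T} (\<lambda>t. picard \<nu> a c0 p t k)" for p
        by (rule rapid_continuous_on[OF rapid_picard[OF assms]]) simp
    qed (use C in simp)
  qed
next
  fix m T
  obtain C where C: "\<And>p s k. s \<in> {0..T} \<Longrightarrow> weight k ^ m * norm (picard \<nu> a c0 p s k) \<le> C * (1 / 2) ^ p"
    using picard_bound[OF assms] by metis
  have "weight k ^ m * norm (picard_sum \<nu> a c0 t k) \<le> (\<Sum>\<^sub>\<infinity>p. C * (1 / 2) ^ p)" if t: "t \<in> {0..T}" for t k
  proof -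
    have "weight k ^ m * norm (picard_sum \<nu> a c0 t k) = norm (weight k ^ m *\<^sub>R picard_sum \<nu> a c0 t k)" by simp
    also have "weight k ^ m *\<^sub>R picard_sum \<nu> a c0 t k = (\<Sum>\<^sub>\<infinity>p. weight k ^ m *\<^sub>R picard \<nu> a c0 p t k)"
      unfolding picard_sum_def
      by (rule infsum_linear_image[OF bounded_linear_scaleR_right summable_picard[OF assms], symmetric]) (use t in simp)
    also have "norm \<dots> \<le> (\<Sum>\<^sub>\<infinity>p. C * (1 / 2) ^ p)"
      by (rule norm_infsum_le_infsum[OF summable_on_half_powers]) (use C[OF t, of k] in simp)
    finally show ?thesis .
  qed
  then show "\<exists>C. \<forall>t\<in>{0..T}. \<forall>k. weight k ^ m * norm (picard_sum \<nu> a c0 t k) \<le> C" by blast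
qed

lemma picard_sum_initial: "picard_sum \<nu> a c0 0 k = c0 k"
proof -
  have "picard \<nu> a c0 p 0 k = (if p = 0 then c0 k else 0)" for p
    by (cases p) (simp_all add: duhamel_def)
  then have "picard_sum \<nu> a c0 0 k = (\<Sum>\<^sub>\<infinity>p::nat. if p = 0 then c0 k else 0)"
    by (simp add: picard_sum_def)
  also have "\<dots> = (\<Sum>\<^sub>\<infinity>p\<in>{0::nat}. c0 k)" by (rule infsum_cong_neutral) auto
  finally show ?thesis by simp
qed

text \<open>The double series over \<open>p\<close> and \<open>l\<close> has a product of two convergent series as a majorant.\<close>

lemma infsum_leray_transport_picard:
  assumes \<nu>: "\<nu> > 0" and a: "rapid a" and c0: "rapid (\<lambda>_::real. c0)" and t: "t \<ge> 0"
  shows "(\<lambda>p. transport (a t) (picard \<nu> a c0 p t) k) summable_on UNIV"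
    and "(\<Sum>\<^sub>\<infinity>p. leray_symbol k (transport (a t) (picard \<nu> a c0 p t) k)) =
      leray_symbol k (transport (a t) (picard_sum \<nu> a c0 t) k)"
proof -
  let ?F = "\<lambda>p l. (\<i> * fdot k (a t l)) *s picard \<nu> a c0 p t (k - l)"
  obtain M where M: "M summable_on UNIV" "\<And>k. 0 \<le> M k" "\<And>s k. s \<in> {0..t} \<Longrightarrow> norm (a s k) \<le> M k"
    using rapid_majorant0[OF a] by metis
  obtain C where C: "0 \<le> C" "\<And>p s k. s \<in> {0..t} \<Longrightarrow> weight k ^ 0 * norm (picard \<nu> a c0 p s k) \<le> C * (1 / 2) ^ p"
    using picard_bound[OF \<nu> a c0] by metis
  have le: "norm (?F p l) \<le> (norm (real_freq k) * M l) * (C * (1 / 2) ^ p)" for p l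
    using C(2)[of t "k - l" p] M(3)[of t l] M(2)[of l] t
    by (intro order_trans[OF norm_transport_term_le] mult_mono) auto
  have pairs: "(\<lambda>(p, l). ?F p l) summable_on UNIV \<times> UNIV"
  proof -
    have "(\<lambda>q. norm (case q of (p, l) \<Rightarrow> ?F p l)) summable_on UNIV \<times> UNIV"
      unfolding Infinite_Sum.abs_summable_on_Sigma_iff prod.case
    proof (intro conjI ballI)
      have s: "(\<lambda>l. norm (real_freq k) * M l) summable_on UNIV" by (rule summable_on_cmult_right[OF M(1)])
      have sl: "(\<lambda>l. (norm (real_freq k) * M l) * (C * (1 / 2) ^ p)) summable_on UNIV" for p
        by (rule summable_on_cmult_left[OF s])
      show "(\<lambda>l. norm (?F p l)) summable_on UNIV" for p
        by (rule Infinite_Sum.abs_summable_on_comparison_test'[OF sl le])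
      have "norm (norm (\<Sum>\<^sub>\<infinity>l. norm (?F p l))) \<le> (infsum (\<lambda>l. norm (real_freq k) * M l) UNIV * C) * (1 / 2) ^ p" for p
      proof -
        have "norm (\<Sum>\<^sub>\<infinity>l. norm (?F p l)) \<le> (\<Sum>\<^sub>\<infinity>l. (norm (real_freq k) * M l) * (C * (1 / 2) ^ p))"
          by (rule norm_infsum_le_infsum[OF sl]) (use le in simp)
        also have "\<dots> = infsum (\<lambda>l. norm (real_freq k) * M l) UNIV * (C * (1 / 2) ^ p)"
          by (rule infsum_cmult_left')
        finally show ?thesis by (simp add: mult.assoc)
      qed
      then show "(\<lambda>p. norm (\<Sum>\<^sub>\<infinity>l. norm (?F p l))) summable_on UNIV"
        by (rule summable_on_of_norm_le[OF summable_on_half_powers])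
    qed
    from abs_summable_summable[OF this] show ?thesis .
  qed
  show s: "(\<lambda>p. transport (a t) (picard \<nu> a c0 p t) k) summable_on UNIV"
    unfolding transport_def using summable_on_Sigma_banach[OF pairs] by simp
  have "(\<Sum>\<^sub>\<infinity>p. transport (a t) (picard \<nu> a c0 p t) k) = (\<Sum>\<^sub>\<infinity>l. \<Sum>\<^sub>\<infinity>p. ?F p l)"
    unfolding transport_def by (rule infsum_swap_banach[OF pairs])
  also have "\<dots> = transport (a t) (picard_sum \<nu> a c0 t) k"
    unfolding transport_def picard_sum_def
    by (intro infsum_cong infsum_linear_image[OF bounded_linear_smult summable_picard[OF \<nu> a c0 t]])
  finally show "(\<Sum>\<^sub>\<infinity>p. leray_symbol k (transport (a t) (picard \<nu> a c0 p t) k)) =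
      leray_symbol k (transport (a t) (picard_sum \<nu> a c0 t) k)"
    using infsum_linear_image[OF bounded_linear_leray_symbol s] by simp
qed

lemma fourier_solution_picard_sum:
  fixes a :: "real \<Rightarrow> int^'n \<Rightarrow> complex^'n"
  assumes \<nu>: "\<nu> > 0" and a: "rapid a" and c0: "rapid (\<lambda>_::real. c0)"
  shows "fourier_solution \<nu> a (picard_sum \<nu> a c0)"
  unfolding fourier_solution_def
proof (intro allI impI)
  fix k :: "int^'n" and t :: real assume t: "0 \<le> t"
  let ?\<beta> = "visc \<nu> k"
  let ?N = "\<lambda>p s. leray_symbol k (transport (a s) (picard \<nu> a c0 p s) k)"
  \<comment> \<open>the derivative of an increment contains the transport term of the preceding one\<close>
  define r where "r p s = (case p of 0 \<Rightarrow> 0 | Suc q \<Rightarrow> ?N q s)" for p s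
  have Nc: "continuous_on S (?N p)" if "S \<subseteq> {0..}" for p S
    using rapid_continuous_on[OF rapid_leray_transport[OF a rapid_picard[OF assms]] that] by simp
  have deriv: "((\<lambda>s. picard \<nu> a c0 p s k) has_vector_derivative (- ?\<beta>) *\<^sub>R picard \<nu> a c0 p s k + r p s) (at s within {0..})"
    if "s \<ge> 0" for p s
  proof (cases p)
    case 0
    have "((\<lambda>s. exp (- ?\<beta> * s)) has_real_derivative - ?\<beta> * exp (- ?\<beta> * s)) (at s within {0..})"
      by (auto intro!: derivative_eq_intros)
    from has_vector_derivative_scaleR[OF this has_vector_derivative_const[of "c0 k"]]
    show ?thesis using 0 by (simp add: r_def)
  next
    case (Suc q)
    then show ?thesis
      using duhamel_has_vector_derivative[OF Nc[OF order_refl, of q] that, of ?\<beta>] by (simp add: r_def)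
  qed
  obtain M where M: "M summable_on UNIV" "\<And>k. 0 \<le> M k" "\<And>s k. s \<in> {0..t+1} \<Longrightarrow> weight k ^ 0 * norm (a s k) \<le> M k"
    using rapid_majorant[OF a] by metis
  have V: "0 \<le> infsum M UNIV" by (rule infsum_nonneg) (rule M(2))
  obtain C where C: "0 \<le> C" "\<And>p s k. s \<in> {0..t+1} \<Longrightarrow> weight k ^ 0 * norm (picard \<nu> a c0 p s k) \<le> C * (1 / 2) ^ p"
    using picard_bound[OF \<nu> a c0] by metis
  let ?K = "2 * (norm (real_freq k) * infsum M UNIV * C)"
  have r: "norm (r p s) \<le> ?K * (1 / 2) ^ p" if s: "s \<in> {0..t+1}" for p s
  proof (cases p)
    case (Suc q)
    have "weight k ^ 0 * norm (transport (a s) (picard \<nu> a c0 q s) k) \<le> norm (real_freq k) * infsum M UNIV * (C * (1 / 2) ^ q)"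
      by (rule weight_transport_le(2)[OF M(1) M(3)[OF s] C(2)[OF s]]) (use C in simp)
    then have "norm (?N q s) \<le> norm (real_freq k) * infsum M UNIV * (C * (1 / 2) ^ q)"
      by (intro order_trans[OF norm_leray_symbol_le]) simp
    then show ?thesis by (simp add: r_def Suc mult.assoc)
  qed (use V C in \<open>simp add: r_def\<close>)
  have "((\<lambda>s. picard_sum \<nu> a c0 s k) has_vector_derivative
      (\<Sum>\<^sub>\<infinity>p. (- ?\<beta>) *\<^sub>R picard \<nu> a c0 p t k + r p t)) (at t within {0..t+1})"
    unfolding picard_sum_def
  proof (rule has_vector_derivative_infsum)
    show "((\<lambda>s. picard \<nu> a c0 p s k) has_vector_derivative (- ?\<beta>) *\<^sub>R picard \<nu> a c0 p s k + r p s) (at s within {0..t+1})"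
      if "s \<in> {0..t+1}" for p s
      by (rule has_vector_derivative_within_subset[OF deriv]) (use that in auto)
    show "continuous_on {0..t+1} (\<lambda>s. (- ?\<beta>) *\<^sub>R picard \<nu> a c0 p s k + r p s)" for p
    proof -
      have "continuous_on {0..t+1} (r p)"
        by (cases p) (auto simp: r_def[abs_def] intro: Nc)
      then show ?thesis
        by (intro continuous_on_add continuous_on_scaleR continuous_on_const rapid_continuous_on[OF rapid_picard[OF assms]]) auto
    qed
    show "(\<lambda>p. ?\<beta> * (C * (1 / 2) ^ p) + ?K * (1 / 2) ^ p) summable_on UNIV"
      by (intro summable_on_add summable_on_half_powers summable_on_cmult_right)
    show "norm ((- ?\<beta>) *\<^sub>R picard \<nu> a c0 p s k + r p s) \<le> ?\<beta> * (C * (1 / 2) ^ p) + ?K * (1 / 2) ^ p"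
      if s: "s \<in> {0..t+1}" for p s
    proof (rule norm_triangle_le[OF add_mono[OF _ r[OF s]]])
      have "norm ((- ?\<beta>) *\<^sub>R picard \<nu> a c0 p s k) = ?\<beta> * norm (picard \<nu> a c0 p s k)"
        using \<nu> by simp
      also have "\<dots> \<le> ?\<beta> * (C * (1 / 2) ^ p)"
        using C(2)[OF s, of k p] \<nu> by (intro mult_left_mono) auto
      finally show "norm ((- ?\<beta>) *\<^sub>R picard \<nu> a c0 p s k) \<le> ?\<beta> * (C * (1 / 2) ^ p)" .
    qed
    show "(\<lambda>p. picard \<nu> a c0 p s k) summable_on UNIV" if "s \<in> {0..t+1}" for s
      by (rule summable_picard[OF assms]) (use that in simp)
  qed (use t in auto)
  moreover have "(\<Sum>\<^sub>\<infinity>p. (- ?\<beta>) *\<^sub>R picard \<nu> a c0 p t k + r p t) =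
      (- ?\<beta>) *\<^sub>R picard_sum \<nu> a c0 t k + leray_symbol k (transport (a t) (picard_sum \<nu> a c0 t) k)"
  proof (rule infsumI, rule has_sum_add)
    show "((\<lambda>p. (- ?\<beta>) *\<^sub>R picard \<nu> a c0 p t k) has_sum (- ?\<beta>) *\<^sub>R picard_sum \<nu> a c0 t k) UNIV"
      unfolding picard_sum_def
      by (rule has_sum_bounded_linear[OF bounded_linear_scaleR_right has_sum_infsum[OF summable_picard[OF assms t]]])
    have "((\<lambda>p. ?N p t) has_sum leray_symbol k (transport (a t) (picard_sum \<nu> a c0 t) k)) UNIV"
      using infsum_leray_transport_picard(2)[OF assms t, of k]
        summable_on_bounded_linear[OF bounded_linear_leray_symbol infsum_leray_transport_picard(1)[OF assms t, of k], of k]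
      by (simp add: has_sum_iff)
    then have "((\<lambda>p. r (Suc p) t) has_sum leray_symbol k (transport (a t) (picard_sum \<nu> a c0 t) k)) UNIV"
      by (simp add: r_def)
    then have "((\<lambda>p. r p t) has_sum leray_symbol k (transport (a t) (picard_sum \<nu> a c0 t) k)) (range Suc)"
      by (subst has_sum_reindex) (simp_all add: o_def)
    then show "((\<lambda>p. r p t) has_sum leray_symbol k (transport (a t) (picard_sum \<nu> a c0 t) k)) UNIV"
    proof (rule has_sum_cong_neutral[THEN iffD1, rotated -1])
      fix p :: nat assume "p \<in> UNIV - range Suc"
      then show "r p t = 0" by (cases p) (auto simp: r_def)
    qed auto
  qed
  ultimately show "((\<lambda>s. picard_sum \<nu> a c0 s k) has_vector_derivative
      (- ?\<beta>) *\<^sub>R picard_sum \<nu> a c0 t k + leray_symbol k (transport (a t) (picard_sum \<nu> a c0 t) k)) (at t within {0..})"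
    by (intro has_vector_derivative_half_line[where T = "t + 1"]) (use t in simp_all)
qed

section \<open>Regularity in time and reality\<close>

text \<open>Bootstrapping: if \<open>a\<close> and \<open>c\<close> have \<open>j\<close> time derivatives, so has the right-hand side, and then
  \<open>c\<close> has \<open>j + 1\<close> of them.\<close>

lemma Cd_rapid_fourier_solution:
  fixes a c :: "real \<Rightarrow> int^'n \<Rightarrow> complex^'n"
  assumes a: "Cd_rapid r a" and c: "rapid c" and sol: "fourier_solution \<nu> a c"
  shows "j \<le> Suc r \<Longrightarrow> Cd_rapid j c"
proof (induction j)
  case 0
  then show ?case using c by simp
next
  case (Suc j)
  have aj: "Cd_rapid j a" by (rule Cd_rapid_mono[OF _ a]) (use Suc in simp)
  have cj: "Cd_rapid j c" using Suc by simp
  have "Cd_rapid j (\<lambda>t k. (- visc \<nu> k) *\<^sub>R c t k)"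
    by (rule Cd_rapid_multiplier[OF cj bounded_linear_scaleR_right norm_visc_le]) simp
  moreover have "Cd_rapid j (\<lambda>t k. leray_symbol k (transport (a t) (c t) k))"
    by (rule Cd_rapid_multiplier[OF Cd_rapid_transport[OF aj cj] bounded_linear_leray_symbol, where K = 1 and p = 0])
      (auto simp: norm_leray_symbol_le)
  ultimately have "Cd_rapid j (\<lambda>t k. fourier_rhs \<nu> (a t) (c t) k)"
    by (rule Cd_rapid_add)
  then show ?case using c sol unfolding fourier_solution_def Cd_rapid.simps by blast
qed

definition cnjv :: "complex^'n \<Rightarrow> complex^'n" where
  "cnjv w = (\<chi> i. cnj (w $ i))"

lemma norm_cnjv [simp]: "norm (cnjv w) = norm w"
  by (simp add: cnjv_def norm_vec_def)

lemma bounded_linear_cnjv: "bounded_linear cnjv"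
  by (rule bounded_linear_intro[where K = 1]) (auto simp: cnjv_def vec_eq_iff norm_vec_def)

lemma hermitian_cnjv: "hermitian c \<longleftrightarrow> (\<forall>k. c (- k) = cnjv (c k))"
  by (auto simp: hermitian_def cnjv_def vec_eq_iff)

lemma cnjv_smult: "cnjv (z *s w) = cnj z *s cnjv w"
  by (simp add: cnjv_def vec_eq_iff)

lemma cnjv_uminus: "cnjv (- w) = - cnjv w"
  by (simp add: cnjv_def vec_eq_iff)

lemma fdot_cnjv: "fdot k (cnjv w) = cnj (fdot k w)"
  by (simp add: fdot_def cnjv_def cnj_sum)

lemma fdot_uminus: "fdot (- k) w = - fdot k w"
  by (simp add: fdot_def sum_negf)

lemma weight_uminus [simp]: "weight (- k) = weight k"
  by (simp add: weight_def real_freq_uminus)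

lemma leray_symbol_cnjv: "leray_symbol k (cnjv w) = cnjv (leray_symbol (- k) w)"
proof -
  have 1: "cnjv (x - y) = cnjv x - cnjv y" for x y :: "complex^'a" by (simp add: cnjv_def vec_eq_iff)
  have 2: "cnjv (cvec y) = cvec y" for y :: "real^'a" by (simp add: cnjv_def vec_eq_iff)
  have 3: "z *s cvec (- y) = (- z) *s cvec y" for z and y :: "real^'a" by (simp add: vec_eq_iff)
  show ?thesis
    by (simp add: leray_symbol_eq real_freq_uminus 1 2 3 cnjv_smult fdot_cnjv fdot_uminus)
qed

lemma transport_cnjv:
  assumes a: "hermitian a" and s: "(\<lambda>l. (\<i> * fdot (- k) (a l)) *s c (- k - l)) summable_on UNIV"
  shows "transport a (\<lambda>k. cnjv (c (- k))) k = cnjv (transport a c (- k))"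
proof -
  have "cnjv (transport a c (- k)) = (\<Sum>\<^sub>\<infinity>l. cnjv ((\<i> * fdot (- k) (a l)) *s c (- k - l)))"
    unfolding transport_def by (rule infsum_linear_image[OF bounded_linear_cnjv s, symmetric])
  also have "\<dots> = (\<Sum>\<^sub>\<infinity>l. cnjv ((\<i> * fdot (- k) (a (- l))) *s c (- k - (- l))))"
    by (rule infsum_reindex_bij_betw[OF bij_uminus_vec, symmetric])
  also have "\<dots> = (\<Sum>\<^sub>\<infinity>l. (\<i> * fdot k (a l)) *s cnjv (c (- (k - l))))"
  proof (rule infsum_cong)
    fix l
    have "a (- l) = cnjv (a l)" using a by (simp add: hermitian_cnjv)
    then show "cnjv ((\<i> * fdot (- k) (a (- l))) *s c (- k - (- l))) = (\<i> * fdot k (a l)) *s cnjv (c (- (k - l)))"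
      by (simp add: cnjv_smult cnjv_uminus fdot_uminus fdot_cnjv)
  qed
  finally show ?thesis by (simp add: transport_def)
qed

text \<open>The reflected conjugate of a solution is again a solution, hence equal to it.\<close>

lemma hermitian_fourier_solution:
  fixes a c :: "real \<Rightarrow> int^'n \<Rightarrow> complex^'n"
  assumes \<nu>: "\<nu> > 0" and a: "rapid a" and c: "rapid c"
    and div: "\<And>s. s \<ge> 0 \<Longrightarrow> solenoidal (a s)" and herm: "\<And>s. s \<ge> 0 \<Longrightarrow> hermitian (a s)"
    and sol: "fourier_solution \<nu> a c" and init: "hermitian (c 0)" and t: "t \<ge> 0"
  shows "hermitian (c t)"
proof -
  let ?b = "\<lambda>t k. cnjv (c t (- k))"
  have b: "rapid ?b"
  proof (rule rapidI)
    show "continuous_on {0..} (\<lambda>t. ?b t k)" for k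
      by (rule bounded_linear.continuous_on[OF bounded_linear_cnjv rapid_continuous[OF c]])
    fix m T
    obtain C where C: "\<And>t k. t \<in> {0..T} \<Longrightarrow> weight k ^ m * norm (c t k) \<le> C"
      using rapid_bound[OF c] by metis
    have "weight k ^ m * norm (?b t k) \<le> C" if "t \<in> {0..T}" for t k
      using C[OF that, of "- k"] by simp
    then show "\<exists>C. \<forall>t\<in>{0..T}. \<forall>k. weight k ^ m * norm (?b t k) \<le> C" by blast
  qed
  have sb: "fourier_solution \<nu> a ?b"
    unfolding fourier_solution_def
  proof (intro allI impI)
    fix k :: "int^'n" and s :: real assume s: "0 \<le> s"
    have "cnjv ((- (visc \<nu> (- k))) *\<^sub>R c s (- k) + leray_symbol (- k) (transport (a s) (c s) (- k))) =
        fourier_rhs \<nu> (a s) (?b s) k"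
      by (simp only: linear_add[OF bounded_linear.linear[OF bounded_linear_cnjv]]
          linear_scale[OF bounded_linear.linear[OF bounded_linear_cnjv]] real_freq_uminus norm_minus_cancel
          transport_cnjv[OF herm[OF s] summable_transport[OF a c s]] leray_symbol_cnjv)
    then show "((\<lambda>s. ?b s k) has_vector_derivative fourier_rhs \<nu> (a s) (?b s) k)
     (at s within {0..})"
      using bounded_linear.has_vector_derivative[OF bounded_linear_cnjv fourier_solutionD[OF sol s, of "- k"]]
      by (simp only:)
  qed
  have i: "?b 0 k = c 0 k" for k
    using init unfolding hermitian_cnjv by (metis minus_minus)
  have "?b t k = c t k" for k
    by (rule fourier_solution_unique[OF \<nu> a b c div herm sb sol i t])
  then show ?thesis unfolding hermitian_cnjv by (metis minus_minus)
qed

section \<open>The initial value problem\<close>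

lemma dmul_dmul: "dmul j (dmul j c) k = (- (of_int (k $ j))\<^sup>2) *s c k"
proof -
  have "(\<i> * of_int (k $ j)) * (\<i> * of_int (k $ j)) = - (of_int (k $ j) :: complex)\<^sup>2"
    using power_mult_distrib[of \<i> "of_int (k $ j)" 2] by (simp add: power2_eq_square)
  then show ?thesis by (simp only: dmul_def vector_smult_assoc)
qed

lemma rapid_const_leray:
  assumes "rapid (\<lambda>_::real. c)"
  shows "rapid (\<lambda>_::real. \<lambda>k. leray_symbol k (c k))"
  by (rule rapid_multiplier[OF assms bounded_linear_leray_symbol, where K = 1 and p = 0])
    (auto simp: norm_leray_symbol_le)

lemma laplacian_synth:
  fixes c :: "int^'n \<Rightarrow> complex^'n"
  assumes c: "rapid (\<lambda>_::real. c)"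
  shows "laplacian (synth c) x = synth (\<lambda>k. (- (norm (real_freq k))\<^sup>2) *\<^sub>R c k) x"
proof -
  have d: "rapid (\<lambda>_::real. dmul j (dmul j c))" for j
    by (intro rapid_dmul c)
  have "laplacian (synth c) x = (\<Sum>j\<in>UNIV. synth (dmul j (dmul j c)) x)"
    by (simp add: laplacian_def partial_synth[OF c] partial_synth[OF rapid_dmul[OF c]])
  also have "\<dots> = (\<Sum>\<^sub>\<infinity>k. \<Sum>j\<in>UNIV. wave (dmul j (dmul j c) k) (real_freq k \<bullet> x))"
    unfolding synth_def
    by (rule infsumI[symmetric], rule has_sum_sum) (auto intro: has_sum_infsum summable_wave[OF d order_refl])
  also have "\<dots> = synth (\<lambda>k. (- (norm (real_freq k))\<^sup>2) *\<^sub>R c k) x"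
    unfolding synth_def
  proof (rule infsum_cong)
    fix k :: "int^'n"
    have "(\<Sum>j\<in>UNIV. dmul j (dmul j c) k) = (- (norm (real_freq k))\<^sup>2) *\<^sub>R c k"
    proof -
      have "(norm (real_freq k))\<^sup>2 = (\<Sum>j\<in>UNIV. (real_of_int (k $ j))\<^sup>2)"
        unfolding power2_norm_eq_inner inner_vec_def by (simp add: real_freq_nth power2_eq_square)
      then show ?thesis
        by (simp add: dmul_dmul vec_eq_iff sum_negf sum_distrib_right scaleR_conv_of_real[where 'a = complex])
    qed
    then show "(\<Sum>j\<in>UNIV. wave (dmul j (dmul j c) k) (real_freq k \<bullet> x)) = wave ((- (norm (real_freq k))\<^sup>2) *\<^sub>R c k) (real_freq k \<bullet> x)"
      by (simp add: linear_sum[OF bounded_linear.linear[OF bounded_linear_wave], symmetric])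
  qed
  finally show ?thesis .
qed

lemma leray_eq_synth:
  fixes f :: "real^'n \<Rightarrow> real^'n"
  assumes "rapid (\<lambda>_::real. fourier_coeff f)"
  shows "leray f x = synth (\<lambda>k. leray_symbol k (fourier_coeff f k)) x"
proof -
  let ?c = "\<lambda>k. leray_symbol k (fourier_coeff f k)"
  have r: "rapid (\<lambda>_::real. ?c)" by (rule rapid_const_leray[OF assms])
  have "leray f x $ i = synth ?c x $ i" for i
  proof -
    have g: "(\<lambda>k. ?c k $ i * cis (real_freq k \<bullet> x)) summable_on UNIV"
      using summable_on_bounded_linear[OF bounded_linear_vec_nth[of i] summable_modes[OF r, of "\<lambda>l. real_freq l \<bullet> x"]]
      by (simp add: mult.commute)
    have "leray f x $ i = (\<Sum>\<^sub>\<infinity>k. Re (?c k $ i * cis (real_freq k \<bullet> x)))"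
      by (simp only: leray_def leray_series_def vec_lambda_beta infsum_Re[OF g])
    also have "\<dots> = (\<Sum>\<^sub>\<infinity>k. wave (?c k) (real_freq k \<bullet> x) $ i)"
      by (simp only: wave_def vec_lambda_beta)
    also have "\<dots> = synth ?c x $ i"
      unfolding synth_def by (rule infsum_linear_image[OF bounded_linear_vec_nth summable_wave[OF r order_refl]])
    finally show ?thesis .
  qed
  then show ?thesis by (simp add: vec_eq_iff)
qed

lemma hermitian_leray: "hermitian (\<lambda>k. leray_symbol k (fourier_coeff f k))"
  by (simp add: hermitian_def leray_symbol_uminus)

lemma synth_add:
  assumes "rapid (\<lambda>_::real. a)" "rapid (\<lambda>_::real. b)"
  shows "synth (\<lambda>k. a k + b k) x = synth a x + synth b x"
proof -
  have "wave (a k + b k) \<theta> = wave (a k) \<theta> + wave (b k) \<theta>" for k \<theta>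
    by (rule linear_add[OF bounded_linear.linear[OF bounded_linear_wave]])
  then show ?thesis
    by (simp add: synth_def infsum_add[OF summable_wave[OF assms(1) order_refl] summable_wave[OF assms(2) order_refl]])
qed

lemma synth_scaleR:
  assumes "rapid (\<lambda>_::real. a)"
  shows "synth (\<lambda>k. r *\<^sub>R a k) x = r *\<^sub>R synth a x"
proof -
  have "wave (r *\<^sub>R a k) \<theta> = r *\<^sub>R wave (a k) \<theta>" for k \<theta>
    by (rule linear_scale[OF bounded_linear.linear[OF bounded_linear_wave]])
  then show ?thesis
    using infsum_linear_image[OF bounded_linear_scaleR_right summable_wave[OF assms order_refl]]
    by (simp add: synth_def)
qed

lemma rapid_laplace:
  fixes c :: "int^'n \<Rightarrow> complex^'n"
  assumes "rapid (\<lambda>_::real. c)"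
  shows "rapid (\<lambda>_::real. \<lambda>k. (- (norm (real_freq k))\<^sup>2) *\<^sub>R c k)"
  using rapid_multiplier[OF assms bounded_linear_scaleR_right norm_visc_le[of 1]] by simp

text \<open>Each term of the equation is a synthesis: the Laplacian by term by term differentiation, the
  Leray projection by definition.\<close>

lemma rhs_eq_synth:
  fixes v u :: "real^'n \<Rightarrow> real^'n"
  assumes v: "smooth_torus v" and u: "smooth_torus u" and div: "\<And>x. divergence v x = 0"
  defines "c \<equiv> fourier_coeff u" and "a \<equiv> fourier_coeff v"
  shows "rapid (\<lambda>_::real. \<lambda>k. fourier_rhs \<nu> a c k)"
    and "hermitian (\<lambda>k. fourier_rhs \<nu> a c k)"
    and "\<nu> *\<^sub>R laplacian u x + leray (advection v u) x =
      synth (\<lambda>k. fourier_rhs \<nu> a c k) x"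
proof -
  have c: "rapid (\<lambda>_::real. c)" and a: "rapid (\<lambda>_::real. a)"
    unfolding c_def a_def by (rule rapid_fourier_coeff_const[OF u], rule rapid_fourier_coeff_const[OF v])
  have adv: "fourier_coeff (advection v u) = transport a c"
    unfolding a_def c_def by (rule ext, rule fourier_coeff_advection[OF v u div])
  have t: "rapid (\<lambda>_::real. fourier_coeff (advection v u))"
    unfolding adv by (rule rapid_transport[OF a c])
  let ?L = "\<lambda>k. (- (norm (real_freq k))\<^sup>2) *\<^sub>R c k" and ?T = "\<lambda>k. leray_symbol k (transport a c k)"
  have L: "rapid (\<lambda>_::real. ?L)" by (rule rapid_laplace[OF c])
  have \<nu>L: "rapid (\<lambda>_::real. \<lambda>k. \<nu> *\<^sub>R ?L k)"
    by (rule rapid_multiplier[OF L bounded_linear_scaleR_right, where K = "\<bar>\<nu>\<bar>" and p = 0]) auto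
  have T: "rapid (\<lambda>_::real. ?T)" using rapid_const_leray[OF t] by (simp add: adv)
  have eq: "(\<lambda>k. (- visc \<nu> k) *\<^sub>R c k + ?T k) = (\<lambda>k. \<nu> *\<^sub>R ?L k + ?T k)"
    by (simp add: fun_eq_iff)
  show "rapid (\<lambda>_::real. \<lambda>k. (- visc \<nu> k) *\<^sub>R c k + ?T k)"
    unfolding eq by (rule rapid_add[OF \<nu>L T])
  show "hermitian (\<lambda>k. (- visc \<nu> k) *\<^sub>R c k + ?T k)"
    using hermitian_leray[of "advection v u"] hermitian_fourier_coeff[of u]
    unfolding adv c_def[symmetric] hermitian_def by (simp add: real_freq_uminus)
  have "laplacian u x = laplacian (synth c) x"
  proof -
    have "synth c = u" unfolding c_def by (rule ext, rule synth_fourier_coeff[OF u])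
    then show ?thesis by simp
  qed
  then show "\<nu> *\<^sub>R laplacian u x + leray (advection v u) x = synth (\<lambda>k. (- visc \<nu> k) *\<^sub>R c k + ?T k) x"
    unfolding eq synth_add[OF \<nu>L T] synth_scaleR[OF L] laplacian_synth[OF c, symmetric] leray_eq_synth[OF t] adv
    by simp
qed

lemma Cd_smooth_imp_0: "Cd_smooth d I f \<Longrightarrow> Cd_smooth 0 I f"
  by (cases d) (auto simp: Cd_smooth_Suc_iff)

text \<open>The time derivative of \<open>u\<close> is jointly continuous, so it may be taken inside the integrals that
  define the coefficients.\<close>

lemma ivp_solution_imp_fourier_solution:
  fixes u v :: "real \<Rightarrow> real^'n \<Rightarrow> real^'n"
  assumes v: "Cd_smooth r {0..} v" and div: "\<And>t x. t \<ge> 0 \<Longrightarrow> divergence (v t) x = 0"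
    and u: "ivp_solution \<nu> r v u0 u"
  shows "rapid (\<lambda>t. fourier_coeff (u t))"
    and "fourier_solution \<nu> (\<lambda>t. fourier_coeff (v t)) (\<lambda>t. fourier_coeff (u t))"
proof -
  have su: "Cd_smooth (Suc r) {0..} u" using u by (simp add: ivp_solution_def)
  have u0: "Cd_smooth 0 {0..} u" by (rule Cd_smooth_imp_0[OF su])
  have ut: "smooth_torus (u t)" and vt: "smooth_torus (v t)" if "t \<ge> 0" for t
    using Cd_smooth_0D(1)[OF su] Cd_smooth_0D(1)[OF v] that by auto
  show "rapid (\<lambda>t. fourier_coeff (u t))" by (rule rapid_fourier_coeff[OF u0])
  let ?R = "\<lambda>t x. \<nu> *\<^sub>R laplacian (u t) x + leray (advection (v t) (u t)) x"
  have eq: "((\<lambda>s. u s x) has_vector_derivative ?R t x) (at t within {0..})" if "t \<ge> 0" for t x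
    using u that by (simp add: ivp_solution_def)
  have cont: "continuous_on ({0..} \<times> UNIV) (\<lambda>(t, x). ?R t x)"
  proof (rule continuous_on_eq)
    have "Cd_smooth 0 {0..} (time_deriv {0..} u)"
      using su by (auto simp: Cd_smooth_Suc_iff intro: Cd_smooth_imp_0)
    then show "continuous_on ({0..} \<times> UNIV) (\<lambda>(t, x). time_deriv {0..} u t x)"
      using Cd_smooth_0D(2)[of 0 "{0..}" "time_deriv {0..} u" "[]"] by simp
    show "(case p of (t, x) \<Rightarrow> time_deriv {0..} u t x) = (case p of (t, x) \<Rightarrow> ?R t x)" if "p \<in> {0..} \<times> UNIV" for p
      using that time_deriv_eqI[OF eq] by auto
  qed
  show "fourier_solution \<nu> (\<lambda>t. fourier_coeff (v t)) (\<lambda>t. fourier_coeff (u t))"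
    unfolding fourier_solution_def
  proof (intro allI impI)
    fix k :: "int^'n" and t :: real assume t: "0 \<le> t"
    have "((\<lambda>s. fourier_coeff (u s) k) has_vector_derivative fourier_coeff (?R t) k) (at t within {0..})"
      by (rule fourier_coeff_has_vector_derivative[OF eq smooth_torus_continuous[OF ut] cont t])
    moreover have "fourier_coeff (?R t) k = fourier_rhs \<nu> (fourier_coeff (v t)) (fourier_coeff (u t)) k"
      unfolding rhs_eq_synth(3)[OF vt[OF t] ut[OF t] div[OF t]]
      by (rule fourier_coeff_synth[OF rhs_eq_synth(1)[OF vt[OF t] ut[OF t] div[OF t]]
            rhs_eq_synth(2)[OF vt[OF t] ut[OF t] div[OF t]]])
    ultimately show "((\<lambda>s. fourier_coeff (u s) k) has_vector_derivative fourier_rhs \<nu> (fourier_coeff (v t)) (fourier_coeff (u t)) k)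
     (at t within {0..})"
      by (simp only:)
  qed
qed

lemma ivp_solution_unique:
  fixes u v w :: "real \<Rightarrow> real^'n \<Rightarrow> real^'n"
  assumes \<nu>: "\<nu> > 0" and v: "Cd_smooth r {0..} v" and div: "\<And>t x. t \<ge> 0 \<Longrightarrow> divergence (v t) x = 0"
    and u: "ivp_solution \<nu> r v u0 u" and w: "ivp_solution \<nu> r v u0 w" and t: "t \<ge> 0"
  shows "w t x = u t x"
proof (rule eq_if_fourier_coeff_eq[where f = "w t" and g = "u t"])
  have "smooth_torus (u t)" "smooth_torus (w t)"
    using u w t Cd_smooth_0D(1)[of "Suc r" "{0..}"] by (auto simp: ivp_solution_def)
  then show "periodic_2pi (w t)" "continuous_on UNIV (w t)" "periodic_2pi (u t)" "continuous_on UNIV (u t)"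
    by (auto simp: smooth_torus_continuous) (auto simp: smooth_torus_def)
  have init: "fourier_coeff (w 0) k = fourier_coeff (u 0) k" for k
    using u w by (simp add: ivp_solution_def fourier_coeff_def)
  show "fourier_coeff (w t) k = fourier_coeff (u t) k" for k
  proof (rule fourier_solution_unique[OF \<nu> rapid_fourier_coeff[OF Cd_smooth_imp_0[OF v]]
        ivp_solution_imp_fourier_solution(1)[OF v div w] ivp_solution_imp_fourier_solution(1)[OF v div u] _ _
        ivp_solution_imp_fourier_solution(2)[OF v div w] ivp_solution_imp_fourier_solution(2)[OF v div u] init t])
    show "solenoidal (fourier_coeff (v s))" if "s \<ge> 0" for s
      using Cd_smooth_0D(1)[OF v] that by (intro solenoidal_fourier_coeff div) auto
  qed (auto simp: hermitian_fourier_coeff)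
qed

text \<open>The coefficients of the synthesis of \<open>picard_sum\<close> are those put in, as they are Hermitian; so
  the system of ordinary differential equations gives back the equation.\<close>

lemma ivp_solution_exists:
  fixes v :: "real \<Rightarrow> real^'n \<Rightarrow> real^'n"
  assumes \<nu>: "\<nu> > 0" and v: "Cd_smooth r {0..} v" and div: "\<And>t x. t \<ge> 0 \<Longrightarrow> divergence (v t) x = 0"
    and u0: "smooth_torus u0"
  shows "\<exists>u. ivp_solution \<nu> r v u0 u"
proof -
  let ?a = "\<lambda>t. fourier_coeff (v t)" and ?c0 = "fourier_coeff u0"
  define c where "c = picard_sum \<nu> ?a ?c0"
  have ar: "Cd_rapid r ?a" by (rule Cd_rapid_fourier_coeff[OF v])
  have a: "rapid ?a" by (rule Cd_rapid_imp_rapid[OF ar])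
  have c0: "rapid (\<lambda>_::real. ?c0)" by (rule rapid_fourier_coeff_const[OF u0])
  have c: "rapid c" unfolding c_def by (rule rapid_picard_sum[OF \<nu> a c0])
  have sol: "fourier_solution \<nu> ?a c" unfolding c_def by (rule fourier_solution_picard_sum[OF \<nu> a c0])
  have init: "c 0 = ?c0" unfolding c_def by (rule ext, rule picard_sum_initial)
  have vt: "smooth_torus (v t)" if "t \<ge> 0" for t using Cd_smooth_0D(1)[OF v] that by auto
  have herm: "hermitian (c t)" if "t \<ge> 0" for t
    by (rule hermitian_fourier_solution[OF \<nu> a c _ hermitian_fourier_coeff sol _ that])
      (use vt div init hermitian_fourier_coeff in \<open>auto intro: solenoidal_fourier_coeff\<close>)
  have cr: "Cd_rapid (Suc r) c" by (rule Cd_rapid_fourier_solution[OF ar c sol order_refl])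
  let ?u = "\<lambda>t. synth (c t)"
  have ut: "smooth_torus (?u t)" if "t \<ge> 0" for t by (rule smooth_torus_synth[OF rapid_at[OF c that]])
  have cu: "fourier_coeff (?u t) = c t" if "t \<ge> 0" for t
    by (rule ext, rule fourier_coeff_synth[OF rapid_at[OF c that] herm[OF that]])
  have "((\<lambda>s. ?u s x) has_vector_derivative
        (\<nu> *\<^sub>R laplacian (?u t) x + leray (advection (v t) (?u t)) x)) (at t within {0..})" if t: "t \<ge> 0" for t x
  proof -
    let ?c' = "\<lambda>t k. fourier_rhs \<nu> (?a t) (c t) k"
    have "rapid ?c'"
    proof (rule rapid_add)
      show "rapid (\<lambda>t k. (- visc \<nu> k) *\<^sub>R c t k)"
        by (rule rapid_multiplier[OF c bounded_linear_scaleR_right norm_visc_le]) simp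
    qed (rule rapid_leray_transport[OF a c])
    from synth_has_time_derivative[OF c this fourier_solutionD[OF sol] t, of x]
    show ?thesis
      unfolding rhs_eq_synth(3)[OF vt[OF t] ut[OF t] div[OF t]] cu[OF t] .
  qed
  then have "ivp_solution \<nu> r v u0 ?u"
    using Cd_smooth_synth[OF cr] synth_fourier_coeff[OF u0] by (simp add: ivp_solution_def init)
  then show ?thesis by blast
qed

lemma integral_eq_fourier_coeff_0:
  fixes f :: "real^'n \<Rightarrow> real^'n"
  assumes "continuous_on torus_cell f"
  shows "cvec (integral torus_cell f) = (2 * pi) ^ CARD('n) *\<^sub>R fourier_coeff f 0"
proof -
  have one: "cis (- (real_freq 0 \<bullet> x)) *s cvec (f x) = cvec (f x)" for x
    by (simp add: vec_eq_iff)
  have "(2 * pi) ^ CARD('n) *\<^sub>R fourier_coeff f 0 = integral torus_cell (\<lambda>x. cvec (f x))"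
    unfolding fourier_coeff_eq[OF assms] one by simp
  also have "\<dots> = cvec (integral torus_cell f)"
    using integral_linear[OF integrable_torus_cell[OF assms] bounded_linear_cvec] by (simp add: o_def)
  finally show ?thesis by simp
qed

text \<open>The a priori bound in physical terms. The integrating factor in front of the source terms
  is at most one if \<open>\<kappa> \<ge> 0\<close>, and there are no such terms if \<open>d \<le> 1\<close>.\<close>

lemma normA_bound:
  fixes u v :: "real \<Rightarrow> real^'n \<Rightarrow> real^'n"
  assumes v: "Cd_smooth r {0..} v" and div: "\<And>t x. t \<ge> 0 \<Longrightarrow> divergence (v t) x = 0"
    and u: "ivp_solution \<nu> r v u0 u" and t: "t \<ge> 0" and \<kappa>: "continuous_on {0..t} \<kappa>"
    and \<kappa>_bound: "\<And>s x. s \<in> {0..t} \<Longrightarrow> x \<ge> 1 \<Longrightarrow> normA 0 (v s) * x - \<nu> * x\<^sup>2 \<le> \<kappa> s"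
    and sign: "d \<ge> 2 \<Longrightarrow> \<forall>s\<in>{0..t}. 0 \<le> \<kappa> s"
  shows "normA d (u t) \<le> exp (integral {0..t} \<kappa> + real d * integral {0..t} (\<lambda>s. normA 1 (v s))) *
    (normA d u0 + (\<Sum>j=2..d. real (d choose j) * integral {0..t} (\<lambda>s. normA j (v s)) *
          (SUP s\<in>{0..t}. normA (d + 1 - j) (u s))))"
proof -
  let ?a = "\<lambda>t. fourier_coeff (v t)" and ?c = "\<lambda>t. fourier_coeff (u t)"
  have a: "rapid ?a" by (rule rapid_fourier_coeff[OF Cd_smooth_imp_0[OF v]])
  have c: "rapid ?c" by (rule ivp_solution_imp_fourier_solution(1)[OF v div u])
  have sub: "{0..t} \<subseteq> {0..}" by auto
  have cv: "continuous_on {0..s} (\<lambda>s. normA j (v s))" and cu: "continuous_on {0..s} (\<lambda>s. normA j (u s))" for j s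
    unfolding normA_eq_cnorm by (rule continuous_cnorm[OF a], simp) (rule continuous_cnorm[OF c], simp)
  have nn: "0 \<le> normA j f" for j and f :: "real^'n \<Rightarrow> real^'n"
    by (simp add: normA_eq_cnorm cnorm_nonneg)
  have sup: "normA j (u s) \<le> (SUP s\<in>{0..t}. normA j (u s))" if "s \<in> {0..t}" for j s
  proof (rule cSUP_upper[OF that])
    show "bdd_above ((\<lambda>s. normA j (u s)) ` {0..t})"
      by (rule bounded_imp_bdd_above[OF compact_imp_bounded[OF compact_continuous_image[OF cu compact_Icc]]])
  qed
  let ?S = "\<lambda>j. SUP s\<in>{0..t}. normA j (u s)"
  let ?\<alpha> = "\<lambda>s. \<kappa> s + real d * normA 1 (v s)"
  let ?A = "\<lambda>s. integral {0..s} ?\<alpha>"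
  let ?b = "\<lambda>s. \<Sum>j=2..d. real (d choose j) * (normA j (v s) * normA (d + 1 - j) (u s))"
  have init: "normA d (u 0) = normA d u0"
    using u by (simp add: ivp_solution_def normA_def fourier_coeff_def)
  have bound: "normA d (u t) \<le> exp (?A t) * (normA d u0 + integral {0..t} (\<lambda>s. exp (- ?A s) * ?b s))"
    using a_priori_bound[OF a c ivp_solution_imp_fourier_solution(2)[OF v div u] _ hermitian_fourier_coeff t \<kappa>, of d]
      \<kappa>_bound solenoidal_fourier_coeff[OF Cd_smooth_0D(1)[OF v] div] init
    unfolding normA_eq_cnorm by simp
  have "?A t = integral {0..t} \<kappa> + real d * integral {0..t} (\<lambda>s. normA 1 (v s))"
    by (subst integral_add) (auto intro!: integrable_continuous_real continuous_intros \<kappa> cv)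
  moreover have "integral {0..t} (\<lambda>s. exp (- ?A s) * ?b s) \<le> (\<Sum>j=2..d. real (d choose j) * integral {0..t} (\<lambda>s. normA j (v s)) * ?S (d + 1 - j))"
  proof (cases "d \<ge> 2")
    case False
    then show ?thesis by simp
  next
    case True
    have A: "continuous_on {0..t} ?A"
      by (rule continuous_on_vector_derivative[OF integral_has_vector_derivative]) (auto intro!: continuous_intros \<kappa> cv)
    have "integral {0..t} (\<lambda>s. exp (- ?A s) * ?b s) \<le> integral {0..t} (\<lambda>s. \<Sum>j=2..d. real (d choose j) * normA j (v s) * ?S (d + 1 - j))"
    proof (rule integral_le)
      show "(\<lambda>s. exp (- ?A s) * ?b s) integrable_on {0..t}"
        by (intro integrable_continuous_real continuous_on_mult continuous_on_exp continuous_on_minus A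
            continuous_on_sum continuous_on_const cv cu)
      show "(\<lambda>s. \<Sum>j=2..d. real (d choose j) * normA j (v s) * ?S (d + 1 - j)) integrable_on {0..t}"
        by (intro integrable_continuous_real continuous_on_mult continuous_on_sum continuous_on_const cv)
      fix s assume s: "s \<in> {0..t}"
      have "0 \<le> ?A s"
        using sign True s
        by (intro integral_nonneg integrable_continuous_real continuous_intros continuous_on_subset[OF \<kappa>] cv)
          (auto simp: nn)
      then have "exp (- ?A s) * ?b s \<le> 1 * ?b s"
        by (intro mult_right_mono sum_nonneg mult_nonneg_nonneg nn) auto
      also have "1 * ?b s \<le> (\<Sum>j=2..d. real (d choose j) * normA j (v s) * ?S (d + 1 - j))"
        unfolding mult_1 mult.assoc by (intro sum_mono mult_left_mono sup[OF s] nn) auto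
      finally show "exp (- ?A s) * ?b s \<le> (\<Sum>j=2..d. real (d choose j) * normA j (v s) * ?S (d + 1 - j))" .
    qed
    also have "\<dots> = (\<Sum>j=2..d. real (d choose j) * integral {0..t} (\<lambda>s. normA j (v s)) * ?S (d + 1 - j))"
      by (subst integral_sum) (auto intro!: integrable_continuous_real continuous_on_mult continuous_on_const cv)
    finally show ?thesis .
  qed
  then have "exp (?A t) * (normA d u0 + integral {0..t} (\<lambda>s. exp (- ?A s) * ?b s)) \<le>
      exp (?A t) * (normA d u0 + (\<Sum>j=2..d. real (d choose j) * integral {0..t} (\<lambda>s. normA j (v s)) * ?S (d + 1 - j)))"
    by (intro mult_left_mono add_left_mono) auto
  ultimately show ?thesis using bound by (simp only:) 
qed

theorem theorem2p2:
  fixes r :: nat and \<nu> :: real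
    and v :: "real \<Rightarrow> real^'n \<Rightarrow> real^'n"
    and u0 :: "real^'n \<Rightarrow> real^'n"
  assumes "CARD('n) \<ge> 2"
    and "\<nu> > 0"
    and "Cd_smooth r {0..} v"
    and "\<And>t x. t \<ge> 0 \<Longrightarrow> divergence (v t) x = 0"
    and "smooth_torus u0"
    and "\<And>x. divergence u0 x = 0"
  shows "\<exists>u. ivp_solution \<nu> r v u0 u \<and>
    (\<forall>w. ivp_solution \<nu> r v u0 w \<longrightarrow> (\<forall>t\<ge>0. \<forall>x. w t x = u t x)) \<and>
    (\<forall>t\<ge>0. integral torus_cell (u t) = integral torus_cell u0) \<and>
    (\<forall>t\<ge>0. normA 0 (u t) \<le>
       normA 0 u0 * exp (1 / (4 * \<nu>) * integral {0..t} (\<lambda>s. (normA 0 (v s))\<^sup>2))) \<and>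
    (\<forall>t\<ge>0. normA 1 (u t) \<le>
       normA 1 u0 * exp (integral {0..t} (\<lambda>s. normA 1 (v s)) +
         1 / (4 * \<nu>) * integral {0..t} (\<lambda>s. (normA 0 (v s))\<^sup>2))) \<and>
    (\<forall>d\<ge>2. \<forall>t\<ge>0. normA d (u t) \<le>
       exp (1 / (4 * \<nu>) * integral {0..t} (\<lambda>s. (normA 0 (v s))\<^sup>2) +
            real d * integral {0..t} (\<lambda>s. normA 1 (v s))) *
       (normA d u0 + (\<Sum>j=2..d. real (d choose j) * integral {0..t} (\<lambda>s. normA j (v s)) *
          (SUP s\<in>{0..t}. normA (d + 1 - j) (u s))))) \<and>
    (\<forall>\<tau>\<ge>0. \<forall>\<delta>\<ge>0. (\<forall>t\<in>{0..\<tau>}. normA 0 (v t) + \<delta> \<le> \<nu>) \<longrightarrow>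
       (\<forall>t\<in>{0..\<tau>}. normA 0 (u t) \<le> normA 0 u0 * exp (- (\<delta> * t)) \<and>
         normA 1 (u t) \<le>
           normA 1 u0 * exp (integral {0..t} (\<lambda>s. normA 1 (v s)) - \<delta> * t)))"
proof -
  note \<nu> = assms(2) and v = assms(3) and div = assms(4) and u0 = assms(5)
  obtain u where u: "ivp_solution \<nu> r v u0 u"
    using ivp_solution_exists[OF \<nu> v div u0] by blast
  have a: "rapid (\<lambda>t. fourier_coeff (v t))"
    by (rule rapid_fourier_coeff[OF Cd_smooth_imp_0[OF v]])
  have mean: "integral torus_cell (u t) = integral torus_cell u0" if t: "t \<ge> 0" for t
  proof -
    have "smooth_torus (u t)"
      using u t Cd_smooth_0D(1)[of "Suc r" "{0..}"] by (auto simp: ivp_solution_def)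
    then have "cvec (integral torus_cell (u t)) = (2 * pi) ^ CARD('n) *\<^sub>R fourier_coeff (u t) 0"
      by (intro integral_eq_fourier_coeff_0 smooth_torus_continuous)
    also have "fourier_coeff (u t) 0 = fourier_coeff (u 0) 0"
      by (rule fourier_solution_zero_mode[OF ivp_solution_imp_fourier_solution(2)[OF v div u] t])
    also have "fourier_coeff (u 0) 0 = fourier_coeff u0 0"
      using u by (simp add: ivp_solution_def fourier_coeff_def)
    also have "(2 * pi) ^ CARD('n) *\<^sub>R fourier_coeff u0 0 = cvec (integral torus_cell u0)"
      by (rule integral_eq_fourier_coeff_0[OF smooth_torus_continuous[OF u0], symmetric])
    finally show ?thesis by (simp add: vec_eq_iff)
  qed
  have viscous: "normA d (u t) \<le> exp (1 / (4 * \<nu>) * integral {0..t} (\<lambda>s. (normA 0 (v s))\<^sup>2) +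
            real d * integral {0..t} (\<lambda>s. normA 1 (v s))) *
       (normA d u0 + (\<Sum>j=2..d. real (d choose j) * integral {0..t} (\<lambda>s. normA j (v s)) *
          (SUP s\<in>{0..t}. normA (d + 1 - j) (u s))))" if t: "t \<ge> 0" for d t
  proof -
    have "continuous_on {0..t} (\<lambda>s. 1 / (4 * \<nu>) * (normA 0 (v s))\<^sup>2)"
      unfolding normA_eq_cnorm by (intro continuous_intros continuous_cnorm[OF a]) simp
    from normA_bound[OF v div u t this quadratic_le[OF \<nu>], of d] show ?thesis
      using \<nu> by simp
  qed
  \<comment> \<open>as \<open>x \<le> x\<^sup>2\<close> for \<open>x \<ge> 1\<close>, the choice \<open>\<kappa> = - \<delta>\<close> is admissible\<close>
  have small: "normA d (u t) \<le> exp (- (\<delta> * t) + real d * integral {0..t} (\<lambda>s. normA 1 (v s))) * normA d u0"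
    if le: "\<forall>t\<in>{0..\<tau>}. normA 0 (v t) + \<delta> \<le> \<nu>" and \<delta>: "\<delta> \<ge> 0" and t: "t \<in> {0..\<tau>}" and d: "d < 2"
    for \<tau> \<delta> t d
  proof -
    have "normA 0 (v s) * x - \<nu> * x\<^sup>2 \<le> - \<delta>" if s: "s \<in> {0..t}" and x: "x \<ge> 1" for s x
    proof -
      have vs: "normA 0 (v s) \<le> \<nu> - \<delta>" using le s t by (auto simp: algebra_simps)
      have n: "0 \<le> normA 0 (v s)" by (simp add: normA_eq_cnorm cnorm_nonneg)
      have "normA 0 (v s) * x - \<nu> * x\<^sup>2 \<le> (\<nu> - \<delta>) * x\<^sup>2 - \<nu> * x\<^sup>2"
        using vs n x self_le_power[OF x, of 2] by (intro diff_right_mono mult_mono) auto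
      also have "\<dots> = - (\<delta> * x\<^sup>2)" by (simp add: algebra_simps)
      also have "\<dots> \<le> - \<delta>" using \<delta> one_le_power[OF x, of 2] by (simp add: mult_le_cancel_left1)
      finally show ?thesis .
    qed
    from normA_bound[OF v div u _ continuous_on_const this, of t d] show ?thesis
      using t d by (simp add: mult.commute)
  qed
  show ?thesis
  proof (intro exI[of _ u] conjI allI impI ballI)
    show "ivp_solution \<nu> r v u0 u" by (rule u)
    show "w t x = u t x" if "ivp_solution \<nu> r v u0 w" "t \<ge> 0" for w t x
      by (rule ivp_solution_unique[OF \<nu> v div u that])
    show "integral torus_cell (u t) = integral torus_cell u0" if "t \<ge> 0" for t
      by (rule mean[OF that])
    show "normA 0 (u t) \<le> normA 0 u0 * exp (1 / (4 * \<nu>) * integral {0..t} (\<lambda>s. (normA 0 (v s))\<^sup>2))"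
      if "t \<ge> 0" for t
      using viscous[OF that, of 0] by (simp add: mult.commute)
    show "normA 1 (u t) \<le> normA 1 u0 * exp (integral {0..t} (\<lambda>s. normA 1 (v s)) +
         1 / (4 * \<nu>) * integral {0..t} (\<lambda>s. (normA 0 (v s))\<^sup>2))" if "t \<ge> 0" for t
      using viscous[OF that, of 1] by (simp add: mult.commute add.commute)
    show "normA d (u t) \<le> exp (1 / (4 * \<nu>) * integral {0..t} (\<lambda>s. (normA 0 (v s))\<^sup>2) +
            real d * integral {0..t} (\<lambda>s. normA 1 (v s))) *
       (normA d u0 + (\<Sum>j=2..d. real (d choose j) * integral {0..t} (\<lambda>s. normA j (v s)) *
          (SUP s\<in>{0..t}. normA (d + 1 - j) (u s))))" if "d \<ge> 2" "t \<ge> 0" for d t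
      by (rule viscous[OF that(2)])
    show "normA 0 (u t) \<le> normA 0 u0 * exp (- (\<delta> * t))"
      if "0 \<le> \<delta>" "\<forall>t\<in>{0..\<tau>}. normA 0 (v t) + \<delta> \<le> \<nu>" "t \<in> {0..\<tau>}" for \<tau> \<delta> t
      using small[OF that(2,1,3), of 0] by (simp add: mult.commute)
    show "normA 1 (u t) \<le> normA 1 u0 * exp (integral {0..t} (\<lambda>s. normA 1 (v s)) - \<delta> * t)"
      if "0 \<le> \<delta>" "\<forall>t\<in>{0..\<tau>}. normA 0 (v t) + \<delta> \<le> \<nu>" "t \<in> {0..\<tau>}" for \<tau> \<delta> t
      using small[OF that(2,1,3), of 1] by (simp add: mult.commute add.commute)
  qed
qed

end
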